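(* Let $\mathbb{G}$ be a Carnot group, and let $1\le p<\infty$. For any $\nu\in\mathbb{S}^{m-1}=\{\nu\in\mathbb{R}^m\mid\|\nu\|=1\}$ and $t>0$ we have $$\frac{1}{t^{p/2}}\int_{\mathbb{G}}p(g,e,t)\,|\langle\nu,z\rangle|^p\,dg=\frac{2\,\Gamma(p)}{\Gamma(p/2)},\qquad g=(z,\sigma),$$ and $$\sqrt{4\pi t}\int_{\{z\in\mathbb{R}^m\mid\langle z,\nu\rangle=0\}\times\mathbb{R}^{N-m}}p\big((z,\sigma),e,t\big)\,dz\,d\sigma=1,$$ where in the second integral $dz$ denotes $(m-1)$-dimensional Lebesgue measure on the hyperplane $\{\langle z,\nu\rangle=0\}$.
   Context: A Carnot group of step $r\in\mathbb{N}$ is a simply connected real Lie group $(\mathbb{G},\circ)$ whose Lie algebra $\mathfrak{g}$ is stratified and $r$-nilpotent: $\mathfrak{g}=\mathfrak{g}_1\oplus\dots\oplus\mathfrak{g}_r$ with $[\mathfrak{g}_1,\mathfrak{g}_j]=\mathfrak{g}_{j+1}$ for $j=1,\dots,r-1$ and $[\mathfrak{g}_1,\mathfrak{g}_r]=\{0\}$. The Lie algebra carries a scalar product for which the layers are mutually orthogonal; $m=\dim\mathfrak{g}_1$, $N=\dim\mathfrak{g}$, and $\{e_1,\dots,e_m\}$ is an orthonormal basis of $\mathfrak{g}_1$. Via the exponential map (a diffeomorphism) and orthonormal bases of the layers, $g\in\mathbb{G}$ is identified with its logarithmic coordinates $(z,\sigma)$, where $z\in\mathbb{R}^m$ are the coordinates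 of the $\mathfrak{g}_1$ component of $\exp^{-1}g$ and $\sigma\in\mathbb{R}^{N-m}$ those of the components in $\mathfrak{g}_2\oplus\dots\oplus\mathfrak{g}_r$; $e$ is the identity of $\mathbb{G}$. $dg=dz\,d\sigma$ is the bi-invariant Haar measure obtained by lifting Lebesgue measure on $\mathfrak{g}$. The left-invariant vector fields are $X_iu(g)=\frac{d}{ds}u(g\circ\exp(se_i))|_{s=0}$, $i=1,\dots,m$. The horizontal Laplacian is $\mathscr{L}=\sum_{i=1}^mX_i^2$, $P_t$ is the heat semigroup generated by $\mathscr{L}$ (so that $u(\cdot,t)=P_tf$ solves $\partial_tu=\mathscr{L}u$, $u(\cdot,0)=f$), and $p(g,g',t)$ is its (positive, smooth, symmetric) heat kernel: $P_tf(g)=\int_{\mathbb{G}}p(g,g',t)f(g')\,dg'$. *)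

theory Defs
  imports "HOL-Analysis.Analysis"
begin

text \<open>
  A Carnot group is represented in logarithmic coordinates: the underlying set is the Lie
  algebra itself, a Euclidean space \<^typ>\<open>'a\<close> whose inner product is the scalar product making the
  layers orthogonal, the exponential map is the identity, the neutral element is \<^term>\<open>0\<close>, and the
  bi-invariant Haar measure is \<^const>\<open>lborel\<close>.
\<close>

section \<open>Smooth functions\<close>

primrec C_k_on :: "nat \<Rightarrow> 'a::euclidean_space set \<Rightarrow> ('a \<Rightarrow> 'b::real_normed_vector) \<Rightarrow> bool" where
  "C_k_on 0 S f \<longleftrightarrow> continuous_on S f"
| "C_k_on (Suc k) S f \<longleftrightarrow> (\<forall>x\<in>S. f differentiable at x) \<and>
     (\<forall>v. C_k_on k S (\<lambda>x. frechet_derivative f (at x) v))"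

text \<open>Meant for open \<open>S\<close>, since the derivatives are taken at \<open>x\<close>, not within \<open>S\<close>.\<close>

definition smooth_on :: "'a::euclidean_space set \<Rightarrow> ('a \<Rightarrow> 'b::real_normed_vector) \<Rightarrow> bool" where
  "smooth_on S f \<longleftrightarrow> (\<forall>k. C_k_on k S f)"

definition test_function :: "('a::euclidean_space \<Rightarrow> real) \<Rightarrow> bool" where
  "test_function \<phi> \<longleftrightarrow> smooth_on UNIV \<phi> \<and> compact (closure {x. \<phi> x \<noteq> 0})"


section \<open>Carnot groups\<close>

text \<open>
  \<open>left_field gmul v\<close> is the left-invariant vector field \<open>X\<^sub>v u(g) = d/ds u(g \<circ> exp(s v))\<close> at \<open>s = 0\<close>,
  where \<open>exp (s v) = s v\<close>. It is also applied to vector-valued functions.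
\<close>

definition left_field ::
  "('a::euclidean_space \<Rightarrow> 'a \<Rightarrow> 'a) \<Rightarrow> 'a \<Rightarrow> ('a \<Rightarrow> 'b::real_normed_vector) \<Rightarrow> 'a \<Rightarrow> 'b" where
  "left_field gmul v u g = vector_derivative (\<lambda>s. u (gmul g (s *\<^sub>R v))) (at 0)"

text \<open>
  The bracket of the Lie algebra of left-invariant vector fields, transported to the tangent
  space at the neutral element: the components of the vector field \<open>X\<^sub>u X\<^sub>v - X\<^sub>v X\<^sub>u\<close> are its values
  on the coordinate functions, hence its value at \<open>0\<close> is obtained by applying it to the identity map.
\<close>

definition lie_bracket :: "('a::euclidean_space \<Rightarrow> 'a \<Rightarrow> 'a) \<Rightarrow> 'a \<Rightarrow> 'a \<Rightarrow> 'a" where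
  "lie_bracket gmul u v =
     left_field gmul u (left_field gmul v (\<lambda>x. x)) 0 -
     left_field gmul v (left_field gmul u (\<lambda>x. x)) 0"

text \<open>
  \<open>V 1, \<dots>, V r\<close> are the layers and \<open>e\<close> is an orthonormal basis of the first layer, indexed by a
  finite type \<open>'m\<close>. Assumption \<open>one_parameter\<close> says that \<open>s \<mapsto> s v\<close> is the one-parameter subgroup
  with velocity \<open>v\<close>, that is, that the exponential map is the identity. Hence \<open>v\<close> and \<open>- v\<close>
  are inverse to each other. Orthogonality makes the sum of the layers direct. Simple connectedness
  is automatic, as the underlying manifold is a vector space.
\<close>

locale carnot_group =
  fixes gmul :: "'a::euclidean_space \<Rightarrow> 'a \<Rightarrow> 'a"
    and V :: "nat \<Rightarrow> 'a set"
    and r :: nat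
    and e :: "'m::finite \<Rightarrow> 'a"
  assumes group_gmul: "group gmul 0 uminus"
    and smooth_gmul: "smooth_on UNIV (\<lambda>(x, y). gmul x y)"
    and one_parameter: "gmul (s *\<^sub>R v) (t *\<^sub>R v) = (s + t) *\<^sub>R v"
    and step_pos: "1 \<le> r"
    and subspace_layer: "j \<in> {1..r} \<Longrightarrow> subspace (V j)"
    and orthogonal_layers:
      "\<lbrakk>i \<in> {1..r}; j \<in> {1..r}; i \<noteq> j; x \<in> V i; y \<in> V j\<rbrakk> \<Longrightarrow> x \<bullet> y = 0"
    and span_layers: "span (\<Union>j\<in>{1..r}. V j) = UNIV"
    and bracket_layer:
      "j \<in> {1..<r} \<Longrightarrow> span {lie_bracket gmul u v |u v. u \<in> V 1 \<and> v \<in> V j} = V (Suc j)"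
    and bracket_last: "\<lbrakk>u \<in> V 1; v \<in> V r\<rbrakk> \<Longrightarrow> lie_bracket gmul u v = 0"
    and orthonormal_basis: "e a \<bullet> e b = (if a = b then 1 else 0)"
    and span_basis: "span (range e) = V 1"

text \<open>The coordinates \<open>z\<close> of the component in the first layer.\<close>

definition horizontal_coord :: "('m::finite \<Rightarrow> 'a::euclidean_space) \<Rightarrow> 'a \<Rightarrow> real ^ 'm" where
  "horizontal_coord e g = (\<chi> i. g \<bullet> e i)"

definition vertical_space :: "(nat \<Rightarrow> 'a::euclidean_space set) \<Rightarrow> nat \<Rightarrow> 'a set" where
  "vertical_space V r = span (\<Union>j\<in>{2..r}. V j)"

text \<open>
  The point with coordinates \<open>(z, \<sigma>)\<close>. The coordinate vector \<open>\<sigma>\<close> is kept as an element of the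
  vertical space, which is isometric to the coordinate space via orthonormal bases of the layers.
\<close>

definition from_coord :: "('m::finite \<Rightarrow> 'a::euclidean_space) \<Rightarrow> real ^ 'm \<Rightarrow> 'a \<Rightarrow> 'a" where
  "from_coord e z \<sigma> = (\<Sum>i\<in>UNIV. z $ i *\<^sub>R e i) + \<sigma>"

text \<open>
  Lebesgue measure of dimension \<open>dim S\<close> on a linear subspace \<open>S\<close>, as a measure on the ambient space
  concentrated on \<open>S\<close>. It does not depend on the choice of the orthonormal basis \<open>B\<close>; for
  \<open>S = UNIV\<close> and \<open>B = Basis\<close> the defining expression is \<^const>\<open>lborel\<close>, and for \<open>S = {0}\<close> it is
  the point mass at \<open>0\<close>.
\<close>

definition subspace_lborel :: "'a::euclidean_space set \<Rightarrow> 'a measure" where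
  "subspace_lborel S =
     (let B = (SOME B. pairwise orthogonal B \<and> (\<forall>b\<in>B. norm b = 1) \<and> span B = S)
      in distr (\<Pi>\<^sub>M b\<in>B. lborel) borel (\<lambda>x. \<Sum>b\<in>B. x b *\<^sub>R b))"


section \<open>Heat semigroup and heat kernel\<close>

definition horizontal_laplacian ::
  "('a::euclidean_space \<Rightarrow> 'a \<Rightarrow> 'a) \<Rightarrow> ('m::finite \<Rightarrow> 'a) \<Rightarrow> ('a \<Rightarrow> real) \<Rightarrow> 'a \<Rightarrow> real" where
  "horizontal_laplacian gmul e u g = (\<Sum>i\<in>UNIV. left_field gmul (e i) (left_field gmul (e i) u) g)"

definition C0_functions :: "('a::euclidean_space \<Rightarrow> real) set" where
  "C0_functions = {f. continuous_on UNIV f \<and> (f \<longlongrightarrow> 0) at_infinity}"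

text \<open>
  Strongly continuous contraction semigroups on the Banach space of continuous functions vanishing
  at infinity with the supremum norm (values of \<open>P t\<close> on other functions are irrelevant).
\<close>

definition contraction_semigroup ::
  "(real \<Rightarrow> ('a::euclidean_space \<Rightarrow> real) \<Rightarrow> 'a \<Rightarrow> real) \<Rightarrow> bool" where
  "contraction_semigroup P \<longleftrightarrow>
     (\<forall>t\<ge>0. \<forall>f\<in>C0_functions. P t f \<in> C0_functions) \<and>
     (\<forall>t\<ge>0. \<forall>f\<in>C0_functions. \<forall>h\<in>C0_functions. \<forall>a b.
        P t (\<lambda>g. a * f g + b * h g) = (\<lambda>g. a * P t f g + b * P t h g)) \<and>
     (\<forall>t\<ge>0. \<forall>f\<in>C0_functions. \<forall>M. (\<forall>g. \<bar>f g\<bar> \<le> M) \<longrightarrow> (\<forall>g. \<bar>P t f g\<bar> \<le> M)) \<and>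
     (\<forall>f\<in>C0_functions. P 0 f = f) \<and>
     (\<forall>s\<ge>0. \<forall>t\<ge>0. \<forall>f\<in>C0_functions. P (s + t) f = P s (P t f)) \<and>
     (\<forall>f\<in>C0_functions. uniform_limit UNIV (\<lambda>t. P t f) f (at_right 0))"

text \<open>\<open>f\<close> lies in the domain of the infinitesimal generator of \<open>P\<close>, which maps it to \<open>h\<close>.\<close>

definition has_generator_value ::
  "(real \<Rightarrow> ('a::euclidean_space \<Rightarrow> real) \<Rightarrow> 'a \<Rightarrow> real) \<Rightarrow> ('a \<Rightarrow> real) \<Rightarrow> ('a \<Rightarrow> real) \<Rightarrow> bool"
where
  "has_generator_value P f h \<longleftrightarrow>
     f \<in> C0_functions \<and> uniform_limit UNIV (\<lambda>t g. (P t f g - f g) / t) h (at_right 0)"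

text \<open>\<open>(f, h)\<close> lies in the closure of the graph of \<open>L\<close> on test functions.\<close>

definition has_closure_value ::
  "(('a::euclidean_space \<Rightarrow> real) \<Rightarrow> 'a \<Rightarrow> real) \<Rightarrow> ('a \<Rightarrow> real) \<Rightarrow> ('a \<Rightarrow> real) \<Rightarrow> bool" where
  "has_closure_value L f h \<longleftrightarrow>
     (\<exists>\<phi>. (\<forall>n::nat. test_function (\<phi> n)) \<and> uniform_limit UNIV \<phi> f sequentially \<and>
          uniform_limit UNIV (\<lambda>n. L (\<phi> n)) h sequentially)"

definition heat_semigroup ::
  "('a::euclidean_space \<Rightarrow> 'a \<Rightarrow> 'a) \<Rightarrow> ('m::finite \<Rightarrow> 'a)
     \<Rightarrow> (real \<Rightarrow> ('a \<Rightarrow> real) \<Rightarrow> 'a \<Rightarrow> real) \<Rightarrow> bool" where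
  "heat_semigroup gmul e P \<longleftrightarrow>
     contraction_semigroup P \<and>
     (\<forall>f h. has_generator_value P f h \<longleftrightarrow> has_closure_value (horizontal_laplacian gmul e) f h)"

definition heat_kernel ::
  "(real \<Rightarrow> ('a::euclidean_space \<Rightarrow> real) \<Rightarrow> 'a \<Rightarrow> real) \<Rightarrow> ('a \<Rightarrow> 'a \<Rightarrow> real \<Rightarrow> real) \<Rightarrow> bool" where
  "heat_kernel P p \<longleftrightarrow>
     (\<forall>g g' t. 0 < t \<longrightarrow> 0 < p g g' t) \<and>
     smooth_on (UNIV \<times> UNIV \<times> {0<..}) (\<lambda>(g, g', t). p g g' t) \<and>
     (\<forall>g g' t. 0 < t \<longrightarrow> p g g' t = p g' g t) \<and>
     (\<forall>f\<in>C0_functions. \<forall>g t. 0 < t \<longrightarrow>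
        has_bochner_integral lborel (\<lambda>g'. p g g' t * f g') (P t f g))"

end

theory Submission
  imports Defs "HOL-Probability.Probability"
begin

text \<open>
  Let \<open>\<ell> g = \<langle>\<nu>, z\<rangle>\<close>. Since every bracket is orthogonal to the first layer, \<open>\<ell>\<close> is a homomorphism
  to the real line. The heat semigroup is left-invariant because its generator is, so the images of
  \<open>p(e, \<cdot>, t)\<close> under \<open>\<ell>\<close> form a convolution semigroup. The generator acts on functions of \<open>\<ell>\<close> as
  the second derivative near the identity, and only mass \<open>o(t)\<close> leaves a neighbourhood of the identity;
  hence the Fourier transform is \<open>exp (- \<theta>\<^sup>2 t)\<close> (conservativeness is the case \<open>\<theta> = 0\<close>),
  and the image is the normal distribution of variance \<open>2 t\<close>. The first claim is then a Gamma integral.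

  The second claim evaluates the density of this image at one point, whereas the above
  determines it only almost everywhere. Fatou's lemma gives one inequality. For the other one, the
  Chapman--Kolmogorov inequality bounds the density at time \<open>2 t\<close> from below by the convolution of
  the densities at time \<open>t\<close>, in which null sets do not matter.
\<close>

section \<open>Smooth functions\<close>

text \<open>The kernel is known only qualitatively: positivity, smoothness, symmetry and the
  integral representation. Without a decay estimate, its integral over a shifted hyperplane cannot
  be shown continuous in the shift by domination; hence the two bounds at one point come from
  different arguments. The lower bound needs the slice through the origin of a translated kernel,
  and that single height is a null set. Translation of slices is therefore proved first for
  compactly supported functions, whose slices vary continuously, and extended by monotone
  convergence. Left translations are not assumed to preserve Lebesgue measure; the kernel is shown
  invariant up to a constant, and this constant cancels against the one in the change of variables.
  Left invariance of the semigroup is itself a uniqueness statement, because the semigroup is given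
  only through its generator, the closure of the horizontal Laplacian on test functions. Additivity
  of the first-layer coordinates is derived from derivatives of the group law and the adjoint
  action, in place of a Baker-Campbell-Hausdorff expansion.\<close>

lemma C_k_on_SucI:
  assumes "\<And>x. (f has_derivative f' x) (at x)" and "\<And>v. C_k_on k UNIV (\<lambda>x. f' x v)"
  shows "C_k_on (Suc k) UNIV f"
proof -
  have "frechet_derivative f (at x) = f' x" for x
    using assms(1) frechet_derivative_at by metis
  then show ?thesis
    using assms by (auto simp: differentiable_def)
qed

lemma C_k_on_Suc_has_derivative:
  assumes "C_k_on (Suc k) UNIV f"
  shows "(f has_derivative frechet_derivative f (at x)) (at x)"
  using assms by (simp flip: frechet_derivative_works)

lemma C_k_on_Suc_imp: "C_k_on (Suc k) UNIV f \<Longrightarrow> C_k_on k UNIV f"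
proof (induction k arbitrary: f)
  case 0
  then show ?case
    by (simp add: continuous_on_eq_continuous_at differentiable_imp_continuous_within)
next
  case (Suc k)
  then show ?case
    by (metis C_k_on.simps(2))
qed

lemma C_k_on_const: "C_k_on k UNIV (\<lambda>x. c)"
proof (induction k arbitrary: c)
  case (Suc k)
  show ?case
    by (rule C_k_on_SucI[where f' = "\<lambda>x v. 0"]) (simp_all add: Suc)
qed simp

lemma C_k_on_linear:
  assumes "bounded_linear f"
  shows "C_k_on k UNIV f"
proof (cases k)
  case 0
  then show ?thesis
    using assms by (simp add: linear_continuous_on)
next
  case (Suc l)
  show ?thesis
    unfolding Suc by (rule C_k_on_SucI[where f' = "\<lambda>x. f"])
      (rule bounded_linear_imp_has_derivative[OF assms] C_k_on_const)+
qed

lemma C_k_on_add: "C_k_on k UNIV f \<Longrightarrow> C_k_on k UNIV g \<Longrightarrow> C_k_on k UNIV (\<lambda>x. f x + g x)"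
proof (induction k arbitrary: f g)
  case (Suc k)
  show ?case
  proof (rule C_k_on_SucI)
    show "((\<lambda>x. f x + g x) has_derivative
        (\<lambda>v. frechet_derivative f (at x) v + frechet_derivative g (at x) v)) (at x)" for x
      by (rule has_derivative_add[OF Suc.prems[THEN C_k_on_Suc_has_derivative]])
    show "C_k_on k UNIV (\<lambda>x. frechet_derivative f (at x) v + frechet_derivative g (at x) v)" for v
      by (rule Suc.IH) (use Suc.prems in simp_all)
  qed
qed (simp add: continuous_on_add)

lemma C_k_on_scaleR:
  fixes f :: "'a::euclidean_space \<Rightarrow> real"
  shows "C_k_on k UNIV f \<Longrightarrow> C_k_on k UNIV g \<Longrightarrow> C_k_on k UNIV (\<lambda>x. f x *\<^sub>R g x)"
proof (induction k arbitrary: f g)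
  case (Suc k)
  show ?case
  proof (rule C_k_on_SucI)
    show "((\<lambda>x. f x *\<^sub>R g x) has_derivative
        (\<lambda>v. f x *\<^sub>R frechet_derivative g (at x) v + frechet_derivative f (at x) v *\<^sub>R g x)) (at x)" for x
      by (rule has_derivative_scaleR[OF Suc.prems[THEN C_k_on_Suc_has_derivative]])
    show "C_k_on k UNIV (\<lambda>x. f x *\<^sub>R frechet_derivative g (at x) v + frechet_derivative f (at x) v *\<^sub>R g x)" for v
      by (rule C_k_on_add; rule Suc.IH)
         (use Suc.prems Suc.prems[THEN C_k_on_Suc_imp] in simp_all)
  qed
qed (simp add: continuous_on_scaleR)

lemma C_k_on_sum:
  assumes "finite I" "\<And>i. i \<in> I \<Longrightarrow> C_k_on k UNIV (f i)"
  shows "C_k_on k UNIV (\<lambda>x. \<Sum>i\<in>I. f i x)"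
  using assms
proof (induction I rule: finite_induct)
  case empty
  show ?case
    by (simp add: C_k_on_const)
next
  case (insert i I)
  have "C_k_on k UNIV (\<lambda>x. f i x + (\<Sum>i\<in>I. f i x))"
    by (rule C_k_on_add) (use insert in simp_all)
  then show ?case
    using insert by simp
qed

lemma C_k_on_bounded_linear:
  assumes "bounded_linear h"
  shows "C_k_on k UNIV f \<Longrightarrow> C_k_on k UNIV (\<lambda>x. h (f x))"
proof (induction k arbitrary: f)
  case 0
  then show ?case
    using bounded_linear.continuous_on[OF assms] by simp
next
  case (Suc k)
  show ?case
  proof (rule C_k_on_SucI)
    show "((\<lambda>x. h (f x)) has_derivative (\<lambda>v. h (frechet_derivative f (at x) v))) (at x)" for x
      by (rule bounded_linear.has_derivative[OF assms C_k_on_Suc_has_derivative[OF Suc.prems]])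
    show "C_k_on k UNIV (\<lambda>x. h (frechet_derivative f (at x) v))" for v
      by (rule Suc.IH) (use Suc.prems in simp)
  qed
qed

text \<open>Expanding the inner derivative in the standard basis writes the derivative of the
  composition as a finite sum of products. In each product the derivative of \<open>f\<close> is
  taken in a fixed direction, so the induction hypothesis, with \<open>f\<close> arbitrary, applies
  to it.\<close>

lemma C_k_on_compose:
  fixes f :: "'b::euclidean_space \<Rightarrow> 'c::real_normed_vector" and g :: "'a::euclidean_space \<Rightarrow> 'b"
  shows "C_k_on k UNIV f \<Longrightarrow> C_k_on k UNIV g \<Longrightarrow> C_k_on k UNIV (\<lambda>x. f (g x))"
proof (induction k arbitrary: f)
  case 0
  then show ?case
    using continuous_on_compose2[of UNIV f UNIV g] by simp
next
  case (Suc k)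
  show ?case
  proof (rule C_k_on_SucI)
    fix x
    show "((\<lambda>x. f (g x)) has_derivative
        (\<lambda>v. \<Sum>b\<in>Basis. (frechet_derivative g (at x) v \<bullet> b) *\<^sub>R frechet_derivative f (at (g x)) b)) (at x)"
    proof -
      have f: "(f has_derivative frechet_derivative f (at (g x))) (at (g x))"
        using Suc.prems(1) by (rule C_k_on_Suc_has_derivative)
      have "frechet_derivative f (at (g x)) (frechet_derivative g (at x) v) =
          (\<Sum>b\<in>Basis. (frechet_derivative g (at x) v \<bullet> b) *\<^sub>R frechet_derivative f (at (g x)) b)" for v
      proof -
        have "frechet_derivative f (at (g x)) (\<Sum>b\<in>Basis. (frechet_derivative g (at x) v \<bullet> b) *\<^sub>R b) =
            (\<Sum>b\<in>Basis. (frechet_derivative g (at x) v \<bullet> b) *\<^sub>R frechet_derivative f (at (g x)) b)"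
          by (simp add: linear_sum[OF has_derivative_linear[OF f]] linear_scale[OF has_derivative_linear[OF f]])
        then show ?thesis
          by (simp add: euclidean_representation)
      qed
      then show ?thesis
        using diff_chain_at[OF C_k_on_Suc_has_derivative[OF Suc.prems(2)] f] by (simp add: o_def)
    qed
  next
    fix v
    have "C_k_on k UNIV g"
      using Suc.prems(2) by (rule C_k_on_Suc_imp)
    moreover have "C_k_on k UNIV (\<lambda>y. frechet_derivative f (at y) b)" for b
      using Suc.prems(1) by simp
    ultimately have "C_k_on k UNIV (\<lambda>x. frechet_derivative f (at (g x)) b)" for b
      by (rule Suc.IH[rotated])
    moreover have "C_k_on k UNIV (\<lambda>x. frechet_derivative g (at x) v \<bullet> b)" for b
      by (rule C_k_on_bounded_linear[OF bounded_linear_inner_left]) (use Suc.prems(2) in simp)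
    ultimately show "C_k_on k UNIV (\<lambda>x. \<Sum>b\<in>Basis. (frechet_derivative g (at x) v \<bullet> b) *\<^sub>R frechet_derivative f (at (g x)) b)"
      by (intro C_k_on_sum C_k_on_scaleR finite_Basis)
  qed
qed

lemma smooth_on_const: "smooth_on UNIV (\<lambda>x. c)"
  by (simp add: smooth_on_def C_k_on_const)

lemma smooth_on_linear: "bounded_linear f \<Longrightarrow> smooth_on UNIV f"
  by (simp add: smooth_on_def C_k_on_linear)

lemma smooth_on_add: "smooth_on UNIV f \<Longrightarrow> smooth_on UNIV g \<Longrightarrow> smooth_on UNIV (\<lambda>x. f x + g x)"
  by (simp add: smooth_on_def C_k_on_add)

lemma smooth_on_mult:
  fixes f g :: "'a::euclidean_space \<Rightarrow> real"
  assumes "smooth_on UNIV f" "smooth_on UNIV g"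
  shows "smooth_on UNIV (\<lambda>x. f x * g x)"
  unfolding smooth_on_def
proof
  fix k
  show "C_k_on k UNIV (\<lambda>x. f x * g x)"
    using C_k_on_scaleR[of k f g] assms by (simp add: smooth_on_def)
qed

lemma smooth_on_compose:
  fixes f :: "'b::euclidean_space \<Rightarrow> 'c::real_normed_vector" and g :: "'a::euclidean_space \<Rightarrow> 'b"
  shows "smooth_on UNIV f \<Longrightarrow> smooth_on UNIV g \<Longrightarrow> smooth_on UNIV (\<lambda>x. f (g x))"
  using C_k_on_compose[of _ f g] by (simp add: smooth_on_def)

lemma smooth_on_prod:
  fixes f :: "'i \<Rightarrow> 'a::euclidean_space \<Rightarrow> real"
  assumes "finite I" "\<And>i. i \<in> I \<Longrightarrow> smooth_on UNIV (f i)"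
  shows "smooth_on UNIV (\<lambda>x. \<Prod>i\<in>I. f i x)"
  using assms
proof (induction I rule: finite_induct)
  case empty
  show ?case
    by (simp add: smooth_on_const)
next
  case (insert i I)
  have "smooth_on UNIV (\<lambda>x. f i x * (\<Prod>i\<in>I. f i x))"
    by (rule smooth_on_mult) (use insert in simp_all)
  then show ?case
    using insert by simp
qed

lemma smooth_on_inner_self: "smooth_on UNIV (\<lambda>x::'a::euclidean_space. x \<bullet> x)"
proof -
  have "C_k_on k UNIV (\<lambda>x::'a. \<Sum>b\<in>Basis. (x \<bullet> b) *\<^sub>R (x \<bullet> b))" for k
    by (rule C_k_on_sum[OF finite_Basis]) (rule C_k_on_scaleR; rule C_k_on_linear[OF bounded_linear_inner_left])
  then have "smooth_on UNIV (\<lambda>x::'a. \<Sum>b\<in>Basis. (x \<bullet> b) * (x \<bullet> b))"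
    by (simp add: smooth_on_def)
  moreover have "(\<lambda>x::'a. x \<bullet> x) = (\<lambda>x. \<Sum>b\<in>Basis. (x \<bullet> b) * (x \<bullet> b))"
    by (rule ext) (rule euclidean_inner)
  ultimately show ?thesis
    by simp
qed

lemma C_k_on_real_SucI:
  fixes f :: "real \<Rightarrow> real"
  assumes "\<And>x. (f has_real_derivative f' x) (at x)" and "C_k_on k UNIV f'"
  shows "C_k_on (Suc k) UNIV f"
proof (rule C_k_on_SucI)
  have "(*) (f' x) = (\<lambda>v. v *\<^sub>R f' x)" for x
    by auto
  then show "(f has_derivative (\<lambda>v. v *\<^sub>R f' x)) (at x)" for x
    using assms(1)[of x] by (simp add: has_field_derivative_def)
  show "C_k_on k UNIV (\<lambda>x. v *\<^sub>R f' x)" for v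
    by (rule C_k_on_scaleR[OF C_k_on_const assms(2)])
qed

lemma smooth_on_cos: "smooth_on UNIV (cos :: real \<Rightarrow> real)"
  and smooth_on_sin: "smooth_on UNIV (sin :: real \<Rightarrow> real)"
proof -
  have "C_k_on k UNIV (cos :: real \<Rightarrow> real) \<and> C_k_on k UNIV (sin :: real \<Rightarrow> real)" for k
  proof (induction k)
    case 0
    show ?case
      by (auto intro!: continuous_intros)
  next
    case (Suc k)
    have "C_k_on (Suc k) UNIV (cos :: real \<Rightarrow> real)"
      by (rule C_k_on_real_SucI[where f' = "\<lambda>x. - sin x"])
         (use C_k_on_scaleR[OF C_k_on_const conjunct2[OF Suc], of "- 1"] in
           \<open>auto intro!: derivative_eq_intros\<close>)
    moreover have "C_k_on (Suc k) UNIV (sin :: real \<Rightarrow> real)"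
      by (rule C_k_on_real_SucI[where f' = cos]) (auto simp: Suc)
    ultimately show ?case ..
  qed
  then show "smooth_on UNIV (cos :: real \<Rightarrow> real)" "smooth_on UNIV (sin :: real \<Rightarrow> real)"
    by (auto simp: smooth_on_def)
qed

section \<open>Cut-off functions\<close>

definition flat :: "nat \<Rightarrow> real \<Rightarrow> real" where
  "flat n x = (if 0 < x then exp (- 1 / x) / x ^ n else 0)"

lemma tendsto_flat: "(flat n \<longlongrightarrow> 0) (at_right 0)"
proof -
  have "((\<lambda>x::real. exp (- 1 / x) / x ^ n) \<longlongrightarrow> 0) (at_right 0)"
    by real_asymp
  then show ?thesis
    by (rule Lim_transform_eventually) (auto simp: eventually_at_filter flat_def)
qed

text \<open>The powers in the denominator make this family closed under differentiation up to linear
  combinations, so a single induction over all \<open>n\<close> gives smoothness.\<close>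

lemma has_real_derivative_flat:
  "(flat n has_real_derivative flat (n + 2) x - real n * flat (n + 1) x) (at x)"
proof -
  consider "x > 0" | "x < 0" | "x = 0"
    by linarith
  then show ?thesis
  proof cases
    case 1
    have "((\<lambda>x. exp (- 1 / x) / x ^ n) has_real_derivative
       flat (n + 2) x - real n * flat (n + 1) x) (at x)"
      using 1 by (auto intro!: derivative_eq_intros simp: flat_def)
        (cases n; auto simp: field_simps power2_eq_square)
    then show ?thesis
      by (rule has_field_derivative_transform_within_open[where S = "{0<..}"])
         (use 1 in \<open>auto simp: flat_def\<close>)
  next
    case 2
    have "((\<lambda>x. 0) has_real_derivative 0) (at x)"
      by simp
    then have "(flat n has_real_derivative 0) (at x)"
      by (rule has_field_derivative_transform_within_open[where S = "{..<0}"])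
         (use 2 in \<open>auto simp: flat_def\<close>)
    then show ?thesis
      using 2 by (simp add: flat_def)
  next
    case 3
    have "((\<lambda>h. flat n h / h) \<longlongrightarrow> 0) (at 0)"
    proof (rule filterlim_split_at)
      show "((\<lambda>h. flat n h / h) \<longlongrightarrow> 0) (at_left 0)"
        by (rule Lim_transform_eventually[OF tendsto_const]) (auto simp: eventually_at_filter flat_def)
      \<comment> \<open>The difference quotient at the origin is itself a member of the family,
        whose right limit is already known.\<close>
      have "flat n h / h = flat (Suc n) h" for h
        by (simp add: flat_def field_simps)
      then show "((\<lambda>h. flat n h / h) \<longlongrightarrow> 0) (at_right 0)"
        using tendsto_flat by simp
    qed
    then show ?thesis
      by (simp add: 3 DERIV_def flat_def)
  qed
qed

lemma smooth_on_flat: "smooth_on UNIV (flat n)"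
proof -
  have "C_k_on k UNIV (flat n)" for k n
  proof (induction k arbitrary: n)
    case 0
    show ?case
      by (simp add: continuous_on_eq_continuous_at DERIV_isCont[OF has_real_derivative_flat])
  next
    case (Suc k)
    have "C_k_on k UNIV (\<lambda>x. flat (n + 2) x + (- real n) *\<^sub>R flat (n + 1) x)"
      by (rule C_k_on_add[OF Suc C_k_on_scaleR[OF C_k_on_const Suc]])
    then have "C_k_on k UNIV (\<lambda>x. flat (n + 2) x - real n * flat (n + 1) x)"
      by simp
    then show ?case
      by (rule C_k_on_real_SucI[OF has_real_derivative_flat])
  qed
  then show ?thesis
    by (simp add: smooth_on_def)
qed

text \<open>The quartic argument makes the first and second derivatives vanish at the origin.\<close>

definition bump :: "nat \<Rightarrow> 'a::euclidean_space \<Rightarrow> real" where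
  "bump n x = exp 1 * flat 0 (1 - (x \<bullet> x) ^ 2 / real (Suc n) ^ 4)"

lemma flat_0_mono: "x \<le> y \<Longrightarrow> flat 0 x \<le> flat 0 y"
  by (auto simp: flat_def field_simps)

lemma flat_nonneg: "0 \<le> flat n x"
  by (auto simp: flat_def)

lemma flat_0_le_1: "flat 0 x \<le> 1"
  by (auto simp: flat_def)

lemma bump_nonneg: "0 \<le> bump n x"
  by (simp add: bump_def flat_nonneg)

text \<open>This is what the factor \<open>exp 1\<close> in \<open>bump\<close> is for: every
  cut-off takes the value 1 at the origin.\<close>

lemma flat_0_one: "exp 1 * flat 0 1 = 1"
  by (simp add: flat_def flip: exp_add)

lemma bump_le_1: "bump n x \<le> 1"
proof -
  have "bump n x \<le> exp 1 * flat 0 1"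
    unfolding bump_def by (intro mult_left_mono flat_0_mono) auto
  then show ?thesis
    by (simp add: flat_0_one)
qed

lemma bump_mono: "m \<le> n \<Longrightarrow> bump m x \<le> bump n x"
  unfolding bump_def
  by (intro mult_left_mono flat_0_mono diff_left_mono divide_left_mono power_mono) auto

lemma tendsto_bump: "(\<lambda>n. bump n x) \<longlonglongrightarrow> 1"
proof -
  have "isCont (flat 0) 1"
    using has_real_derivative_flat DERIV_isCont by blast
  moreover have "(\<lambda>n. 1 - (x \<bullet> x) ^ 2 / real (Suc n) ^ 4) \<longlonglongrightarrow> 1"
    by real_asymp
  ultimately have "(\<lambda>n. bump n x) \<longlonglongrightarrow> exp 1 * flat 0 1"
    unfolding bump_def by (intro tendsto_mult tendsto_const isCont_tendsto_compose[where g = "flat 0"])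
  then show ?thesis
    by (simp add: flat_0_one)
qed

lemma smooth_on_bump: "smooth_on UNIV (bump n)"
proof -
  have "smooth_on UNIV (\<lambda>x::'a. 1 + (x \<bullet> x) * (x \<bullet> x) * (- 1 / real (Suc n) ^ 4))"
    by (rule smooth_on_add[OF smooth_on_const smooth_on_mult[OF
      smooth_on_mult[OF smooth_on_inner_self smooth_on_inner_self] smooth_on_const]])
  then have "smooth_on UNIV (\<lambda>x::'a. 1 - (x \<bullet> x) ^ 2 / real (Suc n) ^ 4)"
    by (simp add: power2_eq_square)
  then show ?thesis
    unfolding bump_def
    by (rule smooth_on_mult[OF smooth_on_const smooth_on_compose[OF smooth_on_flat]])
qed

lemma bump_support: "{x. bump n x \<noteq> 0} \<subseteq> cball 0 (Suc n)"
proof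
  fix x :: 'a
  assume "x \<in> {x. bump n x \<noteq> 0}"
  then have "(x \<bullet> x) ^ 2 < real (Suc n) ^ 4"
    by (auto simp: bump_def flat_def field_simps split: if_splits)
  then have "norm x ^ 4 < real (Suc n) ^ 4"
    by (simp add: dot_square_norm)
  then show "x \<in> cball 0 (Suc n)"
    using power_less_imp_less_base by fastforce
qed

section \<open>Test functions\<close>

lemma test_functionI:
  assumes "smooth_on UNIV f" "{x. f x \<noteq> 0} \<subseteq> K" "compact K"
  shows "test_function f"
  using assms(1) bounded_subset[OF compact_imp_bounded[OF assms(3)] assms(2)]
  by (simp add: test_function_def compact_closure)

lemma test_function_mult_bump:
  assumes "smooth_on UNIV f"
  shows "test_function (\<lambda>x. f x * bump n x)"
  by (rule test_functionI[OF smooth_on_mult[OF assms smooth_on_bump] _ compact_cball[of 0 "Suc n"]])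
     (use bump_support in auto)

lemma test_function_bump: "test_function (bump n)"
  using test_function_mult_bump[OF smooth_on_const[where c = 1]] by simp

lemma smooth_on_cos_inner: "smooth_on UNIV (\<lambda>x::'a::euclidean_space. cos (\<theta> * (x \<bullet> w)))"
  and smooth_on_sin_inner: "smooth_on UNIV (\<lambda>x::'a::euclidean_space. sin (\<theta> * (x \<bullet> w)))"
proof -
  have lin: "smooth_on UNIV (\<lambda>x::'a. \<theta> * (x \<bullet> w))"
    by (rule smooth_on_linear[OF bounded_linear_const_mult[OF bounded_linear_inner_left]])
  show "smooth_on UNIV (\<lambda>x::'a. cos (\<theta> * (x \<bullet> w)))"
    by (rule smooth_on_compose[OF smooth_on_cos lin])
  show "smooth_on UNIV (\<lambda>x::'a. sin (\<theta> * (x \<bullet> w)))"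
    by (rule smooth_on_compose[OF smooth_on_sin lin])
qed

lemma test_function_continuous: "test_function f \<Longrightarrow> continuous_on UNIV f"
  unfolding test_function_def smooth_on_def by (metis C_k_on.simps(1))

lemma test_function_vanishes:
  assumes "test_function f"
  obtains R where "0 < R" "\<And>x. R < norm x \<Longrightarrow> f x = 0"
proof -
  have "bounded (closure {x. f x \<noteq> 0})"
    using assms by (simp add: test_function_def compact_imp_bounded)
  then obtain R where "0 < R" "\<forall>x\<in>closure {x. f x \<noteq> 0}. norm x \<le> R"
    using bounded_pos by blast
  then show ?thesis
    using that[of R] closure_subset[of "{x. f x \<noteq> 0}"] by force
qed

lemma test_function_C0: "test_function f \<Longrightarrow> f \<in> C0_functions"
proof -
  assume f: "test_function f"
  obtain R where "\<And>x. R < norm x \<Longrightarrow> f x = 0"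
    using test_function_vanishes[OF f] by blast
  then have "\<forall>\<^sub>F x in at_infinity. 0 = f x"
    by (auto simp: eventually_at_infinity intro!: exI[of _ "R + 1"])
  then have "(f \<longlongrightarrow> 0) at_infinity"
    using Lim_transform_eventually[OF tendsto_const] by blast
  then show ?thesis
    using test_function_continuous[OF f] by (simp add: C0_functions_def)
qed

text \<open>The product \<open>g\<close> is smooth and positive exactly on the open box; applying
  \<open>flat 0\<close> to \<open>n g\<close> drives positive values to 1 and leaves zeros at 0.
  Boxes determine finite Borel measures, so identities checked on test functions become identities
  of measures.\<close>

lemma box_indicator_limit:
  fixes l u :: "'a::euclidean_space"
  obtains f :: "nat \<Rightarrow> 'a \<Rightarrow> real"
    where "\<And>n. test_function (f n)" "\<And>n x. 0 \<le> f n x" "\<And>n x. f n x \<le> 1"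
      "\<And>x. (\<lambda>n. f n x) \<longlonglongrightarrow> indicator (box l u) x"
proof -
  define g where "g x = (\<Prod>b\<in>Basis. flat 0 (x \<bullet> b - l \<bullet> b) * flat 0 (u \<bullet> b - x \<bullet> b))" for x :: 'a
  have g0: "0 \<le> g x" for x
    by (auto simp: g_def intro!: prod_nonneg mult_nonneg_nonneg flat_nonneg)
  have pos: "0 < flat 0 x \<longleftrightarrow> 0 < x" for x
    by (auto simp: flat_def)
  have g_box: "0 < g x \<longleftrightarrow> x \<in> box l u" for x
  proof
    assume "0 < g x"
    then have "g x \<noteq> 0"
      by simp
    then have nz: "\<forall>b\<in>Basis. flat 0 (x \<bullet> b - l \<bullet> b) \<noteq> 0 \<and> flat 0 (u \<bullet> b - x \<bullet> b) \<noteq> 0"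
      by (simp add: g_def)
    have "l \<bullet> b < x \<bullet> b \<and> x \<bullet> b < u \<bullet> b" if "b \<in> Basis" for b
      using nz[rule_format, OF that] by (auto simp: flat_def split: if_splits)
    then show "x \<in> box l u"
      by (simp add: mem_box)
  next
    assume "x \<in> box l u"
    then show "0 < g x"
      unfolding g_def by (intro prod_pos mult_pos_pos) (auto simp: mem_box pos)
  qed
  have "smooth_on UNIV g"
  proof -
    have 1: "smooth_on UNIV (\<lambda>x. x \<bullet> b + (- (l \<bullet> b)))" for b
      by (rule smooth_on_add[OF smooth_on_linear[OF bounded_linear_inner_left] smooth_on_const])
    have 2: "smooth_on UNIV (\<lambda>x. u \<bullet> b + - 1 * (x \<bullet> b))" for b
      by (rule smooth_on_add[OF smooth_on_const smooth_on_mult[OF smooth_on_const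
        smooth_on_linear[OF bounded_linear_inner_left]]])
    have "smooth_on UNIV (\<lambda>x. flat 0 (x \<bullet> b - l \<bullet> b) * flat 0 (u \<bullet> b - x \<bullet> b))" for b
      using smooth_on_mult[OF smooth_on_compose[OF smooth_on_flat 1] smooth_on_compose[OF smooth_on_flat 2]]
      by simp
    then show ?thesis
      unfolding g_def[abs_def] by (rule smooth_on_prod[OF finite_Basis])
  qed
  then have smooth: "smooth_on UNIV (\<lambda>x. flat 0 (real n * g x))" for n
    using smooth_on_compose[OF smooth_on_flat smooth_on_mult[OF smooth_on_const]] by blast
  show ?thesis
  proof
    show "test_function (\<lambda>x. flat 0 (real n * g x))" for n
    proof (rule test_functionI[OF smooth _ compact_cbox])
      have "x \<in> cbox l u" if "flat 0 (real n * g x) \<noteq> 0" for x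
      proof -
        have "0 < g x"
          using that g0[of x] by (auto simp: flat_def zero_less_mult_iff split: if_splits)
        then show ?thesis
          using g_box box_subset_cbox by blast
      qed
      then show "{x. flat 0 (real n * g x) \<noteq> 0} \<subseteq> cbox l u"
        by blast
    qed
    show "(\<lambda>n. flat 0 (real n * g x)) \<longlonglongrightarrow> indicator (box l u) x" for x
    proof (cases "x \<in> box l u")
      case True
      then have g: "0 < g x"
        by (simp add: g_box)
      have "(\<lambda>n. exp (- 1 / (real n * g x))) \<longlonglongrightarrow> 1"
        using g by real_asymp
      moreover have "\<forall>\<^sub>F n in sequentially. exp (- 1 / (real n * g x)) = flat 0 (real n * g x)"
        using eventually_gt_at_top[of 0] by eventually_elim (simp add: flat_def g)
      ultimately show ?thesis
        using True by (simp add: Lim_transform_eventually)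
    next
      case False
      then have "g x = 0"
        using g0[of x] g_box[of x] by linarith
      then show ?thesis
        using False by (simp add: flat_def)
    qed
  qed (auto simp: flat_nonneg flat_0_le_1)
qed

section \<open>First-layer coordinates are additive\<close>

context carnot_group
begin

sublocale gmul: group gmul 0 uminus
  by (rule group_gmul)

lemma minus_gmul: "- gmul x y = gmul (- y) (- x)"
  using gmul.inverse_distrib_swap by simp

lemma gmul_minus_cancel [simp]: "gmul (- x) (gmul x y) = y" "gmul x (gmul (- x) y) = y"
  by (simp_all flip: gmul.assoc)

section \<open>Differential of the group law\<close>

definition dgmul :: "'a \<times> 'a \<Rightarrow> 'a \<times> 'a \<Rightarrow> 'a" where
  "dgmul q = frechet_derivative (\<lambda>(x, y). gmul x y) (at q)"

lemma has_derivative_gmul: "((\<lambda>(x, y). gmul x y) has_derivative dgmul q) (at q)"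
proof -
  have "C_k_on (Suc 0) UNIV (\<lambda>(x, y). gmul x y)"
    using smooth_gmul by (simp only: smooth_on_def)
  then show ?thesis
    unfolding dgmul_def by (simp only: C_k_on.simps flip: frechet_derivative_works) blast
qed

lemma linear_dgmul: "linear (dgmul q)"
  using has_derivative_gmul has_derivative_linear by blast

lemma differentiable_dgmul: "(\<lambda>q. dgmul q v) differentiable (at q)"
proof -
  have "C_k_on (Suc (Suc 0)) UNIV (\<lambda>(x, y). gmul x y)"
    using smooth_gmul by (simp only: smooth_on_def)
  then show ?thesis
    unfolding dgmul_def by (simp only: C_k_on.simps) blast
qed

lemma continuous_dgmul: "continuous_on UNIV (\<lambda>q. dgmul q v)"
  by (simp add: continuous_on_eq_continuous_at differentiable_dgmul differentiable_imp_continuous_within)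

lemma has_vector_derivative_gmul:
  assumes "(a has_vector_derivative a') (at s)" "(b has_vector_derivative b') (at s)"
  shows "((\<lambda>s. gmul (a s) (b s)) has_vector_derivative dgmul (a s, b s) (a', b')) (at s)"
proof -
  have "((\<lambda>s. (a s, b s)) has_vector_derivative (a', b')) (at s)"
    using assms by (rule has_vector_derivative_Pair)
  then have "((\<lambda>(x, y). gmul x y) \<circ> (\<lambda>s. (a s, b s)) has_vector_derivative dgmul (a s, b s) (a', b')) (at s)"
    by (rule vector_derivative_diff_chain_within) (rule has_derivative_at_withinI[OF has_derivative_gmul])
  then show ?thesis
    by (simp add: o_def)
qed

lemma continuous_gmul: "continuous_on UNIV (\<lambda>(x, y). gmul x y)"
  using has_derivative_gmul has_derivative_continuous
  by (metis continuous_at_imp_continuous_on)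

lemma continuous_on_gmul [continuous_intros]:
  assumes "continuous_on S f" "continuous_on S g"
  shows "continuous_on S (\<lambda>x. gmul (f x) (g x))"
  using continuous_on_compose2[OF continuous_gmul continuous_on_Pair[OF assms]] by simp

text \<open>If one factor is the identity, the product is the other factor; so both partial
  derivatives there are the identity map.\<close>

lemma dgmul_zero: "dgmul (0, 0) (a, b) = a + b"
proof -
  have "((\<lambda>s. gmul (s *\<^sub>R a) (0::'a)) has_vector_derivative dgmul (0 *\<^sub>R a, 0) (a, 0)) (at 0)"
    by (rule has_vector_derivative_gmul) (auto intro!: derivative_eq_intros)
  moreover have "((\<lambda>s. gmul (s *\<^sub>R a) (0::'a)) has_vector_derivative a) (at 0)"
    by (auto intro!: derivative_eq_intros)
  ultimately have 1: "dgmul (0, 0) (a, 0) = a"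
    using vector_derivative_unique_at by fastforce
  have "((\<lambda>s. gmul (0::'a) (s *\<^sub>R b)) has_vector_derivative dgmul (0, 0 *\<^sub>R b) (0, b)) (at 0)"
    by (rule has_vector_derivative_gmul) (auto intro!: derivative_eq_intros)
  moreover have "((\<lambda>s. gmul (0::'a) (s *\<^sub>R b)) has_vector_derivative b) (at 0)"
    by (auto intro!: derivative_eq_intros)
  ultimately have 2: "dgmul (0, 0) (0, b) = b"
    using vector_derivative_unique_at by fastforce
  have "dgmul (0, 0) (a, b) = dgmul (0, 0) (a, 0) + dgmul (0, 0) (0, b)"
    using linear_add[OF linear_dgmul, of "(0,0)" "(a,0)" "(0,b)"] by simp
  then show ?thesis
    using 1 2 by simp
qed

text \<open>The differential at the identity of left translation by \<open>g\<close>, that is, the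
  value at \<open>g\<close> of the left-invariant field generated by \<open>v\<close>.\<close>

definition dleft :: "'a \<Rightarrow> 'a \<Rightarrow> 'a" where
  "dleft g v = dgmul (g, 0) (0, v)"

lemma linear_dleft: "linear (dleft g)"
  unfolding dleft_def
  by (rule linear_compose[OF _ linear_dgmul, of "\<lambda>v. (0, v)", unfolded o_def])
     (auto intro!: linearI)

lemma dleft_zero [simp]: "dleft 0 v = v"
  by (simp add: dleft_def dgmul_zero)

lemma has_vector_derivative_gmul_right:
  "((\<lambda>t. gmul g (t *\<^sub>R v)) has_vector_derivative dleft g v) (at 0)"
proof -
  have "((\<lambda>t. gmul g (t *\<^sub>R v)) has_vector_derivative dgmul (g, 0 *\<^sub>R v) (0, v)) (at 0)"
    by (rule has_vector_derivative_gmul) (auto intro!: derivative_eq_intros)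
  then show ?thesis
    by (simp add: dleft_def)
qed

text \<open>The mixed second derivative of the product at the identity. In exponential coordinates
  it turns out antisymmetric, hence equal to half of the Lie bracket: the quadratic term of the
  Baker-Campbell-Hausdorff series.\<close>

definition half_bracket :: "'a \<Rightarrow> 'a \<Rightarrow> 'a" where
  "half_bracket u v = frechet_derivative (\<lambda>x. dleft x v) (at 0) u"

lemma has_derivative_dleft: "((\<lambda>x. dleft x v) has_derivative (\<lambda>u. half_bracket u v)) (at 0)"
proof -
  have "((\<lambda>x. (x, 0::'a)) has_derivative (\<lambda>x. (x, 0))) (at 0)"
    by (auto intro!: derivative_eq_intros)
  then have "(\<lambda>x. dgmul (x, 0) (0, v)) differentiable (at 0)"
    using differentiable_chain_at[of "\<lambda>x. (x, 0::'a)" 0 "\<lambda>q. dgmul q (0, v)"] differentiable_dgmul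
    by (auto simp: o_def differentiable_def)
  then show ?thesis
    unfolding half_bracket_def dleft_def by (simp flip: frechet_derivative_works)
qed

lemma linear_half_bracket_left: "linear (\<lambda>u. half_bracket u v)"
  using has_derivative_dleft has_derivative_linear by blast

lemma linear_half_bracket_right: "linear (half_bracket u)"
proof (rule linearI)
  fix v w
  have "((\<lambda>x. dleft x (v + w)) has_derivative (\<lambda>u. half_bracket u v + half_bracket u w)) (at 0)"
    using has_derivative_add[OF has_derivative_dleft has_derivative_dleft]
    by (simp add: linear_add[OF linear_dleft])
  then show "half_bracket u (v + w) = half_bracket u v + half_bracket u w"
    using has_derivative_unique[OF _ has_derivative_dleft] by metis
next
  fix c v
  have "((\<lambda>x. dleft x (c *\<^sub>R v)) has_derivative (\<lambda>u. c *\<^sub>R half_bracket u v)) (at 0)"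
    using has_derivative_scaleR_right[OF has_derivative_dleft]
    by (simp add: linear_scale[OF linear_dleft])
  then show "half_bracket u (c *\<^sub>R v) = c *\<^sub>R half_bracket u v"
    using has_derivative_unique[OF _ has_derivative_dleft] by metis
qed

lemma has_vector_derivative_dleft:
  "((\<lambda>s. dleft (s *\<^sub>R u) v) has_vector_derivative half_bracket u v) (at 0)"
proof -
  have "((\<lambda>s. s *\<^sub>R u) has_vector_derivative u) (at 0)"
    by (auto intro!: derivative_eq_intros)
  then have "((\<lambda>x. dleft x v) \<circ> (\<lambda>s. s *\<^sub>R u) has_vector_derivative half_bracket u v) (at 0)"
    by (rule vector_derivative_diff_chain_within)
       (use has_derivative_dleft[THEN has_derivative_at_withinI] in simp)
  then show ?thesis
    by (simp add: o_def)
qed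

text \<open>Since \<open>s u\<close> is a one-parameter subgroup, the left-invariant field of
  \<open>u\<close> is constant along its own line. Exponential coordinates enter here, and
  polarisation then gives antisymmetry.\<close>

lemma half_bracket_self: "half_bracket u u = 0"
proof -
  have "dleft (s *\<^sub>R u) u = u" for s
  proof -
    have "((\<lambda>t. gmul (s *\<^sub>R u) (t *\<^sub>R u)) has_vector_derivative u) (at 0)"
      unfolding one_parameter by (auto intro!: derivative_eq_intros)
    then show ?thesis
      using has_vector_derivative_gmul_right vector_derivative_unique_at by blast
  qed
  then have "((\<lambda>s. u) has_vector_derivative half_bracket u u) (at 0)"
    using has_vector_derivative_dleft[of u u] by simp
  then show ?thesis
    using vector_derivative_unique_at has_vector_derivative_const by blast
qed

lemma half_bracket_antisym: "half_bracket v u = - half_bracket u v"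
proof -
  have "half_bracket (u + v) (u + v) = 0"
    by (rule half_bracket_self)
  then have "half_bracket u v + half_bracket v u = 0"
    unfolding linear_add[OF linear_half_bracket_left] linear_add[OF linear_half_bracket_right]
    by (simp add: half_bracket_self add.commute)
  then show ?thesis
    by (simp add: add_eq_0_iff)
qed

lemma left_field_id: "left_field gmul v (\<lambda>x. x) = (\<lambda>g. dleft g v)"
  using vector_derivative_at[OF has_vector_derivative_gmul_right] by (auto simp: left_field_def)

lemma lie_bracket_eq: "lie_bracket gmul u v = 2 *\<^sub>R half_bracket u v"
proof -
  have "left_field gmul u (\<lambda>g. dleft g v) 0 = half_bracket u v" for u v
    using vector_derivative_at[OF has_vector_derivative_dleft] by (simp add: left_field_def)
  then show ?thesis
    unfolding lie_bracket_def left_field_id by (simp add: scaleR_2 half_bracket_antisym[of v u])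
qed

lemma linear_lie_bracket_left: "linear (\<lambda>u. lie_bracket gmul u v)"
  unfolding lie_bracket_eq by (intro linear_compose_scale_right linear_half_bracket_left)

lemma linear_lie_bracket_right: "linear (lie_bracket gmul u)"
  unfolding lie_bracket_eq by (intro linear_compose_scale_right linear_half_bracket_right)

section \<open>The adjoint action\<close>

definition Ad :: "'a \<Rightarrow> 'a \<Rightarrow> 'a" where
  "Ad g v = gmul (gmul g v) (- g)"

lemma Ad_gmul_right: "Ad g (gmul x y) = gmul (Ad g x) (Ad g y)"
  by (simp add: Ad_def gmul.assoc)

lemma Ad_gmul_left: "Ad (gmul g h) x = Ad g (Ad h x)"
  by (simp add: Ad_def gmul.assoc minus_gmul)

lemma Ad_zero_left [simp]: "Ad 0 v = v"
  using gmul.right_neutral by (simp add: Ad_def)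

lemma Ad_zero_right [simp]: "Ad g 0 = 0"
  by (simp add: Ad_def)

lemma Ad_minus_Ad [simp]: "Ad g (Ad (- g) v) = v"
  by (simp flip: Ad_gmul_left)

lemma real_of_nat_gmul_add: "gmul (real n *\<^sub>R x) x = real (Suc n) *\<^sub>R x"
  using one_parameter[of "real n" x 1] by (simp add: add.commute)

text \<open>In exponential coordinates an integer multiple is a power, and conjugation is a
  homomorphism.\<close>

lemma Ad_of_nat: "Ad g (real n *\<^sub>R v) = real n *\<^sub>R Ad g v"
proof (induction n)
  case (Suc n)
  show ?case
    by (simp only: real_of_nat_gmul_add[symmetric] Ad_gmul_right Suc)
qed simp

text \<open>A derivative at the origin is determined along \<open>v / n\<close>, where homogeneity makes the
  difference quotient constant.\<close>

lemma eq_derivative_of_nat_homogeneous: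
  fixes f :: "'b::real_normed_vector \<Rightarrow> 'c::real_normed_vector"
  assumes "(f has_derivative f') (at 0)" and hom: "\<And>n v. f (real n *\<^sub>R v) = real n *\<^sub>R f v"
  shows "f v = f' v"
proof (cases "v = 0")
  case True
  then show ?thesis
    using hom[of 0 0] assms(1) has_derivative_linear linear_0 by fastforce
next
  case False
  have f0: "f 0 = 0"
    using hom[of 0 0] by simp
  have f': "linear f'"
    using assms(1) has_derivative_linear by blast
  define y where "y n = inverse (real (Suc n)) *\<^sub>R v" for n
  have "y \<longlonglongrightarrow> 0"
    unfolding y_def using tendsto_scaleR[OF LIMSEQ_inverse_real_of_nat tendsto_const] by fastforce
  then have "filterlim y (at 0) sequentially"
    using False by (simp add: filterlim_at y_def)
  moreover have "((\<lambda>h. norm (f h - f' h) / norm h) \<longlongrightarrow> 0) (at 0)"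
    using assms(1) by (simp add: has_derivative_at f0)
  ultimately have "(\<lambda>n. norm (f (y n) - f' (y n)) / norm (y n)) \<longlonglongrightarrow> 0"
    using filterlim_compose by blast
  moreover have "norm (f (y n) - f' (y n)) / norm (y n) = norm (f v - f' v) / norm v" for n
  proof -
    have v: "v = real (Suc n) *\<^sub>R y n"
      by (simp add: y_def del: of_nat_Suc)
    have "norm (f v - f' v) / norm v = norm (real (Suc n) *\<^sub>R (f (y n) - f' (y n))) / norm (real (Suc n) *\<^sub>R y n)"
      by (simp only: scaleR_diff_right hom[symmetric] linear_scale[OF f', symmetric] v[symmetric])
    also have "\<dots> = norm (f (y n) - f' (y n)) / norm (y n)"
      by (simp del: of_nat_Suc)
    finally show ?thesis ..
  qed
  ultimately show ?thesis
    using False by (simp add: tendsto_const_iff)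
qed

text \<open>Conjugation is differentiable at the identity and commutes with integer multiples, so it
  coincides with its derivative there.\<close>

lemma linear_Ad: "linear (Ad g)"
proof -
  have "((\<lambda>v. (g, v)) has_derivative (\<lambda>v. (0, v))) (at 0)"
    by (auto intro!: derivative_eq_intros)
  then have "((\<lambda>v. gmul g v) has_derivative (\<lambda>v. dgmul (g, 0) (0, v))) (at 0)"
    using diff_chain_at[OF _ has_derivative_gmul, of "\<lambda>v. (g, v)"] by (simp add: o_def)
  then have "((\<lambda>v. (gmul g v, - g)) has_derivative (\<lambda>v. (dgmul (g, 0) (0, v), 0))) (at 0)"
    by (auto intro!: derivative_eq_intros)
  then have "\<exists>D. (Ad g has_derivative D) (at 0)"
    using diff_chain_at[OF _ has_derivative_gmul, of "\<lambda>v. (gmul g v, - g)"]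
    by (auto simp: o_def Ad_def[abs_def])
  then obtain D where D: "(Ad g has_derivative D) (at 0)" ..
  then have "Ad g = D"
    using eq_derivative_of_nat_homogeneous Ad_of_nat by blast
  then show ?thesis
    using D has_derivative_linear by blast
qed

lemma gmul_commute_Ad: "gmul x v = gmul (Ad x v) x"
  by (simp add: Ad_def gmul.assoc)

text \<open>Differentiating \<open>x v = (Ad\<^sub>x v) x\<close> with \<open>x = s u\<close>, the right translation on the right being
  turned into a left one by inversion.\<close>

lemma has_vector_derivative_Ad:
  "((\<lambda>s. Ad (s *\<^sub>R u) v) has_vector_derivative lie_bracket gmul u v) (at 0)"
proof -
  let ?a = "\<lambda>s. Ad (s *\<^sub>R u) v"
  have "\<exists>a'. (?a has_vector_derivative a') (at 0)"
  proof -
    have *: "((\<lambda>s. s *\<^sub>R u) has_vector_derivative u) (at 0)"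
        "((\<lambda>s. - (s *\<^sub>R u)) has_vector_derivative - u) (at 0)"
        "((\<lambda>s. v) has_vector_derivative 0) (at (0::real))"
      by (auto intro!: derivative_eq_intros)
    show ?thesis
      unfolding Ad_def
      using has_vector_derivative_gmul[OF has_vector_derivative_gmul[OF *(1,3)] *(2)] by blast
  qed
  then obtain a' where a': "(?a has_vector_derivative a') (at 0)" ..
  \<comment> \<open>In \<open>dleft (- s *\<^sub>R u) (?a s)\<close> both the point and the vector
    depend on \<open>s\<close>. Expanding the vector in the basis reduces its differentiation to the
    product rule.\<close>
  have eq: "dleft (s *\<^sub>R u) v = (\<Sum>b\<in>Basis. (?a s \<bullet> b) *\<^sub>R dleft (- s *\<^sub>R u) b)" for s
  proof -
    have "gmul (s *\<^sub>R u) (t *\<^sub>R v) = - gmul (- s *\<^sub>R u) (t *\<^sub>R (- ?a s))" for t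
      by (subst gmul_commute_Ad) (simp add: minus_gmul linear_scale[OF linear_Ad])
    moreover have "((\<lambda>t. - gmul (- s *\<^sub>R u) (t *\<^sub>R (- ?a s))) has_vector_derivative
        - dleft (- s *\<^sub>R u) (- ?a s)) (at 0)"
      by (intro has_vector_derivative_minus has_vector_derivative_gmul_right)
    ultimately have "((\<lambda>t. gmul (s *\<^sub>R u) (t *\<^sub>R v)) has_vector_derivative
        - dleft (- s *\<^sub>R u) (- ?a s)) (at 0)"
      by simp
    then have "dleft (s *\<^sub>R u) v = - dleft (- s *\<^sub>R u) (- ?a s)"
      using has_vector_derivative_gmul_right vector_derivative_unique_at by blast
    also have "\<dots> = dleft (- s *\<^sub>R u) (?a s)"
      by (simp add: linear_neg[OF linear_dleft])
    also have "\<dots> = dleft (- s *\<^sub>R u) (\<Sum>b\<in>Basis. (?a s \<bullet> b) *\<^sub>R b)"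
      by (simp add: euclidean_representation)
    also have "\<dots> = (\<Sum>b\<in>Basis. (?a s \<bullet> b) *\<^sub>R dleft (- s *\<^sub>R u) b)"
      by (simp add: linear_sum[OF linear_dleft] linear_scale[OF linear_dleft])
    finally show ?thesis .
  qed
  have minus: "((\<lambda>s. dleft (- s *\<^sub>R u) b) has_vector_derivative - half_bracket u b) (at 0)" for b
    using has_vector_derivative_dleft[of "- u" b]
    by (simp add: linear_neg[OF linear_half_bracket_left])
  have inner: "((\<lambda>s. ?a s \<bullet> b) has_real_derivative a' \<bullet> b) (at 0)" for b
    using bounded_linear.has_vector_derivative[OF bounded_linear_inner_left a']
    by (simp add: has_real_derivative_iff_has_vector_derivative)
  have "((\<lambda>s. \<Sum>b\<in>Basis. (?a s \<bullet> b) *\<^sub>R dleft (- s *\<^sub>R u) b) has_vector_derivative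
     (\<Sum>b\<in>Basis. (?a 0 \<bullet> b) *\<^sub>R (- half_bracket u b) + (a' \<bullet> b) *\<^sub>R dleft (- 0 *\<^sub>R u) b)) (at 0)"
    by (intro has_vector_derivative_sum has_vector_derivative_scaleR inner minus)
  also have "(\<Sum>b\<in>Basis. (?a 0 \<bullet> b) *\<^sub>R (- half_bracket u b) + (a' \<bullet> b) *\<^sub>R dleft (- 0 *\<^sub>R u) b)
      = a' - (\<Sum>b\<in>Basis. half_bracket u ((v \<bullet> b) *\<^sub>R b))"
    by (simp add: euclidean_representation linear_scale[OF linear_half_bracket_right] sum_subtractf)
  also have "\<dots> = a' - half_bracket u (\<Sum>b\<in>Basis. (v \<bullet> b) *\<^sub>R b)"
    by (simp only: linear_sum[OF linear_half_bracket_right])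
  also have "\<dots> = a' - half_bracket u v"
    by (simp add: euclidean_representation)
  finally have "((\<lambda>s. dleft (s *\<^sub>R u) v) has_vector_derivative a' - half_bracket u v) (at 0)"
    by (simp add: eq)
  then have "a' - half_bracket u v = half_bracket u v"
    using has_vector_derivative_dleft vector_derivative_unique_at by blast
  then have "a' = lie_bracket gmul u v"
    by (simp add: lie_bracket_eq scaleR_2 algebra_simps)
  then show ?thesis
    using a' by simp
qed

text \<open>By linearity \<open>v\<close> may be taken in a single layer. Its bracket with
  \<open>u\<close> then vanishes or lies in the next layer, which is orthogonal to the first. The
  stratification prescribes only brackets with elements of \<open>V 1\<close>, so a general first
  argument needs the separate treatment in \<open>bracket_ortho_V1\<close>.\<close>

lemma V1_ortho_bracket:
  assumes "w \<in> V 1" "u \<in> V 1"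
  shows "lie_bracket gmul u v \<bullet> w = 0"
proof -
  have "v \<in> span (\<Union>j\<in>{1..r}. V j)"
    unfolding span_layers by simp
  then show ?thesis
  proof (induction rule: span_induct)
    case base
    show ?case
      by (auto simp: subspace_def linear_0[OF linear_lie_bracket_right]
        linear_add[OF linear_lie_bracket_right] linear_scale[OF linear_lie_bracket_right] inner_add_left)
  next
    case (step x)
    then obtain j where j: "j \<in> {1..r}" "x \<in> V j"
      by auto
    show ?case
    proof (cases "j = r")
      case True
      then show ?thesis
        using bracket_last[OF assms(2)] j by simp
    next
      case False
      then have j': "j \<in> {1..<r}" "Suc j \<in> {1..r}"
        using j by auto
      have "lie_bracket gmul u x \<in> V (Suc j)"
        unfolding bracket_layer[OF j'(1), symmetric] using assms j by (auto intro!: span_base)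
      then show ?thesis
        using orthogonal_layers[OF j'(2), of 1] step_pos assms(1) j by auto
    qed
  qed
qed

text \<open>\<open>Ad\<close> turns the one-parameter subgroup into a flow, so the derivative at
  time \<open>s\<close> is the bracket of \<open>x\<close> with \<open>Ad (s *\<^sub>R x) v\<close>,
  paired with \<open>w\<close>; this is zero by assumption.\<close>

lemma Ad_invariant_line:
  assumes "\<And>v. lie_bracket gmul x v \<bullet> w = 0"
  shows "Ad (s *\<^sub>R x) v \<bullet> w = v \<bullet> w"
proof -
  have "((\<lambda>s. Ad (s *\<^sub>R x) v \<bullet> w) has_real_derivative 0) (at s)" for s
  proof -
    have "((\<lambda>h. Ad (h *\<^sub>R x) (Ad (s *\<^sub>R x) v) \<bullet> w) has_real_derivative 0) (at 0)"
      using bounded_linear.has_vector_derivative[OF bounded_linear_inner_left has_vector_derivative_Ad, of x "Ad (s *\<^sub>R x) v" w]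
      by (simp add: has_real_derivative_iff_has_vector_derivative assms)
    also have "(\<lambda>h. Ad (h *\<^sub>R x) (Ad (s *\<^sub>R x) v) \<bullet> w) = (\<lambda>h. Ad ((h + s) *\<^sub>R x) v \<bullet> w)"
      by (simp flip: Ad_gmul_left add: one_parameter)
    finally show ?thesis
      using DERIV_shift[of "\<lambda>s. Ad (s *\<^sub>R x) v \<bullet> w" 0 0 s] by simp
  qed
  then have "Ad (s *\<^sub>R x) v \<bullet> w = Ad (0 *\<^sub>R x) v \<bullet> w"
    using DERIV_isconst_all by blast
  then show ?thesis
    by simp
qed

text \<open>The set of all \<open>x\<close> whose bracket with everything is orthogonal to \<open>w\<close> is the Lie algebra of
  the stabiliser of \<open>\<langle>\<cdot>, w\<rangle>\<close> under \<open>Ad\<close>, hence it is invariant under brackets with elements of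
  \<open>V 1\<close>; since it contains \<open>V 1\<close>, it contains all layers. This replaces the Jacobi identity.\<close>

lemma bracket_ortho_V1:
  assumes w: "w \<in> V 1"
  shows "lie_bracket gmul x v \<bullet> w = 0"
proof -
  define H where "H = {x. \<forall>v. lie_bracket gmul x v \<bullet> w = 0}"
  have sub: "subspace H"
    by (auto simp: H_def subspace_def linear_0[OF linear_lie_bracket_left]
      linear_add[OF linear_lie_bracket_left] linear_scale[OF linear_lie_bracket_left] inner_add_left)
  have V1: "V 1 \<subseteq> H"
    using V1_ortho_bracket[OF w] by (auto simp: H_def)
  have inv: "lie_bracket gmul u x \<in> H" if u: "u \<in> V 1" and x: "x \<in> H" for u x
  proof -
    have inv_u: "Ad (s *\<^sub>R u) v \<bullet> w = v \<bullet> w" for s v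
      by (rule Ad_invariant_line) (use u V1 in \<open>auto simp: H_def\<close>)
    have inv_x: "Ad (s *\<^sub>R x) v \<bullet> w = v \<bullet> w" for s v
      by (rule Ad_invariant_line) (use x in \<open>auto simp: H_def\<close>)
    have "lie_bracket gmul (Ad (s *\<^sub>R u) x) v \<bullet> w = 0" for s v
    proof -
      have "Ad (t *\<^sub>R Ad (s *\<^sub>R u) x) v \<bullet> w = v \<bullet> w" for t
      proof -
        \<comment> \<open>By linearity of \<open>Ad\<close>, the line through the conjugated vector
          is the conjugate of the line through \<open>x\<close>; each of the three factors preserves
          the pairing with \<open>w\<close>.\<close>
        have "t *\<^sub>R Ad (s *\<^sub>R u) x = gmul (gmul (s *\<^sub>R u) (t *\<^sub>R x)) ((- s) *\<^sub>R u)"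
          by (subst linear_scale[OF linear_Ad, symmetric]) (simp add: Ad_def)
        then show ?thesis
          by (simp only: Ad_gmul_left inv_u inv_x)
      qed
      then have "((\<lambda>t. v \<bullet> w) has_real_derivative lie_bracket gmul (Ad (s *\<^sub>R u) x) v \<bullet> w) (at 0)"
        using bounded_linear.has_vector_derivative[OF bounded_linear_inner_left has_vector_derivative_Ad, of "Ad (s *\<^sub>R u) x" v w]
        by (simp add: has_real_derivative_iff_has_vector_derivative)
      then show ?thesis
        using DERIV_unique DERIV_const by blast
    qed
    \<comment> \<open>The pairing just shown to vanish for every \<open>s\<close> is differentiated
      at 0, which brings down a bracket with \<open>u\<close>.\<close>
    moreover have "((\<lambda>s. lie_bracket gmul (Ad (s *\<^sub>R u) x) v \<bullet> w) has_real_derivative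
        lie_bracket gmul (lie_bracket gmul u x) v \<bullet> w) (at 0)" for v
      using bounded_linear.has_vector_derivative[OF bounded_linear_inner_left
          bounded_linear.has_vector_derivative[OF linear_lie_bracket_left[THEN linear_conv_bounded_linear[THEN iffD1]]
          has_vector_derivative_Ad, of u x v], of w]
      by (simp add: has_real_derivative_iff_has_vector_derivative)
    ultimately have "lie_bracket gmul (lie_bracket gmul u x) v \<bullet> w = 0" for v
      using DERIV_unique DERIV_const by fastforce
    then show ?thesis
      by (simp add: H_def)
  qed
  have VH: "V j \<subseteq> H" if "j \<in> {1..r}" for j
    using that
  proof (induction j)
    case (Suc j)
    show ?case
    proof (cases "j = 0")
      case True
      then show ?thesis
        using V1 by simp
    next
      case False
      then have j: "j \<in> {1..<r}" "V j \<subseteq> H"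
        using Suc by auto
      then show ?thesis
        unfolding bracket_layer[OF j(1), symmetric] by (intro span_minimal sub) (auto intro: inv)
    qed
  qed simp
  then have "span (\<Union>j\<in>{1..r}. V j) \<subseteq> H"
    by (intro span_minimal sub) (use VH in blast)
  then show ?thesis
    unfolding span_layers by (auto simp: H_def)
qed

lemma Ad_inner_V1: "w \<in> V 1 \<Longrightarrow> Ad g v \<bullet> w = v \<bullet> w"
  using Ad_invariant_line[of g w 1 v] bracket_ortho_V1 by simp

text \<open>The left-trivialised derivative \<open>J(s)\<close> of the identity map along \<open>s g\<close> is a cocycle for \<open>Ad\<close>,
  so its component along \<open>w\<close> is additive in \<open>s\<close>.\<close>

lemma dgmul_inner_V1:
  assumes w: "w \<in> V 1"
  shows "dgmul (- g, g) (0, v) \<bullet> w = v \<bullet> w"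
proof -
  define J where "J s = dgmul ((- s) *\<^sub>R g, s *\<^sub>R g) (0, s *\<^sub>R v)" for s :: real
  have J: "((\<lambda>\<epsilon>. gmul ((- s) *\<^sub>R g) (s *\<^sub>R (g + \<epsilon> *\<^sub>R v))) has_vector_derivative J s) (at 0)" for s
  proof -
    have "((\<lambda>\<epsilon>. gmul ((- s) *\<^sub>R g) (s *\<^sub>R (g + \<epsilon> *\<^sub>R v))) has_vector_derivative
        dgmul ((- s) *\<^sub>R g, s *\<^sub>R (g + 0 *\<^sub>R v)) (0, s *\<^sub>R v)) (at 0)"
      by (rule has_vector_derivative_gmul) (auto intro!: derivative_eq_intros)
    then show ?thesis
      by (simp add: J_def)
  qed
  have add: "J (s + h) = Ad ((- s) *\<^sub>R g) (J h) + J s" for s h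
  proof -
    let ?c = "\<lambda>s \<epsilon>. gmul ((- s) *\<^sub>R g) (s *\<^sub>R (g + \<epsilon> *\<^sub>R v))"
    have c0: "?c s 0 = 0" for s
      using one_parameter[of "- s" g s] by simp
    have "?c (s + h) \<epsilon> = gmul (Ad ((- s) *\<^sub>R g) (?c h \<epsilon>)) (?c s \<epsilon>)" for \<epsilon>
    proof -
      \<comment> \<open>The two factors are split in opposite orders, so that the \<open>h\<close>
        part lands in the middle and appears conjugated by \<open>- s *\<^sub>R g\<close>.\<close>
      have 1: "(- (s + h)) *\<^sub>R g = gmul ((- s) *\<^sub>R g) ((- h) *\<^sub>R g)"
          "(s + h) *\<^sub>R (g + \<epsilon> *\<^sub>R v) = gmul (h *\<^sub>R (g + \<epsilon> *\<^sub>R v)) (s *\<^sub>R (g + \<epsilon> *\<^sub>R v))"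
        by (simp_all only: one_parameter) (simp_all add: add.commute)
      have "gmul (- (- s *\<^sub>R g)) (gmul (- s *\<^sub>R g) y) = y" for y
        by (rule gmul_minus_cancel)
      then show ?thesis
        unfolding 1 Ad_def by (simp add: gmul.assoc)
    qed
    moreover have "((\<lambda>\<epsilon>. gmul (Ad ((- s) *\<^sub>R g) (?c h \<epsilon>)) (?c s \<epsilon>)) has_vector_derivative
        dgmul (Ad ((- s) *\<^sub>R g) (?c h 0), ?c s 0) (Ad ((- s) *\<^sub>R g) (J h), J s)) (at 0)"
      by (intro has_vector_derivative_gmul J
        bounded_linear.has_vector_derivative[OF linear_Ad[THEN linear_conv_bounded_linear[THEN iffD1]]])
    ultimately have "((\<lambda>\<epsilon>. ?c (s + h) \<epsilon>) has_vector_derivative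
        (Ad ((- s) *\<^sub>R g) (J h) + J s)) (at 0)"
      unfolding c0 Ad_zero_right dgmul_zero by simp
    then show ?thesis
      using J vector_derivative_unique_at by blast
  qed
  have addl: "J (s + h) \<bullet> w = J s \<bullet> w + J h \<bullet> w" for s h
    by (simp only: add inner_add_left Ad_inner_V1[OF w] add.commute)
  have J0: "J 0 \<bullet> w = 0"
    using addl[of 0 0] by simp
  have nJ: "J (real n * s) \<bullet> w = real n * (J s \<bullet> w)" for n s
    by (induction n) (simp_all add: J0 addl distrib_right)
  have "((\<lambda>s. J s \<bullet> w) has_real_derivative v \<bullet> w) (at 0)"
  proof -
    have "((\<lambda>s. dgmul ((- s) *\<^sub>R g, s *\<^sub>R g) (0, v) \<bullet> w) \<longlongrightarrow>
        dgmul ((- 0) *\<^sub>R g, 0 *\<^sub>R g) (0, v) \<bullet> w) (at 0)"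
      by (intro tendsto_inner tendsto_const
         continuous_on_tendsto_compose[OF continuous_dgmul]) (auto intro!: tendsto_eq_intros)
    moreover have "J s \<bullet> w / s = dgmul ((- s) *\<^sub>R g, s *\<^sub>R g) (0, v) \<bullet> w" if "s \<noteq> 0" for s
      using linear_scale[OF linear_dgmul, of "((- s) *\<^sub>R g, s *\<^sub>R g)" s "(0, v)"] that
      by (simp add: J_def)
    ultimately have "((\<lambda>s. J s \<bullet> w / s) \<longlongrightarrow> v \<bullet> w) (at 0)"
      by (subst tendsto_cong[where g = "\<lambda>s. dgmul ((- s) *\<^sub>R g, s *\<^sub>R g) (0, v) \<bullet> w"])
         (auto simp: eventually_at_filter dgmul_zero)
    then show ?thesis
      by (simp add: DERIV_def J0)
  qed
  then have "((\<lambda>s. J s \<bullet> w) has_derivative (\<lambda>s. (v \<bullet> w) * s)) (at 0)"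
    by (simp add: has_field_derivative_def)
  then have "J 1 \<bullet> w = (v \<bullet> w) * 1"
    by (rule eq_derivative_of_nat_homogeneous) (simp add: nJ)
  then show ?thesis
    by (simp add: J_def)
qed

text \<open>Left translation by \<open>- g\<close> undoes left translation by \<open>g\<close>, so
  its differential at \<open>g\<close> maps \<open>dleft g b\<close> back to \<open>b\<close>; that
  differential preserves the component along \<open>w\<close> by
  \<open>dgmul_inner_V1\<close>.\<close>

lemma dleft_inner_V1:
  assumes "w \<in> V 1"
  shows "dleft g b \<bullet> w = b \<bullet> w"
proof -
  have "((\<lambda>t. gmul (- g) (gmul g (t *\<^sub>R b))) has_vector_derivative
      dgmul (- g, gmul g (0 *\<^sub>R b)) (0, dleft g b)) (at 0)"
    by (intro has_vector_derivative_gmul has_vector_derivative_gmul_right has_vector_derivative_const)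
  moreover have "((\<lambda>t. gmul (- g) (gmul g (t *\<^sub>R b))) has_vector_derivative b) (at 0)"
    by (auto intro!: derivative_eq_intros)
  ultimately have "b = dgmul (- g, g) (0, dleft g b)"
    using vector_derivative_unique_at by fastforce
  then show ?thesis
    using dgmul_inner_V1[OF assms] by metis
qed

text \<open>The velocity of the curve \<open>gmul x (t *\<^sub>R y)\<close> is the left-invariant
  field of \<open>y\<close>, whose component along \<open>w\<close> is the constant
  \<open>y \<bullet> w\<close>. Integrate from 0 to 1.\<close>

lemma gmul_inner_V1:
  assumes "w \<in> V 1"
  shows "gmul x y \<bullet> w = x \<bullet> w + y \<bullet> w"
proof -
  have "((\<lambda>t. gmul x (t *\<^sub>R y) \<bullet> w - t * (y \<bullet> w)) has_real_derivative 0) (at s)" for s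
  proof -
    have "((\<lambda>h. gmul (gmul x (s *\<^sub>R y)) (h *\<^sub>R y) \<bullet> w) has_real_derivative y \<bullet> w) (at 0)"
      using bounded_linear.has_vector_derivative[OF bounded_linear_inner_left has_vector_derivative_gmul_right, of "gmul x (s *\<^sub>R y)" y w]
      by (simp add: has_real_derivative_iff_has_vector_derivative dleft_inner_V1[OF assms])
    also have "(\<lambda>h. gmul (gmul x (s *\<^sub>R y)) (h *\<^sub>R y) \<bullet> w) = (\<lambda>h. gmul x ((h + s) *\<^sub>R y) \<bullet> w)"
      by (simp add: gmul.assoc one_parameter add.commute)
    finally have "((\<lambda>t. gmul x (t *\<^sub>R y) \<bullet> w) has_real_derivative y \<bullet> w) (at s)"
      using DERIV_shift[of "\<lambda>s. gmul x (s *\<^sub>R y) \<bullet> w" "y \<bullet> w" 0 s] by simp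
    then show ?thesis
      by (auto intro!: derivative_eq_intros)
  qed
  then have "gmul x (1 *\<^sub>R y) \<bullet> w - 1 * (y \<bullet> w) = gmul x (0 *\<^sub>R y) \<bullet> w - 0 * (y \<bullet> w)"
    using DERIV_isconst_all by blast
  then show ?thesis
    by simp
qed

end

section \<open>Invariance of the heat semigroup\<close>

lemma C0_functionsD:
  assumes "f \<in> C0_functions"
  shows C0_continuous: "continuous_on UNIV f" and C0_tendsto: "(f \<longlongrightarrow> 0) at_infinity"
  using assms by (auto simp: C0_functions_def)

lemma C0_linear_combination:
  assumes "f \<in> C0_functions" "h \<in> C0_functions"
  shows "(\<lambda>g. a * f g + b * h g) \<in> C0_functions"
  using assms tendsto_add[OF tendsto_mult_right_zero tendsto_mult_right_zero, of f at_infinity h a b]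
  by (auto simp: C0_functions_def intro!: continuous_intros)

lemma C0_scale: "f \<in> C0_functions \<Longrightarrow> (\<lambda>g. a * f g) \<in> C0_functions"
  using C0_linear_combination[of f f a 0] by simp

lemma C0_diff: "f \<in> C0_functions \<Longrightarrow> h \<in> C0_functions \<Longrightarrow> (\<lambda>g. f g - h g) \<in> C0_functions"
  using C0_linear_combination[of f h 1 "-1"] by simp

lemma C0_bounded:
  fixes f :: "'a::euclidean_space \<Rightarrow> real"
  assumes "f \<in> C0_functions"
  obtains M where "\<And>g. \<bar>f g\<bar> \<le> M"
proof -
  have "\<forall>\<^sub>F x in at_infinity. dist (f x) 0 < 1"
    using C0_tendsto[OF assms] tendstoD zero_less_one by blast
  then obtain R where R: "\<And>x. R \<le> norm x \<Longrightarrow> \<bar>f x\<bar> < 1"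
    by (auto simp: eventually_at_infinity)
  have "compact (f ` cball 0 R)"
    using C0_continuous[OF assms] by (intro compact_continuous_image) (auto intro: continuous_on_subset)
  then obtain B where "\<forall>x\<in>cball 0 R. \<bar>f x\<bar> \<le> B"
    by (auto dest!: compact_imp_bounded simp: bounded_iff)
  then have B: "norm x \<le> R \<Longrightarrow> \<bar>f x\<bar> \<le> B" for x
    by simp
  have "\<bar>f x\<bar> \<le> max 1 B" for x
    using R[of x] B[of x] by (cases "norm x \<le> R") (auto simp: le_max_iff_disj)
  then show ?thesis
    using that by blast
qed

lemma C0_uniform_limit:
  assumes "\<forall>\<^sub>F n in F. f n \<in> C0_functions" "uniform_limit UNIV f l F" "F \<noteq> bot"
  shows "l \<in> C0_functions"
proof -
  have 1: "\<forall>\<^sub>F n in F. continuous_on UNIV (f n)" "\<forall>\<^sub>F n in F. (f n \<longlongrightarrow> 0) at_infinity"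
    using assms(1) by (simp_all add: C0_functions_def eventually_conj_iff)
  have "continuous_on UNIV l"
    by (rule uniform_limit_theorem[OF 1(1) assms(2,3)])
  moreover have "(l \<longlongrightarrow> 0) at_infinity"
    by (rule swap_uniform_limit'[OF 1(2) tendsto_const assms(2) _ assms(3)]) simp
  ultimately show ?thesis
    by (simp add: C0_functions_def)
qed

context carnot_group
begin

section \<open>Left translations and the horizontal Laplacian\<close>

lemma smooth_on_gmul: "smooth_on UNIV (gmul x)"
proof -
  have "smooth_on UNIV (\<lambda>y. (x, 0) + (0::'a, y))"
    by (rule smooth_on_add[OF smooth_on_const smooth_on_linear])
       (rule bounded_linear_Pair[OF bounded_linear_zero bounded_linear_ident])
  then show ?thesis
    using smooth_on_compose[OF smooth_gmul, of "\<lambda>y. (x, y)"] by simp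
qed

lemma compact_translate: "compact K \<Longrightarrow> compact (gmul x ` K)"
  by (rule compact_continuous_image[OF continuous_on_gmul[OF continuous_on_const continuous_on_id]])

lemma test_function_translate:
  assumes "test_function f"
  shows "test_function (\<lambda>y. f (gmul x y))"
proof -
  let ?K = "closure {y. f y \<noteq> 0}"
  have f: "smooth_on UNIV f" "compact ?K"
    using assms by (simp_all only: test_function_def)
  have "{y. f (gmul x y) \<noteq> 0} \<subseteq> gmul (- x) ` ?K"
  proof
    fix y
    assume "y \<in> {y. f (gmul x y) \<noteq> 0}"
    then have "gmul x y \<in> ?K"
      using subsetD[OF closure_subset[of "{y. f y \<noteq> 0}"]] by simp
    then show "y \<in> gmul (- x) ` ?K"
      by (rule image_eqI[rotated]) simp
  qed
  then show ?thesis
    by (rule test_functionI[OF smooth_on_compose[OF f(1) smooth_on_gmul] _ compact_translate[OF f(2)]])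
qed

lemma horizontal_laplacian_translate:
  "horizontal_laplacian gmul e (\<lambda>y. u (gmul x y)) g = horizontal_laplacian gmul e u (gmul x g)"
  by (simp add: horizontal_laplacian_def left_field_def gmul.assoc)

lemma uniform_limit_translate:
  fixes \<phi> :: "'n \<Rightarrow> 'a \<Rightarrow> real"
  assumes "uniform_limit UNIV \<phi> f F"
  shows "uniform_limit UNIV (\<lambda>n y. \<phi> n (gmul x y)) (\<lambda>y. f (gmul x y)) F"
proof (rule uniform_limitI)
  fix \<epsilon> :: real
  assume "0 < \<epsilon>"
  from uniform_limitD[OF assms this]
  show "\<forall>\<^sub>F n in F. \<forall>y\<in>UNIV. dist (\<phi> n (gmul x y)) (f (gmul x y)) < \<epsilon>"
    by eventually_elim simp
qed

lemma has_closure_value_translate: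
  assumes "has_closure_value (horizontal_laplacian gmul e) f h"
  shows "has_closure_value (horizontal_laplacian gmul e) (\<lambda>y. f (gmul x y)) (\<lambda>y. h (gmul x y))"
proof -
  obtain \<phi> where \<phi>: "\<forall>n::nat. test_function (\<phi> n)" "uniform_limit UNIV \<phi> f sequentially"
    "uniform_limit UNIV (\<lambda>n. horizontal_laplacian gmul e (\<phi> n)) h sequentially"
    using assms by (auto simp: has_closure_value_def)
  have "(\<lambda>g. horizontal_laplacian gmul e (\<phi> n) (gmul x g)) = horizontal_laplacian gmul e (\<lambda>y. \<phi> n (gmul x y))" for n
    by (rule ext) (rule horizontal_laplacian_translate[symmetric])
  then have "uniform_limit UNIV (\<lambda>n. horizontal_laplacian gmul e (\<lambda>y. \<phi> n (gmul x y))) (\<lambda>y. h (gmul x y)) sequentially"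
    using uniform_limit_translate[OF \<phi>(3), of x] by simp
  then show ?thesis
    unfolding has_closure_value_def
    using \<phi>(1) test_function_translate uniform_limit_translate[OF \<phi>(2)]
    by (intro exI[of _ "\<lambda>n y. \<phi> n (gmul x y)"]) simp
qed

end

locale carnot_heat = carnot_group gmul V r e
  for gmul :: "'a::euclidean_space \<Rightarrow> 'a \<Rightarrow> 'a" and V r and e :: "'m::finite \<Rightarrow> 'a" +
  fixes P :: "real \<Rightarrow> ('a \<Rightarrow> real) \<Rightarrow> 'a \<Rightarrow> real"
    and hk :: "'a \<Rightarrow> 'a \<Rightarrow> real \<Rightarrow> real"
  assumes heat_semigroup: "heat_semigroup gmul e P"
    and heat_kernel: "heat_kernel P hk"
begin

section \<open>The semigroup and its generator\<close>

lemma contraction_semigroup: "contraction_semigroup P"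
  using heat_semigroup by (simp add: heat_semigroup_def)

lemma
  assumes "f \<in> C0_functions"
  shows P_C0: "0 \<le> t \<Longrightarrow> P t f \<in> C0_functions"
    and P_bound: "0 \<le> t \<Longrightarrow> (\<And>g. \<bar>f g\<bar> \<le> M) \<Longrightarrow> \<bar>P t f g\<bar> \<le> M"
    and P_zero: "P 0 f = f"
    and P_add: "0 \<le> s \<Longrightarrow> 0 \<le> t \<Longrightarrow> P (s + t) f = P s (P t f)"
    and P_linear_combination: "0 \<le> t \<Longrightarrow> h \<in> C0_functions \<Longrightarrow>
      P t (\<lambda>g. a * f g + b * h g) = (\<lambda>g. a * P t f g + b * P t h g)"
    and P_uniform_limit: "uniform_limit UNIV (\<lambda>t. P t f) f (at_right 0)"
proof -
  note cs = contraction_semigroup[unfolded contraction_semigroup_def]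
  show "P t f \<in> C0_functions" if "0 \<le> t"
    using cs[THEN conjunct1] assms that by simp
  show "P t (\<lambda>g. a * f g + b * h g) = (\<lambda>g. a * P t f g + b * P t h g)" if "0 \<le> t" "h \<in> C0_functions"
    by (rule cs[THEN conjunct2, THEN conjunct1, rule_format]) (use assms that in simp_all)
  show "\<bar>P t f g\<bar> \<le> M" if "0 \<le> t" "\<And>g. \<bar>f g\<bar> \<le> M"
    using cs[THEN conjunct2, THEN conjunct2, THEN conjunct1, rule_format, OF that(1) assms] that(2) by simp
  show "P 0 f = f"
    using cs[THEN conjunct2, THEN conjunct2, THEN conjunct2, THEN conjunct1] assms by simp
  show "P (s + t) f = P s (P t f)" if "0 \<le> s" "0 \<le> t"
    by (rule cs[THEN conjunct2, THEN conjunct2, THEN conjunct2, THEN conjunct2, THEN conjunct1,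
      rule_format, OF that assms])
  show "uniform_limit UNIV (\<lambda>t. P t f) f (at_right 0)"
    by (rule cs[THEN conjunct2, THEN conjunct2, THEN conjunct2, THEN conjunct2, THEN conjunct2,
      rule_format, OF assms])
qed

lemma P_diff:
  assumes "f \<in> C0_functions" "h \<in> C0_functions" "0 \<le> t"
  shows "P t (\<lambda>g. f g - h g) = (\<lambda>g. P t f g - P t h g)"
  using P_linear_combination[of f t h 1 "- 1"] assms by simp

lemma generator_iff:
  "has_generator_value P f h \<longleftrightarrow> has_closure_value (horizontal_laplacian gmul e) f h"
  using heat_semigroup by (simp add: heat_semigroup_def)

lemma generator_test_function:
  assumes "test_function f"
  shows "has_generator_value P f (horizontal_laplacian gmul e f)"
  unfolding generator_iff has_closure_value_def
  using assms by (intro exI[of _ "\<lambda>n. f"]) (simp add: uniform_limit_const)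

text \<open>The closure of the Laplacian is translation invariant, and \<open>generator_iff\<close>
  is used in both directions to transfer this to the generator. It has to hold on the full domain,
  because it is applied to \<open>P t f\<close>, which need not be a test function.\<close>

lemma generator_translate:
  "has_generator_value P f h \<Longrightarrow> has_generator_value P (\<lambda>y. f (gmul x y)) (\<lambda>y. h (gmul x y))"
  unfolding generator_iff by (rule has_closure_value_translate)

lemma generator_C0:
  assumes "has_generator_value P f h"
  shows "f \<in> C0_functions" "h \<in> C0_functions"
proof -
  show f: "f \<in> C0_functions"
    using assms by (simp add: has_generator_value_def)
  show "h \<in> C0_functions"
  proof (rule C0_uniform_limit)
    show "uniform_limit UNIV (\<lambda>t g. (P t f g - f g) / t) h (at_right 0)"
      using assms by (simp add: has_generator_value_def)
    have "(\<lambda>g. (P t f g - f g) / t) \<in> C0_functions" if "0 < t" for t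
      using C0_scale[OF C0_diff[OF P_C0[OF f] f], of t "1 / t"] that by (simp add: less_imp_le)
    then show "\<forall>\<^sub>F t in at_right 0. (\<lambda>g. (P t f g - f g) / t) \<in> C0_functions"
      by (auto simp: eventually_at_filter)
  qed simp
qed

lemma generator_estimate:
  assumes "has_generator_value P f h" "0 < \<delta>"
  obtains d where "0 < d" "\<And>\<epsilon> g. 0 < \<epsilon> \<Longrightarrow> \<epsilon> < d \<Longrightarrow> \<bar>P \<epsilon> f g - f g - \<epsilon> * h g\<bar> \<le> \<delta> * \<epsilon>"
proof -
  have "\<forall>\<^sub>F t in at_right 0. \<forall>g\<in>UNIV. dist ((P t f g - f g) / t) (h g) < \<delta>"
    using assms by (intro uniform_limitD) (auto simp: has_generator_value_def)
  then obtain d where d: "0 < d" "\<And>t g. 0 < t \<Longrightarrow> t < d \<Longrightarrow> \<bar>(P t f g - f g) / t - h g\<bar> < \<delta>"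
    by (auto simp: eventually_at_right_field dist_real_def)
  show ?thesis
  proof
    fix \<epsilon> g
    assume \<epsilon>: "0 < \<epsilon>" "\<epsilon> < d"
    have "P \<epsilon> f g - f g - \<epsilon> * h g = ((P \<epsilon> f g - f g) / \<epsilon> - h g) * \<epsilon>"
      using \<epsilon> by (simp add: field_simps)
    then show "\<bar>P \<epsilon> f g - f g - \<epsilon> * h g\<bar> \<le> \<delta> * \<epsilon>"
      using d(2)[OF \<epsilon>, of g] \<epsilon> by (simp add: abs_mult)
  qed (rule d)
qed

lemma continuity_estimate:
  assumes "f \<in> C0_functions" "0 < \<delta>"
  obtains d where "0 < d" "\<And>\<epsilon> g. 0 < \<epsilon> \<Longrightarrow> \<epsilon> < d \<Longrightarrow> \<bar>P \<epsilon> f g - f g\<bar> \<le> \<delta>"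
proof -
  have "\<forall>\<^sub>F t in at_right 0. \<forall>g\<in>UNIV. dist (P t f g) (f g) < \<delta>"
    using assms by (intro uniform_limitD P_uniform_limit)
  then obtain d where "0 < d" "\<And>t g. 0 < t \<Longrightarrow> t < d \<Longrightarrow> \<bar>P t f g - f g\<bar> < \<delta>"
    by (auto simp: eventually_at_right_field dist_real_def)
  then show ?thesis
    using that less_imp_le by metis
qed

text \<open>\<open>P t\<close> commutes with the difference quotients and is a contraction, so it
  does not increase their uniform distance to the limit.\<close>

lemma generator_P:
  assumes fh: "has_generator_value P f h" and t: "0 \<le> t"
  shows "has_generator_value P (P t f) (P t h)"
proof -
  note C0 = generator_C0[OF fh]
  have "uniform_limit UNIV (\<lambda>s g. (P s (P t f) g - P t f g) / s) (P t h) (at_right 0)"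
  proof (rule uniform_limitI)
    fix \<epsilon> :: real
    assume \<epsilon>: "0 < \<epsilon>"
    have "\<forall>\<^sub>F s in at_right 0. \<forall>g\<in>UNIV. dist ((P s f g - f g) / s) (h g) < \<epsilon> / 2"
      using fh \<epsilon> by (intro uniform_limitD) (auto simp: has_generator_value_def)
    moreover have "\<forall>\<^sub>F s in at_right 0. (0::real) < s"
      by (simp add: eventually_at_filter)
    ultimately show "\<forall>\<^sub>F s in at_right 0. \<forall>g\<in>UNIV. dist ((P s (P t f) g - P t f g) / s) (P t h g) < \<epsilon>"
    proof eventually_elim
      case (elim s)
      define q where "q g = 1 / s * P s f g + (- 1 / s) * f g" for g
      have q: "q \<in> C0_functions"
        unfolding q_def by (intro C0_linear_combination P_C0 C0) (use elim in simp)
      have "P s (P t f) = P t (P s f)"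
        using P_add[OF C0(1), of s t] P_add[OF C0(1), of t s] t elim by (simp add: add.commute)
      moreover have "P t q g = 1 / s * P t (P s f) g + (- 1 / s) * P t f g" for g
        using P_linear_combination[OF P_C0[OF C0(1), of s] t C0(1), of "1 / s" "- 1 / s"] elim
        unfolding q_def[abs_def] by (simp only: less_imp_le)
      ultimately have eq: "(P s (P t f) g - P t f g) / s - P t h g = P t (\<lambda>g. q g - h g) g" for g
        by (simp add: P_diff[OF q C0(2) t] diff_divide_distrib)
      have "\<bar>P t (\<lambda>g. q g - h g) g\<bar> \<le> \<epsilon> / 2" for g
      proof (rule P_bound[OF C0_diff[OF q C0(2)] t])
        fix g
        have "q g = (P s f g - f g) / s"
          using elim by (simp add: q_def field_simps)
        then show "\<bar>q g - h g\<bar> \<le> \<epsilon> / 2"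
          using elim by (auto simp: dist_real_def intro: less_imp_le)
      qed
      then show ?case
        using \<epsilon> by (simp add: dist_real_def eq le_less_trans[of _ "\<epsilon> / 2"])
    qed
  qed
  then show ?thesis
    using P_C0[OF C0(1) t] by (simp add: has_generator_value_def)
qed

lemma generator_diff:
  assumes "has_generator_value P f h" "has_generator_value P f' h'"
  shows "has_generator_value P (\<lambda>g. f g - f' g) (\<lambda>g. h g - h' g)"
proof -
  note C0 = generator_C0(1)[OF assms(1)] generator_C0(1)[OF assms(2)]
  have "uniform_limit UNIV (\<lambda>t g. (P t f g - f g) / t - (P t f' g - f' g) / t) (\<lambda>g. h g - h' g) (at_right 0)"
    using assms by (intro uniform_limit_intros) (auto simp: has_generator_value_def)
  moreover have "\<forall>\<^sub>F t in at_right 0. \<forall>g\<in>UNIV. (P t f g - f g) / t - (P t f' g - f' g) / t =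
      (P t (\<lambda>g. f g - f' g) g - (f g - f' g)) / t"
  proof -
    have "(P t f g - f g) / t - (P t f' g - f' g) / t =
      (P t (\<lambda>g. f g - f' g) g - (f g - f' g)) / t" if "0 < t" for t g
      using P_diff[OF C0, of t] that by (simp add: field_simps)
    then show ?thesis
      by (simp add: eventually_at_filter)
  qed
  ultimately have "uniform_limit UNIV (\<lambda>t g. (P t (\<lambda>g. f g - f' g) g - (f g - f' g)) / t) (\<lambda>g. h g - h' g) (at_right 0)"
    by (rule uniform_limit_cong[THEN iffD1, rotated 2]) simp
  then show ?thesis
    using C0_diff[OF C0] by (simp add: has_generator_value_def)
qed

text \<open>The resolvent estimate: an implicit Euler step is a contraction in the supremum norm.
  Replacing \<open>k\<close> by a difference quotient over time \<open>s\<close> bounds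
  \<open>(1 + \<epsilon> / s) * \<bar>v g\<bar>\<close> by \<open>M + \<epsilon> / s * S\<close>
  plus a small error, where \<open>S\<close> is the supremum of \<open>\<bar>v g\<bar>\<close>.
  Taking the supremum on the left cancels the multiples of \<open>S\<close>.\<close>

lemma generator_dissipative:
  assumes vk: "has_generator_value P v k" and \<epsilon>: "0 < \<epsilon>" and M: "\<And>g. \<bar>v g - \<epsilon> * k g\<bar> \<le> M"
  shows "\<bar>v g\<bar> \<le> M"
proof (rule field_le_epsilon)
  fix \<eta> :: real
  assume \<eta>: "0 < \<eta>"
  note C0 = generator_C0[OF vk]
  \<comment> \<open>The tolerance is chosen so that the remainder, after multiplication by
    \<open>\<epsilon> / s\<close>, is at most \<open>\<eta>\<close>.\<close>
  obtain d where d: "0 < d" "\<And>s g. 0 < s \<Longrightarrow> s < d \<Longrightarrow> \<bar>P s v g - v g - s * k g\<bar> \<le> \<eta> / \<epsilon> * s"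
    using generator_estimate[OF vk, of "\<eta> / \<epsilon>"] \<epsilon> \<eta> by (metis divide_pos_pos)
  define s where "s = d / 2"
  have s: "0 < s" "s < d"
    using d(1) by (auto simp: s_def)
  define S where "S = (SUP g. \<bar>v g\<bar>)"
  obtain M0 where "\<And>g. \<bar>v g\<bar> \<le> M0"
    using C0_bounded[OF C0(1)] by blast
  then have bdd: "bdd_above (range (\<lambda>g. \<bar>v g\<bar>))"
    by (auto simp: bdd_above_def)
  have S: "\<bar>v g\<bar> \<le> S" for g
    unfolding S_def by (rule cSUP_upper[OF _ bdd]) simp
  have "(1 + \<epsilon> / s) * \<bar>v g\<bar> \<le> M + \<epsilon> / s * S + \<eta>" for g
  proof -
    have "(1 + \<epsilon> / s) * v g = (v g - \<epsilon> * k g) + \<epsilon> / s * P s v g - \<epsilon> / s * (P s v g - v g - s * k g)"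
      using s by (simp add: field_simps)
    moreover have "\<bar>(1 + \<epsilon> / s) * v g\<bar> = (1 + \<epsilon> / s) * \<bar>v g\<bar>"
      using s \<epsilon> by (simp add: abs_mult)
    moreover have "\<bar>\<epsilon> / s * x\<bar> = \<epsilon> / s * \<bar>x\<bar>" for x
      using s \<epsilon> by (simp add: abs_mult)
    moreover have "\<bar>a + b - c\<bar> \<le> \<bar>a\<bar> + \<bar>b\<bar> + \<bar>c\<bar>" for a b c :: real
      by linarith
    ultimately have "(1 + \<epsilon> / s) * \<bar>v g\<bar> \<le> \<bar>v g - \<epsilon> * k g\<bar> + \<epsilon> / s * \<bar>P s v g\<bar> + \<epsilon> / s * \<bar>P s v g - v g - s * k g\<bar>"
      by metis
    also have "\<dots> \<le> M + \<epsilon> / s * S + \<epsilon> / s * (\<eta> / \<epsilon> * s)"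
      using s \<epsilon> by (intro add_mono mult_left_mono M d(2) P_bound[OF C0(1)] S) auto
    also have "\<dots> = M + \<epsilon> / s * S + \<eta>"
      using s \<epsilon> by simp
    finally show ?thesis .
  qed
  then have "\<bar>v g\<bar> \<le> (M + \<epsilon> / s * S + \<eta>) / (1 + \<epsilon> / s)" for g
    using s \<epsilon> by (simp add: pos_le_divide_eq add_pos_pos mult.commute)
  then have "S \<le> (M + \<epsilon> / s * S + \<eta>) / (1 + \<epsilon> / s)"
    unfolding S_def by (intro cSUP_least) auto
  then have "(1 + \<epsilon> / s) * S \<le> M + \<epsilon> / s * S + \<eta>"
    using s \<epsilon> by (simp add: pos_le_divide_eq add_pos_pos mult.commute)
  then have "S \<le> M + \<eta>"
    by (simp add: algebra_simps)
  then show "\<bar>v g\<bar> \<le> M + \<eta>"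
    using S[of g] by linarith
qed

text \<open>The consistency error of an implicit Euler step starting at time \<open>t\<close> is
  \<open>P t\<close> applied to the error at time 0; contractivity makes the bound uniform in
  \<open>t\<close>. One \<open>\<delta>\<close> accounts for the difference quotient of
  \<open>f\<close>, the other for the distance between \<open>P \<epsilon> h\<close> and
  \<open>h\<close>.\<close>

lemma backward_estimate:
  assumes fh: "has_generator_value P f h" and \<delta>: "0 < \<delta>"
  obtains d where "0 < d" "\<And>\<epsilon> (t::real) g. 0 < \<epsilon> \<Longrightarrow> \<epsilon> < d \<Longrightarrow> 0 \<le> t \<Longrightarrow>
    \<bar>P (t + \<epsilon>) f g - \<epsilon> * P (t + \<epsilon>) h g - P t f g\<bar> \<le> 2 * \<delta> * \<epsilon>"
proof -
  note C0 = generator_C0[OF fh]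
  obtain d1 where d1: "0 < d1" "\<And>\<epsilon> g. 0 < \<epsilon> \<Longrightarrow> \<epsilon> < d1 \<Longrightarrow> \<bar>P \<epsilon> f g - f g - \<epsilon> * h g\<bar> \<le> \<delta> * \<epsilon>"
    using generator_estimate[OF fh \<delta>] by blast
  obtain d2 where d2: "0 < d2" "\<And>\<epsilon> g. 0 < \<epsilon> \<Longrightarrow> \<epsilon> < d2 \<Longrightarrow> \<bar>P \<epsilon> h g - h g\<bar> \<le> \<delta>"
    using continuity_estimate[OF C0(2) \<delta>] by blast
  show ?thesis
  proof
    show "0 < min d1 d2"
      using d1 d2 by simp
    fix \<epsilon> t :: real and g
    assume \<epsilon>: "0 < \<epsilon>" "\<epsilon> < min d1 d2" and t: "0 \<le> t"
    define q where "q g = P \<epsilon> f g + (- \<epsilon>) * P \<epsilon> h g" for g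
    have q: "q \<in> C0_functions"
      using C0_linear_combination[OF P_C0[OF C0(1)] P_C0[OF C0(2)], of \<epsilon> \<epsilon> 1 "- \<epsilon>"] \<epsilon>
      by (simp add: q_def[abs_def])
    have "P t q g = P t (P \<epsilon> f) g - \<epsilon> * P t (P \<epsilon> h) g"
      using P_linear_combination[OF P_C0[OF C0(1), of \<epsilon>] t P_C0[OF C0(2), of \<epsilon>], of 1 "- \<epsilon>"] \<epsilon>
      by (simp add: q_def[abs_def])
    then have "P (t + \<epsilon>) f g - \<epsilon> * P (t + \<epsilon>) h g - P t f g = P t (\<lambda>g. q g - f g) g"
      using \<epsilon> by (simp add: P_diff[OF q C0(1) t] P_add[OF C0(1) t] P_add[OF C0(2) t])
    also have "\<bar>\<dots>\<bar> \<le> 2 * \<delta> * \<epsilon>"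
    proof (rule P_bound[OF C0_diff[OF q C0(1)] t])
      fix g
      have "q g - f g = (P \<epsilon> f g - f g - \<epsilon> * h g) - \<epsilon> * (P \<epsilon> h g - h g)"
        by (simp add: q_def algebra_simps)
      also have "\<bar>\<dots>\<bar> \<le> \<bar>P \<epsilon> f g - f g - \<epsilon> * h g\<bar> + \<bar>\<epsilon> * (P \<epsilon> h g - h g)\<bar>"
        by (rule abs_triangle_ineq4)
      also have "\<dots> \<le> \<delta> * \<epsilon> + \<epsilon> * \<delta>"
        using \<epsilon> d1(2)[of \<epsilon> g] d2(2)[of \<epsilon> g] by (intro add_mono) (auto simp: abs_mult)
      finally show "\<bar>q g - f g\<bar> \<le> 2 * \<delta> * \<epsilon>"
        by (simp add: algebra_simps)
    qed
    finally show "\<bar>P (t + \<epsilon>) f g - \<epsilon> * P (t + \<epsilon>) h g - P t f g\<bar> \<le> 2 * \<delta> * \<epsilon>" .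
  qed
qed

text \<open>Backward Euler steps: both sides solve the same evolution equation, whose generator is
  dissipative.\<close>

lemma P_translate:
  assumes f: "test_function f" and t: "0 \<le> t"
  shows "P t (\<lambda>y. f (gmul x y)) g = P t f (gmul x g)"
proof (cases "t = 0")
  case True
  then show ?thesis
    using test_function_C0[OF f] test_function_C0[OF test_function_translate[OF f]]
    by (simp add: P_zero)
next
  case False
  then have t: "0 < t"
    using t by simp
  define h where "h = horizontal_laplacian gmul e f"
  let ?f = "\<lambda>y. f (gmul x y)" and ?h = "\<lambda>y. h (gmul x y)"
  have gen: "has_generator_value P f h"
    unfolding h_def by (rule generator_test_function[OF f])
  then have gen': "has_generator_value P ?f ?h"
    by (rule generator_translate)
  define D where "D t g = P t ?f g - P t f (gmul x g)" for t g
  define K where "K t g = P t ?h g - P t h (gmul x g)" for t g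
  have DK: "has_generator_value P (D t) (K t)" if "0 \<le> t" for t
    unfolding D_def K_def
    by (intro generator_diff generator_translate generator_P gen gen' that)
  have "\<bar>D t g\<bar> \<le> \<eta>" if \<eta>: "0 < \<eta>" for \<eta>
  proof -
    \<comment> \<open>Each of the \<open>N\<close> steps of length \<open>t / N\<close> costs
      \<open>4 * \<delta> * \<epsilon>\<close>, half of it from each of the two solutions; the total
      \<open>4 * \<delta> * t\<close> is \<open>\<eta>\<close>.\<close>
    define \<delta> where "\<delta> = \<eta> / (4 * t)"
    have \<delta>: "0 < \<delta>"
      using \<eta> t by (simp add: \<delta>_def)
    obtain d1 where d1: "0 < d1" "\<And>\<epsilon> (t::real) g. 0 < \<epsilon> \<Longrightarrow> \<epsilon> < d1 \<Longrightarrow> 0 \<le> t \<Longrightarrow>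
        \<bar>P (t + \<epsilon>) f g - \<epsilon> * P (t + \<epsilon>) h g - P t f g\<bar> \<le> 2 * \<delta> * \<epsilon>"
      using backward_estimate[OF gen \<delta>] by blast
    obtain d2 where d2: "0 < d2" "\<And>\<epsilon> (t::real) g. 0 < \<epsilon> \<Longrightarrow> \<epsilon> < d2 \<Longrightarrow> 0 \<le> t \<Longrightarrow>
        \<bar>P (t + \<epsilon>) ?f g - \<epsilon> * P (t + \<epsilon>) ?h g - P t ?f g\<bar> \<le> 2 * \<delta> * \<epsilon>"
      using backward_estimate[OF gen' \<delta>] by blast
    obtain N :: nat where N: "t / min d1 d2 < real N"
      using reals_Archimedean2 by blast
    have N0: "0 < N"
      using N t d1(1) d2(1) by (intro gr0I) (auto simp: divide_less_0_iff min_def split: if_splits)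
    define \<epsilon> where "\<epsilon> = t / real N"
    have "t < real N * min d1 d2"
      using N d1(1) d2(1) by (simp add: pos_divide_less_eq)
    then have \<epsilon>: "0 < \<epsilon>" "\<epsilon> < min d1 d2"
      using N0 t by (simp_all add: \<epsilon>_def pos_divide_less_eq mult.commute del: min_less_iff_conj)
    then have \<epsilon>: "0 < \<epsilon>" "\<epsilon> < d1" "\<epsilon> < d2"
      by auto
    have "\<bar>D (real n * \<epsilon>) g\<bar> \<le> 4 * \<delta> * \<epsilon> * real n" for n g
    proof (induction n arbitrary: g)
      case 0
      show ?case
        using P_zero[OF generator_C0(1)[OF gen]] P_zero[OF generator_C0(1)[OF gen']] by (simp add: D_def)
    next
      case (Suc n)
      let ?t = "real n * \<epsilon>"
      have t': "0 \<le> ?t" "0 \<le> ?t + \<epsilon>"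
        using \<epsilon> by auto
      \<comment> \<open>Up to the two consistency errors, \<open>D - \<epsilon> K\<close> at the new
        time is \<open>D\<close> at the old time. Dissipativity passes from this combination to
        \<open>D\<close> itself without loss, so errors only add up.\<close>
      have "\<bar>D (?t + \<epsilon>) g\<bar> \<le> 4 * \<delta> * \<epsilon> * real n + 4 * \<delta> * \<epsilon>" for g
      proof (rule generator_dissipative[OF DK[OF t'(2)] \<epsilon>(1)])
        fix g
        show "\<bar>D (?t + \<epsilon>) g - \<epsilon> * K (?t + \<epsilon>) g\<bar> \<le> 4 * \<delta> * \<epsilon> * real n + 4 * \<delta> * \<epsilon>"
          using d1(2)[OF \<epsilon>(1,2) t'(1), of "gmul x g"] d2(2)[OF \<epsilon>(1,3) t'(1), of g] Suc[of g]
          unfolding D_def K_def right_diff_distrib by linarith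
      qed
      then show ?case
        by (simp add: algebra_simps)
    qed
    from this[of N g] show ?thesis
      using N0 t by (simp add: \<epsilon>_def \<delta>_def)
  qed
  then have "\<bar>D t g\<bar> \<le> 0"
    by (rule field_le_epsilon[of _ 0, simplified])
  then show ?thesis
    by (simp add: D_def)
qed

end

section \<open>The horizontal marginal of the heat kernel\<close>

context carnot_heat
begin

section \<open>The kernel as a sub-probability density\<close>

lemma
  assumes "0 < t"
  shows hk_pos: "0 < hk x y t" and hk_sym: "hk x y t = hk y x t"
    and has_bochner_integral_hk:
      "f \<in> C0_functions \<Longrightarrow> has_bochner_integral lborel (\<lambda>y. hk x y t * f y) (P t f x)"
proof -
  note hk = heat_kernel[unfolded heat_kernel_def]
  show "0 < hk x y t"
    using hk[THEN conjunct1] assms by blast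
  show "hk x y t = hk y x t"
    using hk[THEN conjunct2, THEN conjunct2, THEN conjunct1] assms by blast
  show "has_bochner_integral lborel (\<lambda>y. hk x y t * f y) (P t f x)" if "f \<in> C0_functions"
    using hk[THEN conjunct2, THEN conjunct2, THEN conjunct2] assms that by blast
qed

lemma hk_nonneg: "0 < t \<Longrightarrow> 0 \<le> hk x y t"
  using hk_pos less_imp_le by blast

lemma continuous_on_hk [continuous_intros]:
  assumes "0 < t" "continuous_on S f" "continuous_on S g"
  shows "continuous_on S (\<lambda>x. hk (f x) (g x) t)"
proof -
  have "C_k_on 0 (UNIV \<times> UNIV \<times> {0<..}) (\<lambda>(g, g', t). hk g g' t)"
    using heat_kernel by (simp only: heat_kernel_def smooth_on_def)
  then have "continuous_on (UNIV \<times> UNIV \<times> {0<..}) (\<lambda>(g, g', t). hk g g' t)"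
    by simp
  moreover have "continuous_on S (\<lambda>x. (f x, g x, t))"
    by (intro continuous_on_Pair continuous_on_const assms)
  ultimately have "continuous_on S (\<lambda>x. (\<lambda>(g, g', t). hk g g' t) (f x, g x, t))"
    by (rule continuous_on_compose2) (use assms(1) in auto)
  then show ?thesis
    by simp
qed

lemma borel_measurable_hk [measurable]:
  "0 < t \<Longrightarrow> (\<lambda>y. hk x y t) \<in> borel_measurable borel"
  "0 < t \<Longrightarrow> (\<lambda>y. hk y x t) \<in> borel_measurable borel"
  by (auto intro!: borel_measurable_continuous_onI continuous_intros)

lemma integral_hk: "0 < t \<Longrightarrow> f \<in> C0_functions \<Longrightarrow> (LINT y|lborel. hk x y t * f y) = P t f x"
  using has_bochner_integral_hk has_bochner_integral_integral_eq by blast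

text \<open>Monotone convergence along the cut-offs, each of which the contraction
  \<open>P t\<close> maps to a function bounded by 1. That no mass is lost is seen only in
  \<open>real_distribution_law\<close>.\<close>

lemma nn_integral_hk_le_1:
  assumes t: "0 < t"
  shows "(\<integral>\<^sup>+y. ennreal (hk x y t) \<partial>lborel) \<le> 1"
proof -
  have meas: "(\<lambda>y. ennreal (hk x y t * bump n y)) \<in> borel_measurable lborel" for n
    using borel_measurable_times[OF borel_measurable_hk(1)[OF t, of x]
      borel_measurable_continuous_onI[OF test_function_continuous[OF test_function_bump[of n]]]]
    by simp
  have inc: "incseq (\<lambda>n y. ennreal (hk x y t * bump n y))"
    by (auto simp: incseq_def le_fun_def hk_nonneg[OF t] intro!: ennreal_leI mult_left_mono bump_mono)
  have "(SUP n. ennreal (hk x y t * bump n y)) = ennreal (hk x y t)" for y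
  proof (rule LIMSEQ_unique[OF LIMSEQ_SUP])
    show "incseq (\<lambda>n. ennreal (hk x y t * bump n y))"
      using inc by (auto simp: incseq_def le_fun_def)
    show "(\<lambda>n. ennreal (hk x y t * bump n y)) \<longlonglongrightarrow> ennreal (hk x y t)"
      using tendsto_ennrealI[OF tendsto_mult_left[OF tendsto_bump, of "hk x y t" y]] by simp
  qed
  then have "(\<integral>\<^sup>+y. ennreal (hk x y t) \<partial>lborel) = (SUP n. \<integral>\<^sup>+y. ennreal (hk x y t * bump n y) \<partial>lborel)"
    using nn_integral_monotone_convergence_SUP[OF inc meas] by simp
  also have "\<dots> \<le> 1"
  proof (rule SUP_least)
    fix n
    have C0: "bump n \<in> C0_functions"
      by (rule test_function_C0[OF test_function_bump])
    have "(\<integral>\<^sup>+y. ennreal (hk x y t * bump n y) \<partial>lborel) = ennreal (P t (bump n) x)"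
      using has_bochner_integral_hk[OF t C0, of x]
      by (subst nn_integral_eq_integral)
         (auto simp: has_bochner_integral_iff hk_nonneg[OF t] bump_nonneg)
    also have "\<bar>P t (bump n) x\<bar> \<le> 1"
      using t by (intro P_bound[OF C0]) (auto simp: bump_nonneg bump_le_1)
    then have "ennreal (P t (bump n) x) \<le> 1"
      by (simp add: ennreal_le_1)
    finally show "(\<integral>\<^sup>+y. ennreal (hk x y t * bump n y) \<partial>lborel) \<le> 1" .
  qed
  finally show ?thesis .
qed

lemma integrable_hk:
  assumes t: "0 < t"
  shows "integrable lborel (\<lambda>y. hk x y t)"
proof (rule integrableI_nonneg)
  show "(\<integral>\<^sup>+y. ennreal (hk x y t) \<partial>lborel) < \<infinity>"
    using nn_integral_hk_le_1[OF t, of x] by (auto simp: less_top[symmetric] top_unique)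
qed (use t in \<open>auto simp: hk_nonneg\<close>)

lemma integral_hk_le_1:
  assumes t: "0 < t"
  shows "(LINT y|lborel. hk x y t) \<le> 1"
  using nn_integral_hk_le_1[OF t, of x] integrable_hk[OF t, of x] hk_nonneg[OF t]
  by (simp add: nn_integral_eq_integral ennreal_le_1)

lemma integrable_hk_mult:
  fixes f :: "'a \<Rightarrow> real"
  assumes t: "0 < t" and f: "f \<in> borel_measurable borel" "\<And>y. \<bar>f y\<bar> \<le> 1"
  shows "integrable lborel (\<lambda>y. hk x y t * f y)"
proof (rule Bochner_Integration.integrable_bound[OF integrable_hk[OF t, of x]])
  show "AE y in lborel. norm (hk x y t * f y) \<le> norm (hk x y t)"
    using f(2) mult_left_le[of "\<bar>f _\<bar>" "\<bar>hk x _ t\<bar>"] by (auto simp: abs_mult)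
qed (use t f in measurable)

lemma hk_dominated_convergence:
  fixes f :: "'a \<Rightarrow> real"
  assumes t: "0 < t" and meas: "\<And>n. F n \<in> borel_measurable borel" "f \<in> borel_measurable borel"
    and bound: "\<And>n y. \<bar>F n y\<bar> \<le> 1" and lim: "\<And>y. (\<lambda>n. F n y) \<longlonglongrightarrow> f y"
  shows "(\<lambda>n. LINT y|lborel. hk x y t * F n y) \<longlonglongrightarrow> (LINT y|lborel. hk x y t * f y)"
proof (rule integral_dominated_convergence[OF _ _ integrable_hk[OF t, of x]])
  show "AE y in lborel. norm (hk x y t * F n y) \<le> hk x y t" for n
    using mult_left_le[OF bound hk_nonneg[OF t]] hk_nonneg[OF t] by (auto simp: abs_mult)
  show "AE y in lborel. (\<lambda>n. hk x y t * F n y) \<longlonglongrightarrow> hk x y t * f y"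
    by (intro AE_I2 tendsto_mult_left lim)
qed (use t meas in measurable)

lemma smooth_on_measurable: "smooth_on UNIV f \<Longrightarrow> f \<in> borel_measurable borel"
  unfolding smooth_on_def by (metis C_k_on.simps(1) borel_measurable_continuous_onI)

lemma abs_mult_bump_le: "\<bar>a\<bar> \<le> 1 \<Longrightarrow> \<bar>a * bump n y\<bar> \<le> 1"
  by (simp add: abs_mult mult_le_one bump_nonneg bump_le_1)

text \<open>Sine and cosine do not vanish at infinity, so the semigroup cannot be applied to them
  directly; their integrals against the kernel are reached through cut-offs.\<close>

lemma tendsto_P_mult_bump:
  fixes f :: "'a \<Rightarrow> real"
  assumes t: "0 < t" and f: "smooth_on UNIV f" "\<And>y. \<bar>f y\<bar> \<le> 1"
  shows "(\<lambda>n. P t (\<lambda>y. f y * bump n y) x) \<longlonglongrightarrow> (LINT y|lborel. hk x y t * f y)"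
proof -
  have "(\<lambda>n. LINT y|lborel. hk x y t * (f y * bump n y)) \<longlonglongrightarrow> (LINT y|lborel. hk x y t * f y)"
    using smooth_on_measurable[OF f(1)] smooth_on_measurable[OF smooth_on_bump] tendsto_mult_left[OF tendsto_bump]
    by (intro hk_dominated_convergence[OF t] borel_measurable_times abs_mult_bump_le f)
       (auto intro: tendsto_eq_intros tendsto_bump)
  then show ?thesis
    using test_function_C0[OF test_function_mult_bump[OF f(1)]] by (simp add: integral_hk[OF t])
qed

text \<open>Both sides are limits of integrals of cut-off functions, to which
  \<open>P_translate\<close> applies; on the right the cut-off is translated together with
  \<open>f\<close>.\<close>

lemma integral_hk_translate:
  fixes f :: "'a \<Rightarrow> real"
  assumes t: "0 < t" and f: "smooth_on UNIV f" "\<And>y. \<bar>f y\<bar> \<le> 1"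
  shows "(LINT y|lborel. hk x y t * f y) = (LINT y|lborel. hk 0 y t * f (gmul x y))"
proof (rule LIMSEQ_unique[OF tendsto_P_mult_bump[OF t f]])
  have meas: "gmul x \<in> borel \<rightarrow>\<^sub>M borel"
    by (rule smooth_on_measurable[OF smooth_on_gmul])
  have "(\<lambda>n. LINT y|lborel. hk 0 y t * (f (gmul x y) * bump n (gmul x y)))
      \<longlonglongrightarrow> (LINT y|lborel. hk 0 y t * f (gmul x y))"
    by (intro hk_dominated_convergence[OF t] borel_measurable_times abs_mult_bump_le f
         measurable_compose[OF meas] smooth_on_measurable smooth_on_bump)
       (auto intro: tendsto_eq_intros tendsto_bump)
  moreover have "(LINT y|lborel. hk 0 y t * (f (gmul x y) * bump n (gmul x y))) = P t (\<lambda>y. f y * bump n y) x" for n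
  proof -
    let ?f = "\<lambda>y. f y * bump n y"
    have test: "test_function ?f"
      by (rule test_function_mult_bump[OF f(1)])
    have "(LINT y|lborel. hk 0 y t * ?f (gmul x y)) = P t (\<lambda>y. ?f (gmul x y)) 0"
      by (rule integral_hk[OF t test_function_C0[OF test_function_translate[OF test]]])
    also have "\<dots> = P t ?f x"
      using P_translate[OF test, of t x 0] t by simp
    finally show ?thesis .
  qed
  ultimately show "(\<lambda>n. P t (\<lambda>y. f y * bump n y) x) \<longlonglongrightarrow> (LINT y|lborel. hk 0 y t * f (gmul x y))"
    by simp
qed

text \<open>The semigroup law holds for the cut-off functions; removing the cut-off takes one
  passage to the limit in the inner integral and another in the outer one.\<close>

lemma integral_hk_add:
  fixes f :: "'a \<Rightarrow> real"
  assumes s: "0 < s" and t: "0 < t" and f: "smooth_on UNIV f" "\<And>y. \<bar>f y\<bar> \<le> 1"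
  shows "(LINT y|lborel. hk x y (s + t) * f y) = (LINT y|lborel. hk x y s * (LINT z|lborel. hk y z t * f z))"
proof (rule LIMSEQ_unique[OF tendsto_P_mult_bump[OF add_pos_pos[OF s t] f]])
  let ?f = "\<lambda>n y. f y * bump n y"
  have C0: "?f n \<in> C0_functions" for n
    by (rule test_function_C0[OF test_function_mult_bump[OF f(1)]])
  have lim: "(\<lambda>n. P t (?f n) y) \<longlonglongrightarrow> (LINT z|lborel. hk y z t * f z)" for y
    by (rule tendsto_P_mult_bump[OF t f])
  have meas: "P t (?f n) \<in> borel_measurable borel" for n
    using P_C0[OF C0 less_imp_le[OF t]] by (intro borel_measurable_continuous_onI C0_continuous)
  have "(\<lambda>n. LINT y|lborel. hk x y s * P t (?f n) y) \<longlonglongrightarrow> (LINT y|lborel. hk x y s * (LINT z|lborel. hk y z t * f z))"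
  proof (rule hk_dominated_convergence[OF s meas _ _ lim])
    show "(\<lambda>y. LINT z|lborel. hk y z t * f z) \<in> borel_measurable borel"
      by (rule borel_measurable_LIMSEQ_real[OF lim meas])
    show "\<bar>P t (?f n) y\<bar> \<le> 1" for n y
      using t by (intro P_bound[OF C0] abs_mult_bump_le f) simp
  qed
  then show "(\<lambda>n. P (s + t) (?f n) x) \<longlonglongrightarrow> (LINT y|lborel. hk x y s * (LINT z|lborel. hk y z t * f z))"
    using s t by (simp add: P_add[OF C0] integral_hk[OF s P_C0[OF C0]])
qed

text \<open>At the identity, the iterated derivative along \<open>e i\<close> sees only the line
  through \<open>e i\<close>, on which the product is addition. The Laplacian there is a sum of
  ordinary second derivatives.\<close>

lemma horizontal_laplacian_at_0:
  assumes F: "\<And>i s. f (s *\<^sub>R e i) = F i s"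
    and F': "\<And>i s. (F i has_real_derivative F' i s) (at s)"
    and F'': "\<And>i. (F' i has_real_derivative F'' i) (at 0)"
  shows "horizontal_laplacian gmul e f 0 = (\<Sum>i\<in>UNIV. F'' i)"
proof -
  have 1: "left_field gmul (e i) f (s *\<^sub>R e i) = F' i s" for i s
  proof -
    have "((\<lambda>t. F i (s + t)) has_vector_derivative F' i s) (at 0)"
      using F'[of i s] DERIV_shift[of "F i" "F' i s" 0 s]
      by (simp add: has_real_derivative_iff_has_vector_derivative add.commute)
    then show ?thesis
      by (simp add: left_field_def one_parameter F vector_derivative_at)
  qed
  have "left_field gmul (e i) (left_field gmul (e i) f) 0 = F'' i" for i
  proof -
    have "((\<lambda>t. F' i t) has_vector_derivative F'' i) (at 0)"
      using F'' by (simp add: has_real_derivative_iff_has_vector_derivative)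
    then show ?thesis
      by (subst left_field_def) (simp add: 1 vector_derivative_at)
  qed
  then show ?thesis
    by (simp add: horizontal_laplacian_def)
qed

end

locale carnot_heat_direction = carnot_heat gmul V r e P hk
  for gmul :: "'a::euclidean_space \<Rightarrow> 'a \<Rightarrow> 'a" and V r and e :: "'m::finite \<Rightarrow> 'a" and P hk +
  fixes \<nu> :: "real ^ 'm"
  assumes norm_dir_coord: "norm \<nu> = 1"
begin

section \<open>A direction of the first layer and the Fourier transform along it\<close>

definition dir :: 'a where
  "dir = (\<Sum>i\<in>UNIV. \<nu> $ i *\<^sub>R e i)"

lemma inner_dir: "\<nu> \<bullet> horizontal_coord e g = g \<bullet> dir"
  by (simp add: dir_def horizontal_coord_def inner_vec_def inner_sum_right)

lemma dir_V1: "dir \<in> V 1"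
  unfolding dir_def span_basis[symmetric] by (intro span_sum span_scale span_base) auto

lemma e_inner_dir: "e i \<bullet> dir = \<nu> $ i"
  by (simp add: dir_def inner_sum_right orthonormal_basis if_distrib cong: if_cong)

lemma sum_dir_coord: "(\<Sum>i\<in>UNIV. (\<nu> $ i)\<^sup>2) = 1"
  using norm_dir_coord by (simp add: norm_eq_1 inner_vec_def power2_eq_square)

lemma dir_inner_dir: "dir \<bullet> dir = 1"
  by (subst (1) dir_def)
     (simp add: inner_sum_left e_inner_dir sum_dir_coord flip: power2_eq_square)

lemma gmul_inner_dir: "gmul x y \<bullet> dir = x \<bullet> dir + y \<bullet> dir"
  by (rule gmul_inner_V1[OF dir_V1])

text \<open>Real and imaginary parts of the transform are kept apart because the semigroup acts on
  real functions; \<open>fourier\<close> joins them.\<close>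

definition fcos :: "real \<Rightarrow> real \<Rightarrow> real" where
  "fcos \<theta> t = (LINT y|lborel. hk 0 y t * cos (\<theta> * (y \<bullet> dir)))"

definition fsin :: "real \<Rightarrow> real \<Rightarrow> real" where
  "fsin \<theta> t = (LINT y|lborel. hk 0 y t * sin (\<theta> * (y \<bullet> dir)))"

lemma integrable_trig:
  assumes "0 < t"
  shows "integrable lborel (\<lambda>y. hk x y t * cos (\<theta> * (y \<bullet> dir)))"
    and "integrable lborel (\<lambda>y. hk x y t * sin (\<theta> * (y \<bullet> dir)))"
  by (rule integrable_hk_mult[OF assms]; simp)+

text \<open>Starting from \<open>x\<close> instead of the identity shifts the coordinate by
  \<open>x \<bullet> dir\<close>, since this coordinate is additive; the addition formulas rotate
  the transform by the corresponding phase.\<close>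

lemma integral_hk_trig:
  assumes t: "0 < t"
  shows "(LINT y|lborel. hk x y t * cos (\<theta> * (y \<bullet> dir))) =
      cos (\<theta> * (x \<bullet> dir)) * fcos \<theta> t - sin (\<theta> * (x \<bullet> dir)) * fsin \<theta> t"
    and "(LINT y|lborel. hk x y t * sin (\<theta> * (y \<bullet> dir))) =
      sin (\<theta> * (x \<bullet> dir)) * fcos \<theta> t + cos (\<theta> * (x \<bullet> dir)) * fsin \<theta> t"
proof -
  note int = integrable_trig[OF t, of 0 \<theta>]
  have "(LINT y|lborel. hk x y t * cos (\<theta> * (y \<bullet> dir))) =
      (LINT y|lborel. hk 0 y t * cos (\<theta> * (gmul x y \<bullet> dir)))"
    by (rule integral_hk_translate[OF t smooth_on_cos_inner]) simp
  also have "\<dots> = (LINT y|lborel. cos (\<theta> * (x \<bullet> dir)) * (hk 0 y t * cos (\<theta> * (y \<bullet> dir)))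
      - sin (\<theta> * (x \<bullet> dir)) * (hk 0 y t * sin (\<theta> * (y \<bullet> dir))))"
    by (simp add: gmul_inner_dir distrib_left cos_add algebra_simps)
  also have "\<dots> = cos (\<theta> * (x \<bullet> dir)) * fcos \<theta> t - sin (\<theta> * (x \<bullet> dir)) * fsin \<theta> t"
    using int by (simp add: fcos_def fsin_def)
  finally show "(LINT y|lborel. hk x y t * cos (\<theta> * (y \<bullet> dir))) =
      cos (\<theta> * (x \<bullet> dir)) * fcos \<theta> t - sin (\<theta> * (x \<bullet> dir)) * fsin \<theta> t" .
  have "(LINT y|lborel. hk x y t * sin (\<theta> * (y \<bullet> dir))) =
      (LINT y|lborel. hk 0 y t * sin (\<theta> * (gmul x y \<bullet> dir)))"
    by (rule integral_hk_translate[OF t smooth_on_sin_inner]) simp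
  also have "\<dots> = (LINT y|lborel. sin (\<theta> * (x \<bullet> dir)) * (hk 0 y t * cos (\<theta> * (y \<bullet> dir)))
      + cos (\<theta> * (x \<bullet> dir)) * (hk 0 y t * sin (\<theta> * (y \<bullet> dir))))"
    by (simp add: gmul_inner_dir distrib_left sin_add algebra_simps)
  also have "\<dots> = sin (\<theta> * (x \<bullet> dir)) * fcos \<theta> t + cos (\<theta> * (x \<bullet> dir)) * fsin \<theta> t"
    using int by (simp add: fcos_def fsin_def)
  finally show "(LINT y|lborel. hk x y t * sin (\<theta> * (y \<bullet> dir))) =
      sin (\<theta> * (x \<bullet> dir)) * fcos \<theta> t + cos (\<theta> * (x \<bullet> dir)) * fsin \<theta> t" .
qed

lemma fcos_add:
  assumes s: "0 < s" and t: "0 < t"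
  shows "fcos \<theta> (s + t) = fcos \<theta> s * fcos \<theta> t - fsin \<theta> s * fsin \<theta> t"
proof -
  note int = integrable_trig[OF s, of 0 \<theta>]
  have "fcos \<theta> (s + t) = (LINT y|lborel. hk 0 y s * (LINT z|lborel. hk y z t * cos (\<theta> * (z \<bullet> dir))))"
    unfolding fcos_def by (rule integral_hk_add[OF s t smooth_on_cos_inner]) simp
  also have "\<dots> = (LINT y|lborel. (hk 0 y s * cos (\<theta> * (y \<bullet> dir))) * fcos \<theta> t
      - (hk 0 y s * sin (\<theta> * (y \<bullet> dir))) * fsin \<theta> t)"
    by (simp add: integral_hk_trig[OF t] algebra_simps)
  also have "\<dots> = fcos \<theta> s * fcos \<theta> t - fsin \<theta> s * fsin \<theta> t"
    using int by (simp add: fcos_def fsin_def)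
  finally show ?thesis .
qed

lemma fsin_add:
  assumes s: "0 < s" and t: "0 < t"
  shows "fsin \<theta> (s + t) = fsin \<theta> s * fcos \<theta> t + fcos \<theta> s * fsin \<theta> t"
proof -
  note int = integrable_trig[OF s, of 0 \<theta>]
  have "fsin \<theta> (s + t) = (LINT y|lborel. hk 0 y s * (LINT z|lborel. hk y z t * sin (\<theta> * (z \<bullet> dir))))"
    unfolding fsin_def by (rule integral_hk_add[OF s t smooth_on_sin_inner]) simp
  also have "\<dots> = (LINT y|lborel. (hk 0 y s * sin (\<theta> * (y \<bullet> dir))) * fcos \<theta> t
      + (hk 0 y s * cos (\<theta> * (y \<bullet> dir))) * fsin \<theta> t)"
    by (simp add: integral_hk_trig[OF t] algebra_simps)
  also have "\<dots> = fsin \<theta> s * fcos \<theta> t + fcos \<theta> s * fsin \<theta> t"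
    using int by (simp add: fcos_def fsin_def)
  finally show ?thesis .
qed

definition fourier :: "real \<Rightarrow> real \<Rightarrow> complex" where
  "fourier \<theta> t = Complex (fcos \<theta> t) (fsin \<theta> t)"

lemma fourier_add: "0 < s \<Longrightarrow> 0 < t \<Longrightarrow> fourier \<theta> (s + t) = fourier \<theta> s * fourier \<theta> t"
  by (simp add: fourier_def complex_eq_iff fcos_add fsin_add)

lemma fourier_of_nat:
  assumes "0 < t"
  shows "fourier \<theta> (real (Suc n) * t) = fourier \<theta> t ^ Suc n"
proof (induction n)
  case (Suc n)
  have "fourier \<theta> (real (Suc n) * t + t) = fourier \<theta> (real (Suc n) * t) * fourier \<theta> t"
    by (rule fourier_add) (use assms in simp_all)
  also have "real (Suc n) * t + t = real (Suc (Suc n)) * t"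
    by (simp add: algebra_simps)
  finally show ?case
    by (simp only: Suc power_Suc2)
qed simp

lemma fourier_eq_integral:
  assumes t: "0 < t"
  shows "integrable lborel (\<lambda>y. hk 0 y t *\<^sub>R iexp (\<theta> * (y \<bullet> dir)))"
    and "fourier \<theta> t = (CLINT y|lborel. hk 0 y t *\<^sub>R iexp (\<theta> * (y \<bullet> dir)))"
proof -
  have eq: "hk 0 y t *\<^sub>R iexp (\<theta> * (y \<bullet> dir)) =
      complex_of_real (hk 0 y t * cos (\<theta> * (y \<bullet> dir))) + \<i> * complex_of_real (hk 0 y t * sin (\<theta> * (y \<bullet> dir)))" for y
    by (simp add: complex_eq_iff Re_exp Im_exp)
  note int = integrable_trig[OF t, of 0 \<theta>]
  show "integrable lborel (\<lambda>y. hk 0 y t *\<^sub>R iexp (\<theta> * (y \<bullet> dir)))"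
    unfolding eq by (intro Bochner_Integration.integrable_add integrable_mult_right integrable_of_real int)
  have "(CLINT y|lborel. hk 0 y t *\<^sub>R iexp (\<theta> * (y \<bullet> dir))) =
      complex_of_real (fcos \<theta> t) + \<i> * complex_of_real (fsin \<theta> t)"
    unfolding eq fcos_def fsin_def
    by (subst Bochner_Integration.integral_add)
       (intro integrable_mult_right integrable_of_real int | simp only: integral_mult_right_zero integral_complex_of_real)+
  then show "fourier \<theta> t = (CLINT y|lborel. hk 0 y t *\<^sub>R iexp (\<theta> * (y \<bullet> dir)))"
    by (simp add: fourier_def complex_eq_iff)
qed

lemma norm_fourier_le_1:
  assumes t: "0 < t"
  shows "norm (fourier \<theta> t) \<le> 1"
proof -
  have "norm (fourier \<theta> t) \<le> (LINT y|lborel. norm (hk 0 y t *\<^sub>R iexp (\<theta> * (y \<bullet> dir))))"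
    unfolding fourier_eq_integral(2)[OF t] by (rule integral_norm_bound)
  also have "\<dots> = (LINT y|lborel. hk 0 y t)"
    by (simp add: abs_of_nonneg[OF hk_nonneg[OF t]])
  also have "\<dots> \<le> 1"
    by (rule integral_hk_le_1[OF t])
  finally show ?thesis .
qed

section \<open>The Fourier transform for small times\<close>

lemma bump_on_axis: "bump 0 (s *\<^sub>R e i) = exp 1 * flat 0 (1 - s ^ 4)"
  by (simp add: bump_def orthonormal_basis power2_eq_square power4_eq_xxxx mult.assoc)

lemma DERIV_bump_on_axis:
  "((\<lambda>s. exp 1 * flat 0 (1 - s ^ 4)) has_real_derivative - 4 * exp 1 * s ^ 3 * flat 2 (1 - s ^ 4)) (at s)"
  by (rule derivative_eq_intros DERIV_chain2[OF has_real_derivative_flat] refl)+ (simp add: mult_ac numeral_2_eq_2)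

text \<open>On each axis the first two derivatives of the cut-off vanish at 0, so only the second
  derivative of \<open>f\<close> survives, with the factor
  \<open>(\<theta> * \<nu> $ i)\<^sup>2\<close>. The squares of the coordinates of \<nu> sum to
  1.\<close>

lemma laplacian_trig_bump:
  fixes f f' :: "real \<Rightarrow> real"
  assumes f: "\<And>x. (f has_real_derivative f' x) (at x)" and f': "(f' has_real_derivative c) (at 0)"
  shows "horizontal_laplacian gmul e (\<lambda>x. f (\<theta> * (x \<bullet> dir)) * bump 0 x) 0 = c * \<theta>\<^sup>2"
proof -
  let ?b = "\<lambda>s. exp 1 * flat 0 (1 - s ^ 4)" and ?b' = "\<lambda>s. - 4 * exp 1 * s ^ 3 * flat 2 (1 - s ^ 4)"
  have "horizontal_laplacian gmul e (\<lambda>x. f (\<theta> * (x \<bullet> dir)) * bump 0 x) 0 =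
      (\<Sum>i\<in>UNIV. c * (\<theta> * \<nu> $ i)\<^sup>2)"
  proof (rule horizontal_laplacian_at_0)
    fix i s
    let ?k = "\<theta> * \<nu> $ i"
    show "f (\<theta> * ((s *\<^sub>R e i) \<bullet> dir)) * bump 0 (s *\<^sub>R e i) = f (s * ?k) * ?b s"
      by (simp add: bump_on_axis e_inner_dir mult_ac)
    show "((\<lambda>s. f (s * ?k) * ?b s) has_real_derivative f' (s * ?k) * ?k * ?b s + ?b' s * f (s * ?k)) (at s)"
      by (rule DERIV_mult[OF DERIV_chain2[OF f] DERIV_bump_on_axis]) (auto intro!: derivative_eq_intros)
    have 1: "((\<lambda>s. f' (s * ?k) * ?k * ?b s) has_real_derivative c * ?k * ?k * ?b 0 + ?b' 0 * (f' (0 * ?k) * ?k)) (at 0)"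
      using f' by (intro DERIV_mult[OF DERIV_cmult_right[OF DERIV_chain2[of f']] DERIV_bump_on_axis])
        (auto intro!: derivative_eq_intros)
    have 2: "((\<lambda>s. ?b' s * f (s * ?k)) has_real_derivative 0) (at 0)"
      by (rule derivative_eq_intros DERIV_chain2[OF has_real_derivative_flat] DERIV_chain2[OF f] refl)+ simp
    show "((\<lambda>s. f' (s * ?k) * ?k * ?b s + ?b' s * f (s * ?k)) has_real_derivative c * ?k\<^sup>2) (at 0)"
      using DERIV_add[OF 1 2] by (simp add: flat_0_one power2_eq_square mult.assoc)
  qed
  also have "\<dots> = c * \<theta>\<^sup>2 * (\<Sum>i\<in>UNIV. (\<nu> $ i)\<^sup>2)"
    by (simp add: sum_distrib_left power_mult_distrib mult_ac)
  finally show ?thesis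
    by (simp add: sum_dir_coord)
qed

lemma generator_at_0:
  assumes "has_generator_value P f h"
  shows "((\<lambda>t. (P t f 0 - f 0) / t) \<longlongrightarrow> h 0) (at_right 0)"
  using assms unfolding has_generator_value_def by (intro tendsto_uniform_limitI[where S = UNIV]) auto

text \<open>By contractivity the heat kernel puts only mass \<open>o(t)\<close> outside any neighbourhood of the origin, so the
  first order behaviour of the Fourier transform is read off compactly supported functions.\<close>

lemma trig_derivative:
  fixes f f' :: "real \<Rightarrow> real"
  assumes f: "\<And>x. (f has_real_derivative f' x) (at x)" "(f' has_real_derivative c) (at 0)"
    and smooth: "smooth_on UNIV (\<lambda>x. f (\<theta> * (x \<bullet> dir)))" and bound: "\<And>x. \<bar>f x\<bar> \<le> 1"
  shows "((\<lambda>t. ((LINT y|lborel. hk 0 y t * f (\<theta> * (y \<bullet> dir))) - f 0) / t) \<longlongrightarrow> c * \<theta>\<^sup>2) (at_right 0)"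
proof -
  let ?f = "\<lambda>x. f (\<theta> * (x \<bullet> dir))"
  let ?g = "\<lambda>x. ?f x * bump 0 x"
  have b0: "bump 0 (0::'a) = 1"
    by (simp add: bump_def flat_0_one)
  have test: "test_function ?g"
    by (rule test_function_mult_bump[OF smooth])
  have g: "((\<lambda>t. (P t ?g 0 - f 0) / t) \<longlongrightarrow> c * \<theta>\<^sup>2) (at_right 0)"
    using generator_at_0[OF generator_test_function[OF test]] by (simp add: b0 laplacian_trig_bump[OF f])
  have one: "((\<lambda>x. 1) has_real_derivative 0) (at x)" "((\<lambda>x. 0) has_real_derivative 0) (at x)" for x :: real
    by auto
  \<comment> \<open>The constant function 1 in the place of \<open>f\<close>: the mass seen by the
    cut-off differs from 1 by \<open>o(t)\<close>.\<close>
  have "((\<lambda>t. (P t (bump 0) 0 - 1) / t) \<longlongrightarrow> 0) (at_right 0)"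
    using generator_at_0[OF generator_test_function[OF test_function_bump[of 0]]]
      laplacian_trig_bump[OF one] by (simp add: b0)
  from tendsto_minus[OF this] have u: "((\<lambda>t. (1 - P t (bump 0) 0) / t) \<longlongrightarrow> 0) (at_right 0)"
    by (simp add: minus_divide_left)
  have "\<forall>\<^sub>F t in at_right 0. norm (((LINT y|lborel. hk 0 y t * ?f y) - f 0) / t - (P t ?g 0 - f 0) / t)
      \<le> (1 - P t (bump 0) 0) / t"
  proof -
    have "norm (((LINT y|lborel. hk 0 y t * ?f y) - f 0) / t - (P t ?g 0 - f 0) / t)
      \<le> (1 - P t (bump 0) 0) / t" if t: "0 < t" for t
    proof -
      have meas: "?f \<in> borel_measurable borel" "(bump 0 :: 'a \<Rightarrow> real) \<in> borel_measurable borel"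
        by (rule smooth_on_measurable[OF smooth] smooth_on_measurable[OF smooth_on_bump])+
      have bump1: "\<bar>bump 0 y\<bar> \<le> 1" for y :: 'a
        by (simp add: bump_nonneg bump_le_1)
      have int: "integrable lborel (\<lambda>y. hk 0 y t * ?f y)" "integrable lborel (\<lambda>y. hk 0 y t * ?g y)"
          "integrable lborel (\<lambda>y. hk 0 y t * bump 0 y)"
        by (intro integrable_hk_mult[OF t] borel_measurable_times meas bound bump1 abs_mult_bump_le)+
      have "(LINT y|lborel. hk 0 y t * ?f y) - P t ?g 0 = (LINT y|lborel. hk 0 y t * ?f y - hk 0 y t * ?g y)"
        using int by (simp add: integral_hk[OF t test_function_C0[OF test]])
      also have "norm \<dots> \<le> (LINT y|lborel. hk 0 y t - hk 0 y t * bump 0 y)"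
      proof (rule order_trans[OF integral_norm_bound integral_mono])
        fix y
        have "norm (hk 0 y t * ?f y - hk 0 y t * ?g y) = hk 0 y t * (\<bar>?f y\<bar> * (1 - bump 0 y))"
        proof -
          have "hk 0 y t * ?f y - hk 0 y t * ?g y = hk 0 y t * (?f y * (1 - bump 0 y))"
            by (simp add: algebra_simps)
          moreover have "\<bar>1 - bump 0 y\<bar> = 1 - bump 0 y"
            using bump_le_1[of 0 y] by simp
          ultimately show ?thesis
            using hk_nonneg[OF t] by (simp add: abs_mult)
        qed
        also have "\<dots> \<le> hk 0 y t * (1 * (1 - bump 0 y))"
          using hk_nonneg[OF t] bump_le_1 bound by (intro mult_left_mono mult_right_mono) auto
        finally show "norm (hk 0 y t * ?f y - hk 0 y t * ?g y) \<le> hk 0 y t - hk 0 y t * bump 0 y"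
          by (simp add: algebra_simps)
      qed (use int integrable_hk[OF t] in auto)
      also have "\<dots> = (LINT y|lborel. hk 0 y t) - P t (bump 0) 0"
        using int integrable_hk[OF t] by (simp add: integral_hk[OF t test_function_C0[OF test_function_bump]])
      \<comment> \<open>Conservativeness is still to be derived; the bound 1 for the total mass
        points in the required direction.\<close>
      also have "\<dots> \<le> 1 - P t (bump 0) 0"
        using integral_hk_le_1[OF t, of 0] by simp
      finally have "\<bar>(LINT y|lborel. hk 0 y t * ?f y) - P t ?g 0\<bar> / t \<le> (1 - P t (bump 0) 0) / t"
        using t by (intro divide_right_mono) auto
      then show ?thesis
        using t by (simp flip: diff_divide_distrib)
    qed
    then show ?thesis
      by (auto simp: eventually_at_filter)
  qed
  then have "((\<lambda>t. ((LINT y|lborel. hk 0 y t * ?f y) - f 0) / t - (P t ?g 0 - f 0) / t) \<longlongrightarrow> 0) (at_right 0)"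
    by (rule Lim_null_comparison[OF _ u])
  from tendsto_add[OF this g] show ?thesis
    by simp
qed

lemma fourier_derivative: "((\<lambda>t. (fourier \<theta> t - 1) / of_real t) \<longlongrightarrow> - of_real (\<theta>\<^sup>2)) (at_right 0)"
proof -
  have "((\<lambda>t. ((LINT y|lborel. hk 0 y t * cos (\<theta> * (y \<bullet> dir))) - cos 0) / t) \<longlongrightarrow> - 1 * \<theta>\<^sup>2) (at_right 0)"
    by (rule trig_derivative[where f' = "\<lambda>x. - sin x", OF _ _ smooth_on_cos_inner]) (auto intro!: derivative_eq_intros)
  then have c: "((\<lambda>t. (fcos \<theta> t - 1) / t) \<longlongrightarrow> - \<theta>\<^sup>2) (at_right 0)"
    by (simp add: fcos_def)
  have "((\<lambda>t. ((LINT y|lborel. hk 0 y t * sin (\<theta> * (y \<bullet> dir))) - sin 0) / t) \<longlongrightarrow> 0 * \<theta>\<^sup>2) (at_right 0)"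
    by (rule trig_derivative[where f' = cos, OF _ _ smooth_on_sin_inner]) (auto intro!: derivative_eq_intros)
  then have s: "((\<lambda>t. fsin \<theta> t / t) \<longlongrightarrow> 0) (at_right 0)"
    by (simp add: fsin_def)
  have "((\<lambda>t. Complex ((fcos \<theta> t - 1) / t) (fsin \<theta> t / t)) \<longlongrightarrow> Complex (- \<theta>\<^sup>2) 0) (at_right 0)"
    by (rule tendsto_Complex[OF c s])
  moreover have "Complex ((fcos \<theta> t - 1) / t) (fsin \<theta> t / t) = (fourier \<theta> t - 1) / of_real t" for t
    by (simp add: fourier_def complex_eq_iff)
  moreover have "Complex (- \<theta>\<^sup>2) 0 = - of_real (\<theta>\<^sup>2)"
    by (simp add: complex_eq_iff)
  ultimately show ?thesis
    by simp
qed

text \<open>Two multiplicative semigroups in the closed unit disc with the same right derivative at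
  0 agree. For numbers in the disc, n-th powers differ by at most n times the difference of the
  bases; at time \<open>t / n\<close> this is \<open>t\<close> times the difference of the two
  difference quotients, which tends to 0. So only small times enter.\<close>

lemma fourier_eq:
  assumes t: "0 < t"
  shows "fourier \<theta> t = of_real (exp (- \<theta>\<^sup>2 * t))"
proof -
  define E where "E s = complex_of_real (exp (- \<theta>\<^sup>2 * s))" for s :: real
  have "((\<lambda>s. (exp (- \<theta>\<^sup>2 * s) - 1) / s) \<longlongrightarrow> - \<theta>\<^sup>2) (at_right 0)"
    by real_asymp
  then have "((\<lambda>s. complex_of_real ((exp (- \<theta>\<^sup>2 * s) - 1) / s)) \<longlongrightarrow> of_real (- \<theta>\<^sup>2)) (at_right 0)"
    by (rule tendsto_of_real)
  then have "((\<lambda>s. (E s - 1) / of_real s) \<longlongrightarrow> - of_real (\<theta>\<^sup>2)) (at_right 0)"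
    by (simp add: E_def)
  from tendsto_diff[OF fourier_derivative[of \<theta>] this]
  have "((\<lambda>s. (fourier \<theta> s - E s) / of_real s) \<longlongrightarrow> 0) (at_right 0)"
    by (simp flip: diff_divide_distrib)
  moreover have "filterlim (\<lambda>n. t / real (Suc n)) (at_right 0) sequentially"
    using t by real_asymp
  ultimately have "(\<lambda>n. (fourier \<theta> (t / real (Suc n)) - E (t / real (Suc n))) / of_real (t / real (Suc n))) \<longlonglongrightarrow> 0"
    by (rule filterlim_compose)
  then have lim: "(\<lambda>n. t * norm ((fourier \<theta> (t / real (Suc n)) - E (t / real (Suc n))) / of_real (t / real (Suc n)))) \<longlonglongrightarrow> 0"
    by (intro tendsto_mult_right_zero tendsto_norm_zero)
  have "norm (fourier \<theta> t - E t) \<le> t * norm ((fourier \<theta> (t / real (Suc n)) - E (t / real (Suc n))) / of_real (t / real (Suc n)))" for n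
  proof -
    let ?s = "t / real (Suc n)"
    have s: "0 < ?s" "real (Suc n) * ?s = t"
      using t by auto
    have "fourier \<theta> t = fourier \<theta> ?s ^ Suc n"
      using fourier_of_nat[OF s(1)] s(2) by metis
    moreover have "E t = E ?s ^ Suc n"
    proof -
      have "exp (- \<theta>\<^sup>2 * t) = exp (- \<theta>\<^sup>2 * ?s) ^ Suc n"
        unfolding exp_of_nat_mult[symmetric] by (subst s(2)[symmetric]) (simp only: mult_ac)
      then show ?thesis
        by (simp add: E_def)
    qed
    moreover have "norm (fourier \<theta> ?s ^ Suc n - E ?s ^ Suc n) \<le> real (Suc n) * norm (fourier \<theta> ?s - E ?s)"
      using norm_fourier_le_1[OF s(1)] t by (intro norm_power_diff) (auto simp: E_def)
    moreover have "real (Suc n) * norm (fourier \<theta> ?s - E ?s) = t * norm ((fourier \<theta> ?s - E ?s) / of_real ?s)"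
    proof -
      have "norm (z / of_real ?s) = norm z / ?s" for z :: complex
        using s(1) by (simp only: norm_divide norm_of_real abs_of_pos)
      then show ?thesis
        using t by (simp del: of_nat_Suc)
    qed
    ultimately show ?thesis
      by simp
  qed
  then have "norm (fourier \<theta> t - E t) \<le> 0"
    by (intro LIMSEQ_le_const[OF lim]) auto
  then show ?thesis
    by (simp add: E_def)
qed

section \<open>The law of the coordinate in direction \<nu>\<close>

definition law :: "real \<Rightarrow> real measure" where
  "law t = distr (density lborel (\<lambda>y. ennreal (hk 0 y t))) borel (\<lambda>y. y \<bullet> dir)"

lemma real_distribution_law:
  assumes t: "0 < t"
  shows "real_distribution (law t)"
proof -
  have "fcos 0 t = 1"
    using fourier_eq[OF t, of 0] by (simp add: fourier_def complex_eq_iff)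
  then have "(LINT y|lborel. hk 0 y t) = 1"
    by (simp add: fcos_def)
  then have "(\<integral>\<^sup>+y. ennreal (hk 0 y t) \<partial>lborel) = 1"
    using integrable_hk[OF t] hk_nonneg[OF t] by (simp add: nn_integral_eq_integral)
  then have "prob_space (density lborel (\<lambda>y. ennreal (hk 0 y t)))"
    using t by (intro prob_spaceI) (simp add: emeasure_density)
  then have "prob_space (law t)"
    unfolding law_def by (rule prob_space.prob_space_distr) simp
  then show ?thesis
    by (simp add: real_distribution_def real_distribution_axioms_def law_def)
qed

lemma char_law:
  assumes t: "0 < t"
  shows "char (law t) \<theta> = of_real (exp (- \<theta>\<^sup>2 * t))"
proof -
  have "char (law t) \<theta> = (CLINT y|lborel. hk 0 y t *\<^sub>R iexp (\<theta> * (y \<bullet> dir)))"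
    unfolding char_def law_def using t hk_nonneg[OF t]
    by (simp add: integral_distr integral_density)
  then show ?thesis
    by (simp only: fourier_eq_integral(2)[OF t, symmetric] fourier_eq[OF t])
qed

lemma law_eq:
  assumes t: "0 < t"
  shows "law t = density lborel (normal_density 0 (sqrt (2 * t)))"
proof -
  interpret std: prob_space std_normal_distribution
    using real_dist_normal_dist by (simp add: real_distribution_def)
  \<comment> \<open>Scaling the standard normal law by \<open>sqrt (2 * t)\<close> turns its
    transform \<open>exp (- \<theta>\<^sup>2 / 2)\<close> into
    \<open>exp (- \<theta>\<^sup>2 * t)\<close>.\<close>
  let ?c = "sqrt (2 * t)"
  have c: "0 < ?c"
    using t by simp
  let ?N = "distr std_normal_distribution borel (\<lambda>x. ?c * x)"
  have "real_distribution ?N"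
    by (rule std.real_distribution_distr) simp
  moreover have "char ?N \<theta> = of_real (exp (- \<theta>\<^sup>2 * t))" for \<theta>
  proof -
    have "char ?N \<theta> = char std_normal_distribution (\<theta> * ?c)"
      by (simp add: char_def integral_distr mult.assoc)
    also have "\<dots> = of_real (exp (- \<theta>\<^sup>2 * t))"
      using t by (simp add: char_std_normal_distribution power_mult_distrib del: of_real_exp)
    finally show ?thesis .
  qed
  ultimately have "law t = ?N"
    by (intro Levy_uniqueness[OF real_distribution_law[OF t]] ext) (simp_all add: char_law[OF t])
  moreover have "distributed std_normal_distribution lborel (\<lambda>x. 0 + ?c * x)
      (normal_density (0 + ?c * 0) (\<bar>?c\<bar> * 1))"
    using c by (intro std.normal_density_affine)
       (auto simp: distributed_def distr_id2)
  ultimately show ?thesis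
    using c by (simp add: distributed_def cong: distr_cong)
qed

end

section \<open>Absolute moments of the normal distribution\<close>

lemma Gamma_legendre_duplication_real:
  fixes x :: real
  assumes "0 < x"
  shows "Gamma x * Gamma (x + 1 / 2) = 2 powr (1 - 2 * x) * sqrt pi * Gamma (2 * x)"
proof -
  have "Gamma (complex_of_real x) * Gamma (complex_of_real x + 1 / 2) =
      exp ((1 - 2 * complex_of_real x) * of_real (ln 2)) * of_real (sqrt pi) * Gamma (2 * complex_of_real x)"
  proof (rule Gamma_legendre_duplication)
    show "complex_of_real x \<notin> \<int>\<^sub>\<le>\<^sub>0"
      using assms nonpos_Ints_nonpos[of x] by (auto simp: of_real_in_nonpos_Ints_iff)
    have "x + 1 / 2 \<notin> \<int>\<^sub>\<le>\<^sub>0"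
      using assms nonpos_Ints_nonpos[of "x + 1 / 2"] by auto
    then have "complex_of_real (x + 1 / 2) \<notin> \<int>\<^sub>\<le>\<^sub>0"
      by (simp only: of_real_in_nonpos_Ints_iff not_False_eq_True)
    then show "complex_of_real x + 1 / 2 \<notin> \<int>\<^sub>\<le>\<^sub>0"
      by simp
  qed
  also have "complex_of_real x + 1 / 2 = of_real (x + 1 / 2)"
    by simp
  also have "2 * complex_of_real x = of_real (2 * x)"
    by simp
  also have "exp ((1 - of_real (2 * x)) * of_real (ln 2)) = complex_of_real (2 powr (1 - 2 * x))"
  proof -
    have "(1 - complex_of_real (2 * x)) * of_real (ln 2) = of_real ((1 - 2 * x) * ln 2)"
      by simp
    then show ?thesis
      by (simp only: exp_of_real) (simp add: powr_def)
  qed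
  finally have "complex_of_real (Gamma x * Gamma (x + 1 / 2)) =
      of_real (2 powr (1 - 2 * x) * sqrt pi * Gamma (2 * x))"
    unfolding Gamma_complex_of_real by (simp only: of_real_mult)
  then show ?thesis
    by (simp only: of_real_eq_iff)
qed

text \<open>On the positive half-line the substitution \<open>u = x\<^sup>2 / (4 * t)\<close>
  produces Gamma at \<open>(p + 1) / 2\<close>; symmetry doubles it. The duplication formula at
  \<open>p / 2\<close> then replaces this value by the quotient of \<open>Gamma p\<close> and
  \<open>Gamma (p / 2)\<close>.\<close>

lemma normal_abs_moment:
  fixes t p :: real
  assumes t: "0 < t" and p: "1 \<le> p"
  shows "(LINT x|density lborel (normal_density 0 (sqrt (2 * t))). \<bar>x\<bar> powr p) =
    t powr (p / 2) * (2 * Gamma p / Gamma (p / 2))"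
proof -
  define G where "G = Gamma ((p + 1) / 2)"
  \<comment> \<open>The factor \<open>2 * t\<close> cancels the denominator of the derivative of
    \<open>?g\<close>, the power of \<open>4 * t\<close> that of \<open>?g\<close> raised to
    \<open>(p - 1) / 2\<close>, and the root normalises the density.\<close>
  define c where "c = 2 * t * (4 * t) powr ((p - 1) / 2) / sqrt (4 * pi * t)"
  define h where "h x = normal_density 0 (sqrt (2 * t)) x * \<bar>x\<bar> powr p" for x
  define f where "f u = u powr ((p - 1) / 2) / exp u" for u :: real
  let ?g = "\<lambda>x. x\<^sup>2 / (4 * t)"
  have h0: "0 \<le> h x" for x
    by (simp add: h_def)
  have meas [measurable]: "h \<in> borel_measurable borel"
    by (simp add: h_def[abs_def])
  have G0: "0 < G"
    unfolding G_def using p by (intro Gamma_real_pos) simp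
  have c0: "0 < c"
    using t by (simp add: c_def)
  have img: "?g ` {0<..} = {0<..}"
  proof (intro equalityI subsetI)
    fix u :: real
    assume "u \<in> {0<..}"
    then show "u \<in> ?g ` {0<..}"
      using t by (intro image_eqI[where x = "sqrt (4 * t * u)"]) auto
  qed (use t in auto)
  have "(f has_integral G) {0..}"
    using Gamma_integral_real[of "(p + 1) / 2"] p by (simp add: f_def[abs_def] G_def diff_divide_distrib add_divide_distrib)
  then have f: "(f has_integral G) {0<..}"
    by (subst (asm) has_integral_spike_set_eq[of _ "{0<..}"]) (auto intro: negligible_subset[of "{0}"])
  then have "f absolutely_integrable_on ?g ` {0<..}" "integral (?g ` {0<..}) f = G"
    unfolding img by (auto simp: f_def intro!: nonnegative_absolutely_integrable_1)
  moreover have "inj_on ?g {0<..}"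
    using t by (auto simp: inj_on_def)
  moreover have "(?g has_real_derivative x / (2 * t)) (at x within {0<..})" for x
    using t by (auto intro!: derivative_eq_intros)
  ultimately have "(\<lambda>x. \<bar>x / (2 * t)\<bar> * f (?g x)) absolutely_integrable_on {0<..}"
      "integral {0<..} (\<lambda>x. \<bar>x / (2 * t)\<bar> * f (?g x)) = G"
    using has_absolute_integral_change_of_variables_1'[of "{0<..}" ?g "\<lambda>x. x / (2 * t)" f G] by auto
  then have "((\<lambda>x. \<bar>x / (2 * t)\<bar> * f (?g x)) has_integral G) {0<..}"
    using set_lebesgue_integral_eq_integral(1) has_integral_integral by blast
  then have "((\<lambda>x. c * (\<bar>x / (2 * t)\<bar> * f (?g x))) has_integral c * G) {0<..}"
    by (rule has_integral_mult_right)
  moreover have "c * (\<bar>x / (2 * t)\<bar> * f (?g x)) = h x" if "x \<in> {0<..}" for x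
  proof -
    have x: "0 < x"
      using that by simp
    have "(?g x) powr ((p - 1) / 2) = x powr (p - 1) / (4 * t) powr ((p - 1) / 2)"
      using x t by (simp add: powr_divide powr_powr diff_divide_distrib flip: powr_numeral)
    moreover have "x * x powr (p - 1) = x powr p"
      using x by (simp add: powr_mult_base)
    ultimately have "c * (\<bar>x / (2 * t)\<bar> * f (?g x)) = x powr p / exp (?g x) / sqrt (4 * pi * t)"
      using x t by (simp add: c_def f_def field_simps)
    also have "\<dots> = h x"
      using x t by (simp add: h_def normal_density_def exp_minus field_simps real_sqrt_mult)
    finally show ?thesis .
  qed
  ultimately have "(h has_integral c * G) {0<..}"
    by (rule has_integral_eq[rotated])
  then have pos: "(\<integral>\<^sup>+x. ennreal (h x) * indicator {0<..} x \<partial>lborel) = ennreal (c * G)"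
    by (intro nn_integral_has_integral_lebesgue' h0)
  have "(\<integral>\<^sup>+x. ennreal (h x) * indicator {..<0} x \<partial>lborel) =
      (\<integral>\<^sup>+x. ennreal (h (- x)) * indicator {..<0} (- x) \<partial>lborel)"
    by (subst nn_integral_real_affine[where c = "- 1" and t = 0]) auto
  also have "\<dots> = (\<integral>\<^sup>+x. ennreal (h x) * indicator {0<..} x \<partial>lborel)"
    by (intro nn_integral_cong) (auto simp: h_def normal_density_def indicator_def)
  finally have neg: "(\<integral>\<^sup>+x. ennreal (h x) * indicator {..<0} x \<partial>lborel) = ennreal (c * G)"
    using pos by simp
  \<comment> \<open>The origin lies in neither half-line; nothing is lost because
    \<open>0 powr p = 0\<close> gives \<open>h 0 = 0\<close>.\<close>
  have "(\<integral>\<^sup>+x. ennreal (h x) \<partial>lborel) =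
      (\<integral>\<^sup>+x. ennreal (h x) * indicator {0<..} x + ennreal (h x) * indicator {..<0} x \<partial>lborel)"
    by (intro nn_integral_cong) (auto simp: indicator_def h_def not_less)
  also have "\<dots> = ennreal (2 * c * G)"
    using c0 G0 by (subst nn_integral_add) (auto simp: pos neg simp flip: ennreal_plus)
  finally have nn: "(\<integral>\<^sup>+x. ennreal (h x) \<partial>lborel) = ennreal (2 * c * G)" .
  have "(LINT x|density lborel (normal_density 0 (sqrt (2 * t))). \<bar>x\<bar> powr p) = (LINT x|lborel. h x)"
    by (subst integral_density) (auto simp: h_def[abs_def])
  also have "\<dots> = 2 * c * G"
    using h0 c0 G0 by (simp add: integral_eq_nn_integral nn)
  also have "2 * c = t powr (p / 2) * 2 powr p / sqrt pi"
  proof -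
    have "(4 * t) powr (p / 2) = (4 * t) powr ((p - 1) / 2) * sqrt (4 * t)"
      using t by (simp add: powr_half_sqrt[symmetric] flip: powr_add add_divide_distrib)
    moreover have "(4 * t) powr (p / 2) = 2 powr p * t powr (p / 2)"
    proof -
      have "(4::real) powr (p / 2) = (2 powr 2) powr (p / 2)"
        by simp
      also have "\<dots> = 2 powr p"
        by (simp only: powr_powr) simp
      finally show ?thesis
        using t by (simp add: powr_mult)
    qed
    moreover have "2 * c = (4 * t) powr ((p - 1) / 2) * sqrt (4 * t) / sqrt pi"
    proof -
      have "2 * c = 4 * t * (4 * t) powr ((p - 1) / 2) / (sqrt pi * sqrt (4 * t))"
        by (simp add: c_def flip: real_sqrt_mult) (simp add: mult_ac)
      moreover have "a * q / (sqrt pi * s) = q * s / sqrt pi" if "a = s * s" "0 < s" for a q s :: real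
        using that by simp
      ultimately show ?thesis
        using t by simp
    qed
    ultimately show ?thesis
      by (simp add: mult.commute)
  qed
  also have "t powr (p / 2) * 2 powr p / sqrt pi * G = t powr (p / 2) * (2 * Gamma p / Gamma (p / 2))"
  proof -
    have 1: "Gamma (p / 2) * G = 2 powr (1 - p) * sqrt pi * Gamma p"
      using Gamma_legendre_duplication_real[of "p / 2"] p by (simp add: G_def add_divide_distrib)
    have 2: "2 powr (1 - p) * 2 powr p = (2::real)"
      by (simp flip: powr_add)
    have "Gamma (p / 2) * G * 2 powr p = 2 powr (1 - p) * 2 powr p * sqrt pi * Gamma p"
      unfolding 1 by (simp only: mult_ac)
    then have "Gamma (p / 2) * G * 2 powr p = 2 * sqrt pi * Gamma p"
      unfolding 2 .
    moreover have "0 < Gamma (p / 2)"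
      using p by (intro Gamma_real_pos) simp
    ultimately show ?thesis
      by (simp add: field_simps)
  qed
  finally show ?thesis .
qed

section \<open>Lebesgue measure on subspaces\<close>

text \<open>A positive weight whose integral over a subspace depends only on the dimension. It fixes
  the normalisation of translation-invariant measures and yields sigma-finiteness.\<close>

definition gaussian_weight :: "'a::euclidean_space \<Rightarrow> ennreal" where
  "gaussian_weight x = ennreal (exp (- (norm x)\<^sup>2 / 2))"

lemma gaussian_weight_measurable [measurable]: "gaussian_weight \<in> borel_measurable borel"
  unfolding gaussian_weight_def[abs_def] by measurable

lemma nn_integral_gaussian_real:
  "(\<integral>\<^sup>+x. ennreal (exp (- x\<^sup>2 / 2)) \<partial>lborel) = ennreal (sqrt (2 * pi))"
proof -
  have "(\<integral>\<^sup>+x. ennreal (exp (- x\<^sup>2 / 2)) \<partial>lborel) =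
      (\<integral>\<^sup>+x. ennreal (sqrt (2 * pi)) * ennreal (std_normal_density x) \<partial>lborel)"
    by (intro nn_integral_cong) (simp add: std_normal_density_def flip: ennreal_mult')
  also have "\<dots> = ennreal (sqrt (2 * pi)) * (\<integral>\<^sup>+x. ennreal (std_normal_density x) \<partial>lborel)"
    by (rule nn_integral_cmult) simp
  also have "(\<integral>\<^sup>+x. ennreal (std_normal_density x) \<partial>lborel) = 1"
    using prob_space.emeasure_space_1[OF prob_space_normal_density[of 1 0]] by (simp add: emeasure_density)
  finally show ?thesis
    by simp
qed

lemma PiM_lborel_translate:
  fixes c :: "'i \<Rightarrow> real"
  assumes B: "finite B"
  shows "distr (\<Pi>\<^sub>M b\<in>B. lborel) (\<Pi>\<^sub>M b\<in>B. lborel) (\<lambda>x. \<lambda>b\<in>B. x b + c b) = (\<Pi>\<^sub>M b\<in>B. lborel)"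
proof -
  interpret product_sigma_finite "\<lambda>_::'i. lborel :: real measure" ..
  have meas: "(\<lambda>x. \<lambda>b\<in>B. x b + c b) \<in> (\<Pi>\<^sub>M b\<in>B. lborel) \<rightarrow>\<^sub>M (\<Pi>\<^sub>M b\<in>B. lborel :: real measure)"
    by measurable
  show ?thesis
  proof (rule PiM_eqI[OF B])
    fix A :: "'i \<Rightarrow> real set"
    assume A: "\<And>i. i \<in> B \<Longrightarrow> A i \<in> sets lborel"
    have "emeasure (distr (\<Pi>\<^sub>M b\<in>B. lborel) (\<Pi>\<^sub>M b\<in>B. lborel) (\<lambda>x. \<lambda>b\<in>B. x b + c b)) (Pi\<^sub>E B A) =
        emeasure (\<Pi>\<^sub>M b\<in>B. lborel) ((\<lambda>x. \<lambda>b\<in>B. x b + c b) -` Pi\<^sub>E B A \<inter> space (\<Pi>\<^sub>M b\<in>B. lborel))"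
      using A by (intro emeasure_distr meas sets_PiM_I_finite B) auto
    also have "(\<lambda>x. \<lambda>b\<in>B. x b + c b) -` Pi\<^sub>E B A \<inter> space (\<Pi>\<^sub>M b\<in>B. lborel) =
        Pi\<^sub>E B (\<lambda>b. (\<lambda>y. c b + y) -` A b)"
      by (auto simp: space_PiM PiE_iff add.commute)
    also have "emeasure (\<Pi>\<^sub>M b\<in>B. lborel) (Pi\<^sub>E B (\<lambda>b. (\<lambda>y. c b + y) -` A b)) =
        (\<Prod>b\<in>B. emeasure lborel ((\<lambda>y. c b + y) -` A b))"
    proof (rule emeasure_PiM[OF B])
      fix b
      assume "b \<in> B"
      then show "(\<lambda>y. c b + y) -` A b \<in> sets lborel"
        using A measurable_sets[of "\<lambda>y. c b + y" borel borel "A b"] by simp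
    qed
    also have "\<dots> = (\<Prod>b\<in>B. emeasure lborel (A b))"
    proof (rule prod.cong)
      fix b
      assume "b \<in> B"
      then have "emeasure (distr lborel borel ((+) (c b))) (A b) = emeasure lborel ((\<lambda>y. c b + y) -` A b)"
        using A by (subst emeasure_distr) auto
      then show "emeasure lborel ((\<lambda>y. c b + y) -` A b) = emeasure lborel (A b)"
        by (simp add: lborel_distr_plus)
    qed simp
    finally show "emeasure (distr (\<Pi>\<^sub>M b\<in>B. lborel) (\<Pi>\<^sub>M b\<in>B. lborel) (\<lambda>x. \<lambda>b\<in>B. x b + c b)) (Pi\<^sub>E B A) =
        (\<Prod>b\<in>B. emeasure lborel (A b))" .
  qed simp
qed

text \<open>The measure behind \<open>subspace_lborel\<close> for an explicit basis, so that its
  properties are proved without reference to the choice operator.\<close>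

definition orthonormal_lborel :: "'a::euclidean_space set \<Rightarrow> 'a measure" where
  "orthonormal_lborel B = distr (\<Pi>\<^sub>M b\<in>B. lborel) borel (\<lambda>x. \<Sum>b\<in>B. x b *\<^sub>R b)"

lemma orthonormal_lborel_sum_measurable [measurable]:
  fixes B :: "'a::euclidean_space set"
  shows "(\<lambda>x. \<Sum>b\<in>B. x b *\<^sub>R b) \<in> (\<Pi>\<^sub>M b\<in>B. lborel :: real measure) \<rightarrow>\<^sub>M borel"
  by (intro borel_measurable_sum borel_measurable_scaleR) (auto intro: measurable_component_singleton[THEN measurable_compose])

lemma nn_integral_orthonormal_lborel:
  assumes "f \<in> borel_measurable borel"
  shows "(\<integral>\<^sup>+x. f x \<partial>orthonormal_lborel B) = (\<integral>\<^sup>+x. f (\<Sum>b\<in>B. x b *\<^sub>R b) \<partial>(\<Pi>\<^sub>M b\<in>B. lborel))"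
  unfolding orthonormal_lborel_def using assms by (intro nn_integral_distr) auto

lemma orthonormal_finite:
  fixes B :: "'a::euclidean_space set"
  assumes "pairwise orthogonal B" "\<forall>b\<in>B. norm b = 1"
  shows "independent B" "finite B"
proof -
  show "independent B"
    using assms by (intro pairwise_orthogonal_independent) auto
  then show "finite B"
    by (rule independent_imp_finite)
qed

lemma orthonormal_lborel_translate:
  fixes B :: "'a::euclidean_space set"
  assumes B: "pairwise orthogonal B" "\<forall>b\<in>B. norm b = 1" and s: "s \<in> span B"
    and f[measurable]: "f \<in> borel_measurable borel"
  shows "(\<integral>\<^sup>+x. f (x + s) \<partial>orthonormal_lborel B) = (\<integral>\<^sup>+x. f x \<partial>orthonormal_lborel B)"
proof -
  have fin: "finite B"
    by (rule orthonormal_finite[OF B])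
  obtain c where s: "s = (\<Sum>b\<in>B. c b *\<^sub>R b)"
    using s unfolding span_finite[OF fin] by auto
  let ?M = "\<Pi>\<^sub>M b\<in>B. lborel :: real measure" and ?T = "\<lambda>x. \<lambda>b\<in>B. x b + c b"
  have "(\<integral>\<^sup>+x. f (x + s) \<partial>orthonormal_lborel B) = (\<integral>\<^sup>+x. f (\<Sum>b\<in>B. ?T x b *\<^sub>R b) \<partial>?M)"
    by (subst nn_integral_orthonormal_lborel)
       (auto simp: s scaleR_add_left sum.distrib intro!: nn_integral_cong)
  also have "\<dots> = (\<integral>\<^sup>+x. f (\<Sum>b\<in>B. x b *\<^sub>R b) \<partial>distr ?M ?M ?T)"
    by (rule nn_integral_distr[symmetric]) measurable
  also have "\<dots> = (\<integral>\<^sup>+x. f x \<partial>orthonormal_lborel B)"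
    unfolding PiM_lborel_translate[OF fin] by (rule nn_integral_orthonormal_lborel[symmetric]) simp
  finally show ?thesis .
qed

text \<open>By Pythagoras the weight is a product over the coordinates.\<close>

lemma orthonormal_lborel_gaussian:
  fixes B :: "'a::euclidean_space set"
  assumes B: "pairwise orthogonal B" "\<forall>b\<in>B. norm b = 1"
  shows "(\<integral>\<^sup>+x. gaussian_weight x \<partial>orthonormal_lborel B) = ennreal (sqrt (2 * pi)) ^ card B"
proof -
  have fin: "finite B"
    by (rule orthonormal_finite[OF B])
  interpret product_sigma_finite "\<lambda>_::'a. lborel :: real measure" ..
  have "gaussian_weight (\<Sum>b\<in>B. x b *\<^sub>R b) = (\<Prod>b\<in>B. ennreal (exp (- (x b)\<^sup>2 / 2)))" for x :: "'a \<Rightarrow> real"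
  proof -
    have "(norm (\<Sum>b\<in>B. x b *\<^sub>R b))\<^sup>2 = (\<Sum>b\<in>B. (norm (x b *\<^sub>R b))\<^sup>2)"
      using B(1) by (intro norm_sum_Pythagorean fin pairwise_ortho_scaleR) (auto simp: pairwise_def)
    also have "\<dots> = (\<Sum>b\<in>B. (x b)\<^sup>2)"
      using B(2) by (intro sum.cong) auto
    finally have "exp (- (norm (\<Sum>b\<in>B. x b *\<^sub>R b))\<^sup>2 / 2) = (\<Prod>b\<in>B. exp (- (x b)\<^sup>2 / 2))"
      by (simp add: exp_sum[OF fin, symmetric] sum_divide_distrib sum_negf)
    then show ?thesis
      by (simp add: gaussian_weight_def prod_ennreal)
  qed
  then have "(\<integral>\<^sup>+x. gaussian_weight x \<partial>orthonormal_lborel B) =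
      (\<integral>\<^sup>+x. (\<Prod>b\<in>B. ennreal (exp (- (x b)\<^sup>2 / 2))) \<partial>(\<Pi>\<^sub>M b\<in>B. lborel))"
    by (subst nn_integral_orthonormal_lborel) auto
  also have "\<dots> = (\<Prod>b\<in>B. \<integral>\<^sup>+x. ennreal (exp (- x\<^sup>2 / 2)) \<partial>lborel)"
    by (rule product_nn_integral_prod[OF fin]) measurable
  finally show ?thesis
    by (simp only: nn_integral_gaussian_real prod_constant)
qed

text \<open>The weight is bounded below on every ball, so balls have finite measure.\<close>

lemma sigma_finite_gaussian:
  fixes M :: "'a::euclidean_space measure"
  assumes sets: "sets M = sets borel" and fin: "(\<integral>\<^sup>+x. gaussian_weight x \<partial>M) < \<infinity>"
  shows "sigma_finite_measure M"
proof -
  have [measurable_cong]: "sets M = sets borel"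
    by (rule sets)
  have bound: "emeasure M (cball 0 (real n)) < \<infinity>" for n
  proof -
    let ?c = "ennreal (exp ((real n)\<^sup>2 / 2))"
    have "emeasure M (cball 0 (real n)) = (\<integral>\<^sup>+x. indicator (cball 0 (real n)) x \<partial>M)"
      by (simp add: sets)
    also have "\<dots> \<le> (\<integral>\<^sup>+x. ?c * gaussian_weight x \<partial>M)"
    proof (rule nn_integral_mono)
      fix x :: 'a
      have "1 \<le> exp ((real n)\<^sup>2 / 2 - (norm x)\<^sup>2 / 2)" if "norm x \<le> real n"
        using power_mono[OF that, of 2] by simp
      then show "indicator (cball 0 (real n)) x \<le> ?c * gaussian_weight x"
        by (auto simp: gaussian_weight_def indicator_def simp flip: ennreal_mult' exp_add)
    qed
    also have "\<dots> = ?c * (\<integral>\<^sup>+x. gaussian_weight x \<partial>M)"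
      by (rule nn_integral_cmult) measurable
    also have "\<dots> < \<infinity>"
      using fin by (simp add: ennreal_mult_less_top)
    finally show ?thesis .
  qed
  have "(\<Union>n. cball 0 (real n)) = (UNIV :: 'a set)"
    using real_arch_simple by (auto simp: mem_cball_0)
  moreover have "space M = UNIV"
    using sets_eq_imp_space_eq[OF sets] by simp
  ultimately show ?thesis
    using bound by (intro sigma_finite_measure.intro exI[of _ "range (\<lambda>n. cball 0 (real n))"])
      (auto simp: sets less_top)
qed

text \<open>Uniqueness of Haar measure by Fubini: integrate
  \<open>gaussian_weight x * g (y + x)\<close> over \<open>x\<close> in \<open>M\<close> and
  \<open>y\<close> in \<open>lborel\<close>. Translating \<open>y\<close> gives the Gaussian
  constant times the Lebesgue integral of \<open>g\<close>; translating \<open>x\<close> and using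
  that the weight is even gives the same constant times the integral over \<open>M\<close>.\<close>

lemma translation_invariant_eq_lborel:
  fixes M :: "'a::euclidean_space measure"
  assumes sets: "sets M = sets borel"
    and inv: "\<And>f a. f \<in> borel_measurable borel \<Longrightarrow> (\<integral>\<^sup>+x. f (x + a) \<partial>M) = (\<integral>\<^sup>+x. f x \<partial>M)"
    and gauss: "(\<integral>\<^sup>+x. gaussian_weight x \<partial>M) = ennreal (sqrt (2 * pi)) ^ DIM('a)"
  shows "M = lborel"
proof -
  note [measurable_cong] = sets
  have "sigma_finite_measure M"
    by (rule sigma_finite_gaussian[OF sets]) (simp add: gauss ennreal_power)
  then interpret M: sigma_finite_measure M .
  interpret pair_sigma_finite M "lborel :: 'a measure"
    by standard
  have lborel_eq: "lborel = orthonormal_lborel (Basis :: 'a set)"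
    unfolding orthonormal_lborel_def by (rule lborel_eq)
  have basis: "pairwise orthogonal (Basis :: 'a set)" "\<forall>b\<in>Basis. norm (b::'a) = 1"
    by (auto simp: pairwise_def orthogonal_def inner_Basis)
  have gauss': "(\<integral>\<^sup>+x. gaussian_weight x \<partial>(lborel :: 'a measure)) = ennreal (sqrt (2 * pi)) ^ DIM('a)"
    unfolding lborel_eq by (rule orthonormal_lborel_gaussian[OF basis])
  have inv': "(\<integral>\<^sup>+x. f (x + a) \<partial>lborel) = (\<integral>\<^sup>+x. f x \<partial>lborel)"
    if "f \<in> borel_measurable borel" for f :: "'a \<Rightarrow> ennreal" and a
    unfolding lborel_eq by (rule orthonormal_lborel_translate[OF basis _ that]) simp
  have eq: "(\<integral>\<^sup>+x. g x \<partial>lborel) = (\<integral>\<^sup>+x. g x \<partial>M)" if g[measurable]: "g \<in> borel_measurable borel" for g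
  proof -
    let ?w = gaussian_weight and ?c = "ennreal (sqrt (2 * pi)) ^ DIM('a)"
    have "?c * (\<integral>\<^sup>+y. g y \<partial>lborel) = (\<integral>\<^sup>+x. ?w x * (\<integral>\<^sup>+y. g y \<partial>lborel) \<partial>M)"
      by (simp add: nn_integral_multc gauss)
    also have "\<dots> = (\<integral>\<^sup>+x. (\<integral>\<^sup>+y. ?w x * g y \<partial>lborel) \<partial>M)"
      by (simp add: nn_integral_cmult)
    also have "\<dots> = (\<integral>\<^sup>+x. (\<integral>\<^sup>+y. ?w x * g (y + x) \<partial>lborel) \<partial>M)"
      by (intro nn_integral_cong inv'[symmetric]) measurable
    also have "\<dots> = (\<integral>\<^sup>+y. (\<integral>\<^sup>+x. ?w x * g (y + x) \<partial>M) \<partial>lborel)"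
      by (rule Fubini'[symmetric]) measurable
    also have "\<dots> = (\<integral>\<^sup>+y. (\<integral>\<^sup>+x. ?w (x + (- y)) * g x \<partial>M) \<partial>lborel)"
    proof (rule nn_integral_cong)
      fix y
      have "(\<integral>\<^sup>+x. ?w (x + (- y)) * g (y + (x + (- y))) \<partial>M) = (\<integral>\<^sup>+x. ?w x * g (y + x) \<partial>M)"
        by (rule inv[of "\<lambda>x. ?w x * g (y + x)"]) measurable
      then show "(\<integral>\<^sup>+x. ?w x * g (y + x) \<partial>M) = (\<integral>\<^sup>+x. ?w (x + (- y)) * g x \<partial>M)"
        by simp
    qed
    also have "\<dots> = (\<integral>\<^sup>+x. (\<integral>\<^sup>+y. ?w (x + (- y)) * g x \<partial>lborel) \<partial>M)"
      by (rule Fubini') measurable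
    also have "\<dots> = (\<integral>\<^sup>+x. ?c * g x \<partial>M)"
    proof (rule nn_integral_cong)
      fix x
      have "(\<integral>\<^sup>+y. ?w (x + (- y)) * g x \<partial>lborel) = (\<integral>\<^sup>+y. ?w (y + (- x)) \<partial>lborel) * g x"
        by (subst nn_integral_multc[symmetric])
           (auto simp: gaussian_weight_def norm_minus_commute intro!: nn_integral_cong)
      also have "(\<integral>\<^sup>+y. ?w (y + (- x)) \<partial>lborel) = ?c"
        unfolding gauss'[symmetric] by (rule inv') measurable
      finally show "(\<integral>\<^sup>+y. ?w (x + (- y)) * g x \<partial>lborel) = ?c * g x" .
    qed
    also have "\<dots> = ?c * (\<integral>\<^sup>+x. g x \<partial>M)"
      by (rule nn_integral_cmult) measurable
    finally show ?thesis
      by (simp add: ennreal_power ennreal_mult_cancel_left)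
  qed
  show ?thesis
  proof (rule measure_eqI)
    fix A
    assume "A \<in> sets M"
    then show "emeasure M A = emeasure lborel A"
      using eq[of "indicator A"] by (simp add: sets)
  qed (simp add: sets)
qed

lemma subspace_lborel_obtain:
  fixes S :: "'a::euclidean_space set"
  assumes "subspace S"
  obtains B where "pairwise orthogonal B" "\<forall>b\<in>B. norm b = 1" "span B = S" "card B = dim S"
    "subspace_lborel S = orthonormal_lborel B"
proof -
  let ?P = "\<lambda>B. pairwise orthogonal B \<and> (\<forall>b\<in>B. norm b = 1) \<and> span B = S"
  define B where "B = (SOME B. ?P B)"
  have "\<exists>B. ?P B"
    using orthonormal_basis_subspace[OF assms] by metis
  then have P: "?P B"
    unfolding B_def by (rule someI_ex)
  then have "card B = dim S"
    using orthonormal_finite(1)[of B] dim_span_eq_card_independent[of B] by simp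
  moreover have "subspace_lborel S = orthonormal_lborel B"
    by (simp add: subspace_lborel_def orthonormal_lborel_def Let_def B_def)
  ultimately show ?thesis
    using P that by blast
qed

lemma sets_subspace_lborel [measurable_cong]: "sets (subspace_lborel S) = sets borel"
  by (simp add: subspace_lborel_def Let_def)

lemma space_subspace_lborel [simp]: "space (subspace_lborel S) = UNIV"
  by (simp add: subspace_lborel_def Let_def)

lemma
  fixes S :: "'a::euclidean_space set"
  assumes S: "subspace S"
  shows subspace_lborel_translate: "s \<in> S \<Longrightarrow> f \<in> borel_measurable borel \<Longrightarrow>
      (\<integral>\<^sup>+x. f (x + s) \<partial>subspace_lborel S) = (\<integral>\<^sup>+x. f x \<partial>subspace_lborel S)"
    and subspace_lborel_gaussian:
      "(\<integral>\<^sup>+x. gaussian_weight x \<partial>subspace_lborel S) = ennreal (sqrt (2 * pi)) ^ dim S"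
    and AE_subspace_lborel: "AE x in subspace_lborel S. x \<in> S"
proof -
  obtain B where B: "pairwise orthogonal B" "\<forall>b\<in>B. norm b = 1" "span B = S" "card B = dim S"
    "subspace_lborel S = orthonormal_lborel B"
    using subspace_lborel_obtain[OF S] .
  show "(\<integral>\<^sup>+x. f (x + s) \<partial>subspace_lborel S) = (\<integral>\<^sup>+x. f x \<partial>subspace_lborel S)"
    if "s \<in> S" "f \<in> borel_measurable borel"
    unfolding B(5) by (rule orthonormal_lborel_translate[OF B(1,2)]) (use that B(3) in auto)
  show "(\<integral>\<^sup>+x. gaussian_weight x \<partial>subspace_lborel S) = ennreal (sqrt (2 * pi)) ^ dim S"
    unfolding B(5) by (simp add: orthonormal_lborel_gaussian[OF B(1,2)] B(4))
  have "{x. x \<in> S} \<in> sets borel"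
    using closed_subspace[OF S] by simp
  then show "AE x in subspace_lborel S. x \<in> S"
    unfolding B(5) orthonormal_lborel_def
    by (subst AE_distr_iff) (auto simp flip: B(3) intro!: AE_I2 span_sum span_scale intro: span_base)
qed

lemma sigma_finite_subspace_lborel:
  "subspace S \<Longrightarrow> sigma_finite_measure (subspace_lborel S)"
  using sigma_finite_gaussian[OF sets_subspace_lborel, of S]
  by (simp add: subspace_lborel_gaussian ennreal_power)

section \<open>Slices\<close>

context carnot_heat_direction
begin

abbreviation hplane :: "(real ^ 'm) set" where
  "hplane \<equiv> {z. z \<bullet> \<nu> = 0}"

abbreviation vert_measure :: "'a measure" where
  "vert_measure \<equiv> subspace_lborel (vertical_space V r)"

abbreviation slice_measure :: "((real ^ 'm) \<times> 'a) measure" where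
  "slice_measure \<equiv> subspace_lborel hplane \<Otimes>\<^sub>M vert_measure"

text \<open>The parameter \<open>a\<close> is the height in direction \<nu>. Height 0 is the
  hyperplane of the second claim, and the slices at all heights together disintegrate Lebesgue
  measure.\<close>

definition slice_point :: "real \<Rightarrow> (real ^ 'm) \<times> 'a \<Rightarrow> 'a" where
  "slice_point a w = a *\<^sub>R dir + from_coord e (fst w) (snd w)"

lemma subspace_hplane: "subspace hplane"
  by (auto simp: subspace_def inner_add_left)

lemma subspace_vertical: "subspace (vertical_space V r)"
  by (simp add: vertical_space_def)

sublocale HV: pair_sigma_finite "subspace_lborel hplane" "vert_measure"
  by (intro pair_sigma_finite.intro sigma_finite_subspace_lborel subspace_hplane subspace_vertical)

lemmas nn_integral_slice_fst = sigma_finite_measure.nn_integral_fst[OF HV.sigma_finite_measure_axioms]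

lemmas slice_fst_measurable =
  sigma_finite_measure.borel_measurable_nn_integral_fst[OF HV.sigma_finite_measure_axioms]

lemma sets_slice_measure [measurable_cong]: "sets slice_measure = sets (borel \<Otimes>\<^sub>M borel)"
  by (intro sets_pair_measure_cong sets_subspace_lborel)

lemma space_slice_measure [simp]: "space slice_measure = UNIV"
  by (simp add: space_pair_measure)

lemma slice_point_measurable:
  "(\<lambda>q. slice_point (fst q) (snd q)) \<in> borel_measurable (lborel \<Otimes>\<^sub>M slice_measure)"
proof -
  have "(\<lambda>q::real \<times> (real ^ 'm) \<times> 'a. slice_point (fst q) (snd q)) \<in> borel_measurable borel"
    unfolding slice_point_def from_coord_def
    by (intro borel_measurable_continuous_onI continuous_intros)
  moreover have "sets (lborel \<Otimes>\<^sub>M slice_measure) = sets (borel :: (real \<times> (real ^ 'm) \<times> 'a) measure)"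
    by (simp add: borel_prod[symmetric] sets_slice_measure cong: sets_pair_measure_cong)
  ultimately show ?thesis
    by (simp cong: measurable_cong_sets)
qed

lemma slice_point_measurable' [measurable]: "slice_point a \<in> borel_measurable slice_measure"
proof -
  have "(\<lambda>w. (a, w)) \<in> slice_measure \<rightarrow>\<^sub>M lborel \<Otimes>\<^sub>M slice_measure"
    by measurable
  from measurable_compose[OF this slice_point_measurable] show ?thesis
    by simp
qed

lemma inner_vertical:
  assumes "\<sigma> \<in> vertical_space V r"
  shows "\<sigma> \<bullet> e i = 0"
proof -
  have "e i \<in> V 1"
    unfolding span_basis[symmetric] by (intro span_base) simp
  have ortho: "orthogonal (e i) x" if x: "x \<in> (\<Union>j\<in>{2..r}. V j)" for x
  proof -
    obtain j where j: "j \<in> {2..r}" "x \<in> V j"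
      using x by blast
    have "x \<bullet> e i = 0"
      by (rule orthogonal_layers[of j 1]) (use j \<open>e i \<in> V 1\<close> step_pos in auto)
    then show ?thesis
      by (simp add: orthogonal_def inner_commute)
  qed
  have "\<sigma> \<in> span (\<Union>j\<in>{2..r}. V j)"
    using assms by (simp add: vertical_space_def)
  then have "orthogonal (e i) \<sigma>"
    using ortho by (rule orthogonal_to_span)
  then show ?thesis
    by (simp add: orthogonal_def inner_commute)
qed

lemma V1_representation:
  assumes "x \<in> V 1"
  shows "(\<Sum>i\<in>UNIV. (x \<bullet> e i) *\<^sub>R e i) = x"
proof -
  have "x \<in> span (range e)"
    using assms span_basis by simp
  then show ?thesis
  proof (induction rule: span_induct)
    case base
    have "(\<Sum>i\<in>UNIV. ((c *\<^sub>R x) \<bullet> e i) *\<^sub>R e i) = c *\<^sub>R (\<Sum>i\<in>UNIV. (x \<bullet> e i) *\<^sub>R e i)" for c x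
      by (simp add: scaleR_sum_right)
    then show ?case
      by (simp add: subspace_def inner_add_left scaleR_add_left sum.distrib)
  next
    case (step x)
    then show ?case
      by (auto simp: orthonormal_basis if_distrib[of "\<lambda>c. c *\<^sub>R _"] cong: if_cong)
  qed
qed

lemma layers_decomposition: obtains v1 v2 where "x = v1 + v2" "v1 \<in> V 1" "v2 \<in> vertical_space V r"
proof -
  have V1: "subspace (V 1)"
    unfolding span_basis[symmetric] by simp
  have "x \<in> span (\<Union>j\<in>{1..r}. V j)"
    unfolding span_layers by simp
  also have "(\<Union>j\<in>{1..r}. V j) = V 1 \<union> (\<Union>j\<in>{2..r}. V j)"
  proof -
    have "{1..r} = insert 1 {2..r}"
      using step_pos by auto
    then show ?thesis
      by simp
  qed
  finally obtain v1 v2 where "x = v1 + v2" "v1 \<in> span (V 1)" "v2 \<in> vertical_space V r"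
    unfolding span_Un vertical_space_def by auto
  moreover have "span (V 1) = V 1"
    using V1 by (simp only: span_eq_iff)
  ultimately show ?thesis
    using that[of v1 v2] by (simp only:)
qed

lemma vertical_part: "x - (\<Sum>i\<in>UNIV. (x \<bullet> e i) *\<^sub>R e i) \<in> vertical_space V r"
proof -
  obtain v1 v2 where x: "x = v1 + v2" "v1 \<in> V 1" "v2 \<in> vertical_space V r"
    by (rule layers_decomposition)
  have "(\<Sum>i\<in>UNIV. (x \<bullet> e i) *\<^sub>R e i) = v1"
    using V1_representation[OF x(2)] by (simp add: x(1) inner_add_left inner_vertical[OF x(3)])
  then show ?thesis
    using x by simp
qed

text \<open>This count makes the Gaussian normalisations of the line, the hyperplane and the
  vertical space multiply to that of the whole space in \<open>lborel_slices\<close>.\<close>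

lemma dim_decomposition: "1 + dim hplane + dim (vertical_space V r) = DIM('a)"
proof -
  have V1: "subspace (V 1)"
    unfolding span_basis[symmetric] by simp
  have "inj e"
    using orthonormal_basis by (metis injI zero_neq_one)
  have "independent (range e)"
  proof (rule pairwise_orthogonal_independent)
    show "pairwise orthogonal (range e)"
      by (auto simp: pairwise_def orthogonal_def orthonormal_basis)
    show "0 \<notin> range e"
      using orthonormal_basis by (metis imageE inner_zero_left zero_neq_one)
  qed
  then have "dim (V 1) = CARD('m)"
    using dim_eq_card[OF refl, of "range e"] card_image[OF \<open>inj e\<close>]
    unfolding span_basis[symmetric] by simp
  moreover have "dim hplane = CARD('m) - 1"
  proof -
    have "hplane = {z. \<nu> \<bullet> z = 0}"
      by (simp add: inner_commute)
    then show ?thesis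
      using dim_hyperplane[of \<nu>] norm_dir_coord by force
  qed
  moreover have "dim (V 1) + dim (vertical_space V r) = DIM('a)"
  proof -
    have "V 1 \<inter> vertical_space V r = {0}"
    proof -
      have "x = 0" if "x \<in> V 1" "x \<in> vertical_space V r" for x
        using V1_representation[OF that(1)] by (simp add: inner_vertical[OF that(2)])
      then show ?thesis
        using subspace_0[OF V1] subspace_0[OF subspace_vertical] by auto
    qed
    moreover have "{x + y |x y. x \<in> V 1 \<and> y \<in> vertical_space V r} = UNIV"
    proof (rule UNIV_eq_I[symmetric])
      fix x
      show "x \<in> {x + y |x y. x \<in> V 1 \<and> y \<in> vertical_space V r}"
        by (rule layers_decomposition[of x]) blast
    qed
    ultimately show ?thesis
      using dim_sums_Int[OF V1 subspace_vertical] by (simp add: dim_UNIV)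
  qed
  moreover have "0 < CARD('m)"
    by simp
  ultimately show ?thesis
    by linarith
qed

lemma from_coord_eq: "a *\<^sub>R dir + from_coord e z \<sigma> = (\<Sum>i\<in>UNIV. (z + a *\<^sub>R \<nu>) $ i *\<^sub>R e i) + \<sigma>"
  by (simp add: from_coord_def dir_def scaleR_sum_right sum.distrib scaleR_add_left)

lemma inner_slice_point:
  assumes "fst w \<in> hplane" "snd w \<in> vertical_space V r"
  shows "slice_point a w \<bullet> dir = a"
proof -
  have "snd w \<bullet> dir = 0"
    by (simp add: dir_def inner_sum_right inner_vertical[OF assms(2)])
  moreover have "(\<Sum>i\<in>UNIV. fst w $ i *\<^sub>R e i) \<bullet> dir = fst w \<bullet> \<nu>"
    by (simp add: inner_sum_left e_inner_dir inner_vec_def)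
  ultimately show ?thesis
    using assms by (simp add: slice_point_def from_coord_def inner_add_left dir_inner_dir)
qed

text \<open>The direction, the hyperplane and the vertical part are mutually orthogonal; hence the
  Gaussian weight factorises over slice coordinates, and moving a point to height 0 does not
  increase its norm.\<close>

lemma norm_slice_point:
  assumes "fst w \<in> hplane" "snd w \<in> vertical_space V r"
  shows "(norm (slice_point a w))\<^sup>2 = a\<^sup>2 + (norm (fst w))\<^sup>2 + (norm (snd w))\<^sup>2"
proof -
  let ?y = "fst w + a *\<^sub>R \<nu>"
  let ?h = "\<Sum>i\<in>UNIV. ?y $ i *\<^sub>R e i"
  have h: "?h \<bullet> e j = ?y $ j" for j
    by (simp add: inner_sum_left orthonormal_basis if_distrib cong: if_cong)
  have "?h \<bullet> ?h = (\<Sum>i\<in>UNIV. ?y $ i * (?h \<bullet> e i))"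
    by (simp only: inner_sum_right inner_scaleR_right)
  also have "\<dots> = ?y \<bullet> ?y"
    by (simp only: h) (simp add: inner_vec_def)
  also have "\<dots> = (norm (fst w))\<^sup>2 + a\<^sup>2"
  proof -
    have "orthogonal (fst w) (a *\<^sub>R \<nu>)"
      using assms(1) by (simp add: orthogonal_def)
    then show ?thesis
      using norm_dir_coord by (simp add: norm_add_Pythagorean flip: power2_norm_eq_inner)
  qed
  finally have hh: "?h \<bullet> ?h = (norm (fst w))\<^sup>2 + a\<^sup>2" .
  have "?h \<bullet> snd w = 0"
  proof -
    have "e i \<bullet> snd w = 0" for i
      using inner_vertical[OF assms(2)] by (simp add: inner_commute)
    then show ?thesis
      by (simp add: inner_sum_left)
  qed
  then show ?thesis
    unfolding slice_point_def from_coord_eq using hh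
    by (simp add: power2_norm_eq_inner inner_add_left inner_add_right inner_commute del: vector_add_component)
qed

text \<open>The subspace measures live on the ambient spaces, so the orthogonality relations are
  available only almost everywhere.\<close>

lemma AE_slice: "AE w in slice_measure. fst w \<in> hplane \<and> snd w \<in> vertical_space V r"
proof (rule HV.AE_pair_measure)
  have [measurable]: "hplane \<in> sets borel" "vertical_space V r \<in> sets borel"
    using closed_subspace[OF subspace_hplane] closed_subspace[OF subspace_vertical] by auto
  show "{w \<in> space slice_measure. fst w \<in> hplane \<and> snd w \<in> vertical_space V r} \<in> sets slice_measure"
    by measurable
  show "AE z in subspace_lborel hplane. AE \<sigma> in vert_measure.
      fst (z, \<sigma>) \<in> hplane \<and> snd (z, \<sigma>) \<in> vertical_space V r"
    using AE_subspace_lborel[OF subspace_hplane] AE_subspace_lborel[OF subspace_vertical] by auto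
qed

lemma nn_integral_slice_measure:
  assumes "f \<in> borel_measurable slice_measure"
  shows "(\<integral>\<^sup>+w. f w \<partial>slice_measure) =
    (\<integral>\<^sup>+z. \<integral>\<^sup>+\<sigma>. f (z, \<sigma>) \<partial>vert_measure \<partial>subspace_lborel hplane)"
  using HV.M2.nn_integral_fst[OF assms] by simp

lemma slice_measure_gaussian:
  "(\<integral>\<^sup>+w. gaussian_weight (slice_point a w) \<partial>slice_measure) =
    gaussian_weight a * ennreal (sqrt (2 * pi)) ^ (dim hplane + dim (vertical_space V r))"
proof -
  have "(\<integral>\<^sup>+w. gaussian_weight (slice_point a w) \<partial>slice_measure) =
      (\<integral>\<^sup>+w. gaussian_weight a * (gaussian_weight (fst w) * gaussian_weight (snd w)) \<partial>slice_measure)"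
  proof (rule nn_integral_cong_AE, use AE_slice in eventually_elim)
    case (elim w)
    show ?case
      by (simp add: gaussian_weight_def norm_slice_point[OF elim[THEN conjunct1] elim[THEN conjunct2]]
        add_divide_distrib flip: ennreal_mult' exp_add)
  qed
  also have "\<dots> = gaussian_weight a * (\<integral>\<^sup>+w. gaussian_weight (fst w) * gaussian_weight (snd w) \<partial>slice_measure)"
    by (rule nn_integral_cmult) measurable
  also have "(\<integral>\<^sup>+w. gaussian_weight (fst w) * gaussian_weight (snd w) \<partial>slice_measure) =
      ennreal (sqrt (2 * pi)) ^ (dim hplane + dim (vertical_space V r))"
    by (subst nn_integral_slice_measure)
       (simp_all add: nn_integral_cmult nn_integral_multc subspace_lborel_gaussian[OF subspace_hplane]
         subspace_lborel_gaussian[OF subspace_vertical] power_add)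
  finally show ?thesis .
qed

text \<open>The bases behind the two subspace measures are unspecified, so no explicit change of
  basis is written down. Instead the image measure is shown to be translation invariant with the
  Gaussian integral of Lebesgue measure, which characterises the latter.\<close>

lemma lborel_slices: "distr (lborel \<Otimes>\<^sub>M slice_measure) borel (\<lambda>q. slice_point (fst q) (snd q)) = lborel"
  (is "?M = _")
proof (rule translation_invariant_eq_lborel)
  note [measurable] = slice_point_measurable
  have int: "(\<integral>\<^sup>+x. f x \<partial>?M) = (\<integral>\<^sup>+a. \<integral>\<^sup>+w. f (slice_point a w) \<partial>slice_measure \<partial>lborel)"
    if [measurable]: "f \<in> borel_measurable borel" for f
  proof -
    have "(\<integral>\<^sup>+x. f x \<partial>?M) = (\<integral>\<^sup>+q. f (slice_point (fst q) (snd q)) \<partial>(lborel \<Otimes>\<^sub>M slice_measure))"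
      by (rule nn_integral_distr) measurable
    then show ?thesis
      using nn_integral_slice_fst[OF measurable_compose[OF slice_point_measurable that]] by simp
  qed
  show "(\<integral>\<^sup>+x. f (x + v) \<partial>?M) = (\<integral>\<^sup>+x. f x \<partial>?M)" if f[measurable]: "f \<in> borel_measurable borel" for f v
  proof -
    \<comment> \<open>The components of \<open>v\<close>: translation by \<open>v\<close> shifts
      height, hyperplane part and vertical part separately, and each factor measure is invariant
      under its own shift.\<close>
    define \<alpha> where "\<alpha> = v \<bullet> dir"
    define z0 where "z0 = horizontal_coord e v - \<alpha> *\<^sub>R \<nu>"
    define \<sigma>0 where "\<sigma>0 = v - (\<Sum>i\<in>UNIV. (v \<bullet> e i) *\<^sub>R e i)"
    have \<sigma>0: "\<sigma>0 \<in> vertical_space V r"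
      unfolding \<sigma>0_def by (rule vertical_part)
    have z0: "z0 \<in> hplane"
      using inner_dir[of v] norm_dir_coord
      by (simp add: z0_def \<alpha>_def inner_diff_left inner_diff_right inner_commute norm_eq_1)
    have v: "v = \<alpha> *\<^sub>R dir + from_coord e z0 \<sigma>0"
      unfolding from_coord_eq by (simp add: z0_def \<sigma>0_def horizontal_coord_def)
    have shift: "slice_point a (z, \<sigma>) + v = slice_point (a + \<alpha>) (z + z0, \<sigma> + \<sigma>0)" for a z \<sigma>
      by (simp add: v slice_point_def from_coord_def scaleR_add_left sum.distrib)
    have meas: "(\<lambda>q. f (slice_point a q)) \<in> borel_measurable slice_measure" for a
      by measurable
    have meas1: "(\<lambda>\<sigma>. f (slice_point a (z, \<sigma>))) \<in> borel_measurable borel" for a z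
    proof -
      have "(\<lambda>\<sigma>. slice_point a (z, \<sigma>)) \<in> borel_measurable borel"
        unfolding slice_point_def from_coord_def
        by (intro borel_measurable_continuous_onI continuous_intros)
      from measurable_compose[OF this f] show ?thesis .
    qed
    have meas2: "(\<lambda>z. \<integral>\<^sup>+\<sigma>. f (slice_point a (z, \<sigma>)) \<partial>vert_measure) \<in> borel_measurable borel" for a
      using HV.M2.borel_measurable_nn_integral_fst[OF meas[of a]] by (simp cong: measurable_cong_sets add: sets_subspace_lborel)
    have slice: "(\<integral>\<^sup>+w. f (slice_point a w + v) \<partial>slice_measure) = (\<integral>\<^sup>+w. f (slice_point (a + \<alpha>) w) \<partial>slice_measure)" for a
    proof -
      have "(\<integral>\<^sup>+w. f (slice_point a w + v) \<partial>slice_measure) =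
          (\<integral>\<^sup>+z. \<integral>\<^sup>+\<sigma>. f (slice_point (a + \<alpha>) (z + z0, \<sigma> + \<sigma>0)) \<partial>vert_measure \<partial>subspace_lborel hplane)"
        by (subst nn_integral_slice_measure) (simp_all add: shift)
      also have "\<dots> = (\<integral>\<^sup>+z. \<integral>\<^sup>+\<sigma>. f (slice_point (a + \<alpha>) (z + z0, \<sigma>)) \<partial>vert_measure \<partial>subspace_lborel hplane)"
        by (intro nn_integral_cong subspace_lborel_translate[OF subspace_vertical \<sigma>0 meas1])
      also have "\<dots> = (\<integral>\<^sup>+z. \<integral>\<^sup>+\<sigma>. f (slice_point (a + \<alpha>) (z, \<sigma>)) \<partial>vert_measure \<partial>subspace_lborel hplane)"
        by (rule subspace_lborel_translate[OF subspace_hplane z0 meas2])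
      also have "\<dots> = (\<integral>\<^sup>+w. f (slice_point (a + \<alpha>) w) \<partial>slice_measure)"
        by (rule nn_integral_slice_measure[symmetric]) measurable
      finally show ?thesis .
    qed
    have "(\<integral>\<^sup>+x. f (x + v) \<partial>?M) = (\<integral>\<^sup>+a. \<integral>\<^sup>+w. f (slice_point a w + v) \<partial>slice_measure \<partial>lborel)"
      by (rule int) measurable
    also have "\<dots> = (\<integral>\<^sup>+a. \<integral>\<^sup>+w. f (slice_point (\<alpha> + 1 * a) w) \<partial>slice_measure \<partial>lborel)"
      by (simp only: slice) (simp add: add.commute)
    also have "\<dots> = (\<integral>\<^sup>+a. \<integral>\<^sup>+w. f (slice_point a w) \<partial>slice_measure \<partial>lborel)"
      using slice_fst_measurable[OF measurable_compose[OF slice_point_measurable f]]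
      by (subst nn_integral_real_affine[where c = 1 and t = \<alpha>]) simp_all
    also have "\<dots> = (\<integral>\<^sup>+x. f x \<partial>?M)"
      by (rule int[symmetric]) measurable
    finally show ?thesis .
  qed
  have "(\<integral>\<^sup>+x. gaussian_weight x \<partial>?M) =
      (\<integral>\<^sup>+a. gaussian_weight a * ennreal (sqrt (2 * pi)) ^ (dim hplane + dim (vertical_space V r)) \<partial>(lborel :: real measure))"
    by (subst int) (simp_all add: slice_measure_gaussian)
  also have "\<dots> = (\<integral>\<^sup>+a. gaussian_weight a \<partial>(lborel :: real measure)) * ennreal (sqrt (2 * pi)) ^ (dim hplane + dim (vertical_space V r))"
    by (rule nn_integral_multc) measurable
  also have "(\<integral>\<^sup>+a. gaussian_weight a \<partial>(lborel :: real measure)) = ennreal (sqrt (2 * pi))"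
    using nn_integral_gaussian_real by (simp add: gaussian_weight_def)
  also have "ennreal (sqrt (2 * pi)) * ennreal (sqrt (2 * pi)) ^ (dim hplane + dim (vertical_space V r)) =
      ennreal (sqrt (2 * pi)) ^ DIM('a)"
    by (simp add: dim_decomposition[symmetric])
  finally show "(\<integral>\<^sup>+x. gaussian_weight x \<partial>?M) = ennreal (sqrt (2 * pi)) ^ DIM('a)" .
qed simp

lemma nn_integral_slices:
  assumes f: "f \<in> borel_measurable borel"
  shows "(\<integral>\<^sup>+x. f x \<partial>lborel) = (\<integral>\<^sup>+a. \<integral>\<^sup>+w. f (slice_point a w) \<partial>slice_measure \<partial>lborel)"
proof -
  have "(\<integral>\<^sup>+x. f x \<partial>lborel) = (\<integral>\<^sup>+q. f (slice_point (fst q) (snd q)) \<partial>(lborel \<Otimes>\<^sub>M slice_measure))"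
    by (subst lborel_slices[symmetric]) (rule nn_integral_distr[OF slice_point_measurable], use f in simp)
  then show ?thesis
    using nn_integral_slice_fst[OF measurable_compose[OF slice_point_measurable f]] by simp
qed

lemma slice_integral_measurable [measurable]:
  assumes f: "f \<in> borel_measurable borel"
  shows "(\<lambda>a. \<integral>\<^sup>+w. f (slice_point a w) \<partial>slice_measure) \<in> borel_measurable borel"
  using slice_fst_measurable[OF measurable_compose[OF slice_point_measurable f]] by simp

end

section \<open>Relative invariance of the heat kernel\<close>

text \<open>The set where the functions differ is open and null, hence empty.\<close>

lemma continuous_AE_eq:
  fixes f g :: "'a::euclidean_space \<Rightarrow> real"
  assumes "continuous_on UNIV f" "continuous_on UNIV g" "AE x in lborel. f x = g x"
  shows "f x = g x"
proof -
  let ?S = "{x. f x \<noteq> g x}"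
  have "open ?S"
    using assms(1,2) by (intro open_Collect_neq)
  moreover have "?S \<in> null_sets lborel"
    using assms(3) \<open>open ?S\<close> by (subst AE_iff_null_sets) auto
  then have "negligible ?S"
    by (simp add: negligible_iff_null_sets null_sets_completionI)
  ultimately have "?S = {}"
    using open_not_negligible by blast
  then show ?thesis
    by blast
qed

text \<open>A set of full measure meets every interval to the right of \<open>a\<close>. This allows
  almost-everywhere identities to be used along a sequence tending to a prescribed point.\<close>

lemma AE_lborel_approach:
  fixes a :: real
  assumes "AE x in lborel. Q x"
  obtains s where "s \<longlonglongrightarrow> a" "\<And>n::nat. Q (s n)"
proof -
  have "\<exists>x. Q x \<and> x \<in> {a<..<a + 1 / real (Suc n)}" for n
  proof (rule ccontr)
    assume "\<not> ?thesis"
    then have "AE x in lborel. x \<notin> {a<..<a + 1 / real (Suc n)}"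
      by (intro eventually_mono[OF assms]) auto
    then have "{a<..<a + 1 / real (Suc n)} \<in> null_sets lborel"
      by (subst AE_iff_null_sets) auto
    then show False
      by auto
  qed
  then obtain s where s: "\<And>n. Q (s n)" "\<And>n. s n \<in> {a<..<a + 1 / real (Suc n)}"
    by metis
  have "s \<longlonglongrightarrow> a"
  proof (rule tendsto_sandwich[OF _ _ tendsto_const])
    show "(\<lambda>n. a + 1 / real (Suc n)) \<longlonglongrightarrow> a"
      by real_asymp
  qed (use s(2) in \<open>auto intro!: always_eventually less_imp_le\<close>)
  then show ?thesis
    using s(1) that by blast
qed

context carnot_heat
begin

lemma continuous_gmul_left: "continuous_on S (gmul h)"
  by (rule continuous_on_gmul[OF continuous_on_const continuous_on_id])

lemma gmul_measurable [measurable]: "gmul h \<in> borel_measurable borel"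
  by (intro borel_measurable_continuous_onI continuous_gmul_left)

text \<open>\<open>P_translate\<close> equates the two finite measures on test functions. Indicators
  of boxes are limits of test functions, and boxes form a generator closed under intersection, so
  the measures agree on all Borel sets.\<close>

lemma nn_integral_hk_translate:
  assumes t: "0 < t" and f: "f \<in> borel_measurable borel"
  shows "(\<integral>\<^sup>+y. ennreal (hk x y t) * f (gmul h y) \<partial>lborel) = (\<integral>\<^sup>+y. ennreal (hk (gmul h x) y t) * f y \<partial>lborel)"
proof -
  note [measurable] = borel_measurable_hk(1)[OF t] f
  let ?M = "distr (density lborel (\<lambda>y. ennreal (hk x y t))) borel (gmul h)"
  let ?N = "density lborel (\<lambda>y. ennreal (hk (gmul h x) y t))"
  have M: "emeasure ?M A = ennreal (LINT y|lborel. hk x y t * indicator A (gmul h y))" if [measurable]: "A \<in> sets borel" for A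
  proof -
    have "emeasure ?M A = (\<integral>\<^sup>+y. ennreal (hk x y t) * indicator (gmul h -` A) y \<partial>lborel)"
      using measurable_sets[OF gmul_measurable that] by (simp add: emeasure_distr emeasure_density)
    also have "\<dots> = (\<integral>\<^sup>+y. ennreal (hk x y t * indicator A (gmul h y)) \<partial>lborel)"
      by (intro nn_integral_cong) (simp add: indicator_def)
    also have "\<dots> = ennreal (LINT y|lborel. hk x y t * indicator A (gmul h y))"
      by (intro nn_integral_eq_integral integrable_hk_mult[OF t]) (auto simp: hk_nonneg[OF t])
    finally show ?thesis .
  qed
  have N: "emeasure ?N A = ennreal (LINT y|lborel. hk (gmul h x) y t * indicator A y)" if [measurable]: "A \<in> sets borel" for A
  proof -
    have "emeasure ?N A = (\<integral>\<^sup>+y. ennreal (hk (gmul h x) y t * indicator A y) \<partial>lborel)"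
      by (simp add: emeasure_density) (intro nn_integral_cong, simp add: indicator_def)
    also have "\<dots> = ennreal (LINT y|lborel. hk (gmul h x) y t * indicator A y)"
      by (intro nn_integral_eq_integral integrable_hk_mult[OF t]) (auto simp: hk_nonneg[OF t])
    finally show ?thesis .
  qed
  have "?M = ?N"
  proof (rule measure_eqI_generator_eq)
    let ?E = "range (\<lambda>(a, b). box a b :: 'a set)"
    show "Int_stable ?E"
      by (auto simp: Int_stable_def box_Int_box)
    show "?E \<subseteq> Pow UNIV" "sets ?M = sigma_sets UNIV ?E" "sets ?N = sigma_sets UNIV ?E"
      by (simp_all add: borel_eq_box)
    let ?A = "\<lambda>n::nat. box (- (real n *\<^sub>R One)) (real n *\<^sub>R One) :: 'a set"
    show "range ?A \<subseteq> ?E" "(\<Union>i. ?A i) = UNIV"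
      unfolding UN_box_eq_UNIV by auto
    show "emeasure ?M (?A i) \<noteq> \<infinity>" for i
      by (simp add: M)
    show "emeasure ?M X = emeasure ?N X" if X: "X \<in> ?E" for X
    proof -
      obtain l u where X: "X = box l u"
        using X by auto
      obtain F :: "nat \<Rightarrow> 'a \<Rightarrow> real" where F: "\<And>n. test_function (F n)" "\<And>n y. 0 \<le> F n y" "\<And>n y. F n y \<le> 1"
          "\<And>y. (\<lambda>n. F n y) \<longlonglongrightarrow> indicator (box l u) y"
        using box_indicator_limit[of l u] by metis
      have meas: "F n \<in> borel_measurable borel" for n
        by (intro borel_measurable_continuous_onI test_function_continuous F)
      have F1: "\<bar>F n y\<bar> \<le> 1" for n y
        using F(2,3) by simp
      have "(\<lambda>n. LINT y|lborel. hk x y t * F n (gmul h y)) \<longlonglongrightarrow> (LINT y|lborel. hk x y t * indicator (box l u) (gmul h y))"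
        by (rule hk_dominated_convergence[OF t]) (auto intro!: F measurable_compose[OF gmul_measurable] meas F1)
      moreover have "(LINT y|lborel. hk x y t * F n (gmul h y)) = (LINT y|lborel. hk (gmul h x) y t * F n y)" for n
        using integral_hk[OF t test_function_C0[OF test_function_translate[OF F(1)]]]
          integral_hk[OF t test_function_C0[OF F(1)]] P_translate[OF F(1) less_imp_le[OF t]] by simp
      moreover have "(\<lambda>n. LINT y|lborel. hk (gmul h x) y t * F n y) \<longlonglongrightarrow> (LINT y|lborel. hk (gmul h x) y t * indicator (box l u) y)"
        by (rule hk_dominated_convergence[OF t]) (auto intro!: F meas F1)
      ultimately have "(LINT y|lborel. hk x y t * indicator (box l u) (gmul h y)) =
          (LINT y|lborel. hk (gmul h x) y t * indicator (box l u) y)"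
        using LIMSEQ_unique by simp
      then show ?thesis
        by (simp add: X M N)
    qed
  qed
  moreover have "(\<integral>\<^sup>+y. f y \<partial>?M) = (\<integral>\<^sup>+y. ennreal (hk x y t) * f (gmul h y) \<partial>lborel)"
    by (subst nn_integral_distr) (auto simp: nn_integral_density)
  moreover have "(\<integral>\<^sup>+y. f y \<partial>?N) = (\<integral>\<^sup>+y. ennreal (hk (gmul h x) y t) * f y \<partial>lborel)"
    by (simp add: nn_integral_density)
  ultimately show ?thesis
    by simp
qed

text \<open>The ratio \<open>\<rho>\<close> is the density of the translated Lebesgue measure, so it does not depend on \<open>x\<close>;
  by the symmetry of the kernel it does not depend on \<open>y\<close> either. This avoids computing the Jacobian
  determinants of the translations (which are equal to 1).\<close>

lemma hk_relative_invariance: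
  assumes t: "0 < t"
  obtains \<rho> where "0 < \<rho>" "\<And>x y. hk (gmul h x) (gmul h y) t = \<rho> * hk x y t"
    "\<And>f. f \<in> borel_measurable borel \<Longrightarrow> (\<integral>\<^sup>+y. f (gmul h y) \<partial>lborel) = ennreal \<rho> * (\<integral>\<^sup>+y. f y \<partial>lborel)"
proof -
  define R where "R x y = hk (gmul h x) y t / hk x (gmul (- h) y) t" for x y
  have R_pos: "0 < R x y" for x y
    using hk_pos[OF t] by (simp add: R_def)
  have R_cont: "continuous_on UNIV (R x)" for x
    unfolding R_def using hk_pos[OF t]
    by (intro continuous_intros t continuous_gmul_left) (auto simp: less_imp_neq[symmetric])
  have R_meas [measurable]: "R x \<in> borel_measurable borel" for x
    by (rule borel_measurable_continuous_onI[OF R_cont])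
  have shift: "(\<integral>\<^sup>+y. f (gmul h y) \<partial>lborel) = (\<integral>\<^sup>+y. ennreal (R x y) * f y \<partial>lborel)"
    if f[measurable]: "f \<in> borel_measurable borel" for f x
  proof -
    note [measurable] = borel_measurable_hk(1)[OF t]
    \<comment> \<open>Putting the reciprocal of the kernel into the integrand cancels the kernel on
      the left, which turns invariance of the kernel into a formula for the translated Lebesgue
      measure.\<close>
    let ?f = "\<lambda>y. ennreal (1 / hk x (gmul (- h) y) t) * f y"
    have "ennreal (hk x y t) * ?f (gmul h y) = f (gmul h y)" for y
      using hk_pos[OF t, of x y] by (simp add: mult.assoc[symmetric] flip: ennreal_mult')
    then have "(\<integral>\<^sup>+y. f (gmul h y) \<partial>lborel) = (\<integral>\<^sup>+y. ennreal (hk x y t) * ?f (gmul h y) \<partial>lborel)"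
      by simp
    also have "\<dots> = (\<integral>\<^sup>+y. ennreal (hk (gmul h x) y t) * ?f y \<partial>lborel)"
      by (rule nn_integral_hk_translate[OF t]) measurable
    also have "\<dots> = (\<integral>\<^sup>+y. ennreal (R x y) * f y \<partial>lborel)"
      using hk_nonneg[OF t] by (simp add: R_def mult.assoc[symmetric] flip: ennreal_mult')
    finally show ?thesis .
  qed
  have R_eq: "R x y = R 0 y" for x y
  proof (rule continuous_AE_eq[OF R_cont R_cont])
    have "density lborel (\<lambda>y. ennreal (R x y)) = density lborel (\<lambda>y. ennreal (R 0 y))"
    proof (rule measure_eqI)
      fix A
      assume "A \<in> sets (density lborel (\<lambda>y. ennreal (R x y)))"
      then have "A \<in> sets borel"
        by simp
      then show "emeasure (density lborel (\<lambda>y. ennreal (R x y))) A = emeasure (density lborel (\<lambda>y. ennreal (R 0 y))) A"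
        using shift[of "indicator A" x] shift[of "indicator A" 0] by (simp add: emeasure_density)
    qed simp
    then have "AE y in lborel. ennreal (R x y) = ennreal (R 0 y)"
      by (intro sigma_finite_measure.density_unique[OF sigma_finite_lborel]) auto
    then show "AE y in lborel. R x y = R 0 y"
      using R_pos by (auto simp: less_imp_le elim!: eventually_mono)
  qed
  have inv: "hk (gmul h x) (gmul h y) t = R 0 (gmul h y) * hk x y t" for x y
    using hk_pos[OF t, of x y] by (simp add: R_eq[of x, symmetric]) (simp add: R_def)
  have const: "R 0 z = R 0 0" for z
  proof -
    have "R 0 (gmul h y) = R 0 (gmul h x)" for x y
      using inv[of x y] inv[of y x] hk_sym[OF t, of x y] hk_sym[OF t, of "gmul h x" "gmul h y"] hk_pos[OF t, of x y]
      by simp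
    from this[of "gmul (- h) z" "gmul (- h) 0"] show ?thesis
      by (simp only: gmul_minus_cancel)
  qed
  show ?thesis
  proof (rule that[of "R 0 0"])
    show "hk (gmul h x) (gmul h y) t = R 0 0 * hk x y t" for x y
      using inv const by metis
    show "(\<integral>\<^sup>+y. f (gmul h y) \<partial>lborel) = ennreal (R 0 0) * (\<integral>\<^sup>+y. f y \<partial>lborel)"
      if "f \<in> borel_measurable borel" for f
    proof -
      have "(\<integral>\<^sup>+y. f (gmul h y) \<partial>lborel) = (\<integral>\<^sup>+y. ennreal (R 0 0) * f y \<partial>lborel)"
        unfolding shift[OF that, of 0] by (subst const) (rule refl)
      then show ?thesis
        using that by (simp add: nn_integral_cmult)
    qed
  qed (rule R_pos)
qed

text \<open>One half of the Chapman--Kolmogorov equation, which suffices and holds at every point: approximate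
  the point mass at the origin and use Fatou's lemma.\<close>

lemma hk_chapman_kolmogorov_le:
  assumes s: "0 < s" and t: "0 < t"
  shows "(\<integral>\<^sup>+y. ennreal (hk x y s) * ennreal (hk y 0 t) \<partial>lborel) \<le> ennreal (hk x 0 (s + t))"
proof -
  define b :: "nat \<Rightarrow> 'a \<Rightarrow> real" where "b n y = bump 0 (real (Suc n) *\<^sub>R y)" for n y
  have b_cont: "continuous_on UNIV (b n)" for n
    unfolding b_def[abs_def]
    by (rule continuous_on_compose2[OF test_function_continuous[OF test_function_bump]]) (auto intro!: continuous_intros)
  have b_supp: "norm y \<le> 1 / real (Suc n)" if "b n y \<noteq> 0" for n y
  proof -
    have "real (Suc n) *\<^sub>R y \<in> cball 0 (real (Suc 0))"
      using that bump_support[of 0] unfolding b_def by blast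
    then show ?thesis
      by (simp add: field_simps del: of_nat_Suc)
  qed
  have b_nonneg: "0 \<le> b n y" for n y
    by (simp add: b_def bump_nonneg)
  have int: "integrable lborel (\<lambda>y. q y * b n y)" if q: "continuous_on UNIV q" for q n
  proof -
    have "integrable lborel (\<lambda>y. indicator (cball 0 1) y *\<^sub>R (q y * b n y))"
      by (intro borel_integrable_compact compact_cball continuous_on_mult continuous_on_subset[OF q] continuous_on_subset[OF b_cont]) auto
    moreover have "indicator (cball 0 1) y *\<^sub>R (q y * b n y) = q y * b n y" for y
    proof (cases "b n y = 0")
      case False
      have "norm y \<le> 1"
        using b_supp[OF False] by (rule order_trans) simp
      then show ?thesis
        by simp
    qed simp
    ultimately show ?thesis
      by (simp only:)
  qed
  define I where "I n = (LINT y|lborel. b n y)" for n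
  have I_int: "integrable lborel (b n)" for n
    using int[of "\<lambda>_. 1"] by simp
  have I_pos: "0 < I n" for n
  proof -
    have "I n \<noteq> 0"
    proof
      assume "I n = 0"
      then have "AE y in lborel. b n y = 0"
        using integral_nonneg_eq_0_iff_AE[OF I_int] b_nonneg by (simp add: I_def)
      then have "b n 0 = 0"
        by (rule continuous_AE_eq[OF b_cont continuous_on_const])
      then show False
        by (simp add: b_def bump_def flat_0_one)
    qed
    moreover have "0 \<le> I n"
      unfolding I_def using b_nonneg by (intro integral_nonneg_AE) auto
    ultimately show ?thesis
      by simp
  qed
  define f where "f n y = b n y / I n" for n y
  have f_C0: "f n \<in> C0_functions" for n
  proof -
    have "(b n \<longlongrightarrow> 0) at_infinity"
    proof (rule Lim_transform_eventually[OF tendsto_const])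
      have "b n y = 0" if "2 \<le> norm y" for y
        using b_supp[of n y] that order_trans[of 2 "1 / real (Suc n)" 1] by fastforce
      then show "\<forall>\<^sub>F y in at_infinity. 0 = b n y"
        by (auto simp: eventually_at_infinity intro!: exI[of _ 2])
    qed
    then have "b n \<in> C0_functions"
      using b_cont by (simp add: C0_functions_def)
    from C0_scale[OF this, of "1 / I n"] show ?thesis
      by (simp add: f_def[abs_def])
  qed
  have lim: "(\<lambda>n. LINT y|lborel. q y * f n y) \<longlonglongrightarrow> q 0" if q: "continuous_on UNIV q" for q :: "'a \<Rightarrow> real"
  proof (rule LIMSEQ_I)
    fix \<epsilon> :: real
    assume \<epsilon>: "0 < \<epsilon>"
    have "isCont q 0"
      using q by (simp add: continuous_on_eq_continuous_at)
    then obtain d where d: "0 < d" "\<And>y. norm y < d \<Longrightarrow> \<bar>q y - q 0\<bar> < \<epsilon> / 2"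
      using \<epsilon> unfolding continuous_at_eps_delta by (metis diff_zero dist_norm half_gt_zero real_norm_def)
    obtain N where N: "1 / real (Suc N) < d"
      using d(1) nat_approx_posE by blast
    have "\<bar>(LINT y|lborel. q y * f n y) - q 0\<bar> \<le> \<epsilon> / 2" if n: "N \<le> n" for n
    proof -
      have "(LINT y|lborel. q y * f n y) - q 0 = (LINT y|lborel. (q y - q 0) * b n y) / I n"
        using int[OF q, of n] I_int[of n] I_pos[of n]
        by (simp add: f_def left_diff_distrib I_def[symmetric] diff_divide_distrib)
      also have "\<bar>\<dots>\<bar> \<le> (LINT y|lborel. \<epsilon> / 2 * b n y) / I n"
      proof -
        have "norm (LINT y|lborel. (q y - q 0) * b n y) \<le> (LINT y|lborel. \<epsilon> / 2 * b n y)"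
        proof (rule Bochner_Integration.integral_norm_bound_integral)
          show "integrable lborel (\<lambda>y. (q y - q 0) * b n y)"
            by (intro int continuous_intros q)
          show "integrable lborel (\<lambda>y. \<epsilon> / 2 * b n y)"
            using I_int by simp
          fix y
          show "norm ((q y - q 0) * b n y) \<le> \<epsilon> / 2 * b n y"
          proof (cases "b n y = 0")
            case False
            have "norm y \<le> 1 / real (Suc N)"
              using b_supp[OF False] by (rule order_trans) (use n in \<open>simp add: frac_le\<close>)
            then have "\<bar>q y - q 0\<bar> \<le> \<epsilon> / 2"
              using d(2)[of y] N by simp
            from mult_right_mono[OF this b_nonneg[of n y]] show ?thesis
              by (simp add: abs_mult b_nonneg)
          qed simp
        qed
        from divide_right_mono[OF this less_imp_le[OF I_pos[of n]]] show ?thesis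
          using I_pos[of n] by (simp only: abs_divide abs_of_pos real_norm_def)
      qed
      also have "\<dots> = \<epsilon> / 2"
        using I_pos[of n] by (simp add: I_def)
      finally show ?thesis .
    qed
    then show "\<exists>N. \<forall>n\<ge>N. norm ((LINT y|lborel. q y * f n y) - q 0) < \<epsilon>"
      using \<epsilon> by (intro exI[of _ N]) (auto intro: le_less_trans[of _ "\<epsilon> / 2"])
  qed
  have f_nonneg: "0 \<le> f n y" for n y
    using b_nonneg I_pos by (simp add: f_def less_imp_le)
  have P_nonneg: "0 \<le> P t (f n) y" for n y
    unfolding integral_hk[OF t f_C0, symmetric] using hk_nonneg[OF t] f_nonneg by (intro integral_nonneg_AE) auto
  have P_meas: "P t (f n) \<in> borel_measurable borel" for n
    using P_C0[OF f_C0 less_imp_le[OF t]] by (intro borel_measurable_continuous_onI C0_continuous)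
  note [measurable] = borel_measurable_hk(1)[OF s]
  have P_lim: "(\<lambda>n. P t (f n) y) \<longlonglongrightarrow> hk y 0 t" for y
    unfolding integral_hk[OF t f_C0, symmetric] by (intro lim continuous_intros t)
  have P_int: "(\<integral>\<^sup>+y. ennreal (hk x y s * P t (f n) y) \<partial>lborel) = ennreal (P (s + t) (f n) x)" for n
  proof -
    have "has_bochner_integral lborel (\<lambda>y. hk x y s * P t (f n) y) (P s (P t (f n)) x)"
      by (rule has_bochner_integral_hk[OF s P_C0[OF f_C0 less_imp_le[OF t]]])
    then show ?thesis
      using s t hk_nonneg[OF s] P_nonneg
      by (subst nn_integral_eq_integral) (auto simp: has_bochner_integral_iff P_add[OF f_C0])
  qed
  have "(\<integral>\<^sup>+y. ennreal (hk x y s) * ennreal (hk y 0 t) \<partial>lborel) =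
      (\<integral>\<^sup>+y. liminf (\<lambda>n. ennreal (hk x y s * P t (f n) y)) \<partial>lborel)"
  proof (rule nn_integral_cong)
    fix y
    have "(\<lambda>n. ennreal (hk x y s * P t (f n) y)) \<longlonglongrightarrow> ennreal (hk x y s * hk y 0 t)"
      by (intro tendsto_ennrealI tendsto_mult_left P_lim)
    then show "ennreal (hk x y s) * ennreal (hk y 0 t) = liminf (\<lambda>n. ennreal (hk x y s * P t (f n) y))"
      using hk_nonneg[OF s] by (simp add: lim_imp_Liminf flip: ennreal_mult')
  qed
  also have "\<dots> \<le> liminf (\<lambda>n. \<integral>\<^sup>+y. ennreal (hk x y s * P t (f n) y) \<partial>lborel)"
    using P_meas by (intro nn_integral_liminf) simp
  also have "\<dots> = ennreal (hk x 0 (s + t))"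
    unfolding P_int
  proof (intro lim_imp_Liminf tendsto_ennrealI)
    show "(\<lambda>n. P (s + t) (f n) x) \<longlonglongrightarrow> hk x 0 (s + t)"
      unfolding integral_hk[OF add_pos_pos[OF s t] f_C0, symmetric]
      by (intro lim continuous_intros add_pos_pos s t)
  qed simp
  finally show ?thesis .
qed

end

section \<open>The density at the hyperplane\<close>

context carnot_heat_direction
begin

definition slice_integral :: "('a \<Rightarrow> real) \<Rightarrow> real \<Rightarrow> ennreal" where
  "slice_integral k a = (\<integral>\<^sup>+w. ennreal (k (slice_point a w)) \<partial>slice_measure)"

lemma slice_integral_measurable' [measurable]:
  "k \<in> borel_measurable borel \<Longrightarrow> slice_integral k \<in> borel_measurable borel"
  unfolding slice_integral_def[abs_def] by (rule slice_integral_measurable) simp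

text \<open>The indicator depends on the height alone and leaves the inner integral. So
  \<open>slice_integral k\<close> is a density of the image of the measure with density
  \<open>k\<close> under \<open>\<lambda>x. x \<bullet> dir\<close>.\<close>

lemma nn_integral_slice_integral:
  assumes k: "k \<in> borel_measurable borel" and A: "A \<in> sets borel"
  shows "(\<integral>\<^sup>+a. slice_integral k a * indicator A a \<partial>lborel) = (\<integral>\<^sup>+x. ennreal (k x) * indicator A (x \<bullet> dir) \<partial>lborel)"
proof -
  note [measurable] = k A
  have "(\<integral>\<^sup>+x. ennreal (k x) * indicator A (x \<bullet> dir) \<partial>lborel) =
      (\<integral>\<^sup>+a. \<integral>\<^sup>+w. ennreal (k (slice_point a w)) * indicator A (slice_point a w \<bullet> dir) \<partial>slice_measure \<partial>lborel)"
    by (rule nn_integral_slices) measurable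
  also have "\<dots> = (\<integral>\<^sup>+a. slice_integral k a * indicator A a \<partial>lborel)"
  proof (rule nn_integral_cong)
    fix a
    have "(\<integral>\<^sup>+w. ennreal (k (slice_point a w)) * indicator A (slice_point a w \<bullet> dir) \<partial>slice_measure) =
        (\<integral>\<^sup>+w. ennreal (k (slice_point a w)) * indicator A a \<partial>slice_measure)"
    proof (rule nn_integral_cong_AE, use AE_slice in eventually_elim)
      case (elim w)
      show ?case
        by (simp only: inner_slice_point[OF elim[THEN conjunct1] elim[THEN conjunct2]])
    qed
    also have "\<dots> = slice_integral k a * indicator A a"
      unfolding slice_integral_def by (rule nn_integral_multc) measurable
    finally show "(\<integral>\<^sup>+w. ennreal (k (slice_point a w)) * indicator A (slice_point a w \<bullet> dir) \<partial>slice_measure) =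
        slice_integral k a * indicator A a" .
  qed
  finally show ?thesis ..
qed

lemma continuous_on_slice_point: "continuous_on S (\<lambda>a. slice_point a w)"
  unfolding slice_point_def by (intro continuous_intros)

lemma slice_integral_tendsto:
  assumes cont: "continuous_on UNIV k" and K: "compact K" "{x. k x \<noteq> 0} \<subseteq> K"
    and s: "s \<longlonglongrightarrow> a"
  shows "(\<lambda>n. slice_integral k (s n)) \<longlonglongrightarrow> slice_integral k a"
proof -
  obtain R where R: "\<And>x. x \<in> K \<Longrightarrow> norm x \<le> R"
    using compact_imp_bounded[OF K(1)] by (auto simp: bounded_iff)
  have "bounded (k ` K)"
    by (intro compact_imp_bounded compact_continuous_image continuous_on_subset[OF cont] K(1)) simp
  then obtain B where B: "\<And>x. x \<in> K \<Longrightarrow> \<bar>k x\<bar> \<le> B"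
    by (auto simp: bounded_iff)
  have B0: "k x \<le> max 0 B" for x
    using B[of x] K(2) by (cases "k x = 0") auto
  have [measurable]: "k \<in> borel_measurable borel"
    by (rule borel_measurable_continuous_onI[OF cont])
  \<comment> \<open>A bound for \<open>k\<close>, divided by the lower bound
    \<open>exp (- R\<^sup>2 / 2)\<close> of the Gaussian weight on the ball of radius
    \<open>R\<close>.\<close>
  let ?c = "ennreal (max 0 B * exp (R\<^sup>2 / 2))"
  show ?thesis
    unfolding slice_integral_def
  proof (rule nn_integral_dominated_convergence[where w = "\<lambda>w. ?c * gaussian_weight (slice_point 0 w)"])
    show "AE w in slice_measure. ennreal (k (slice_point (s n) w)) \<le> ?c * gaussian_weight (slice_point 0 w)" for n
      using AE_slice
    proof eventually_elim
      case (elim w)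
      note w = elim[THEN conjunct1] elim[THEN conjunct2]
      show ?case
      proof (cases "k (slice_point (s n) w) = 0")
        case False
        then have "norm (slice_point (s n) w) \<le> R"
          using K(2) R by blast
        then have "(norm (slice_point (s n) w))\<^sup>2 \<le> R\<^sup>2"
          by (intro power_mono) auto
        then have "(norm (slice_point 0 w))\<^sup>2 \<le> R\<^sup>2"
          using zero_le_power2[of "s n"] unfolding norm_slice_point[OF w] power_zero_numeral by linarith
        then have "1 \<le> exp (R\<^sup>2 / 2) * exp (- (norm (slice_point 0 w))\<^sup>2 / 2)"
          by (simp flip: exp_add)
        then have "max 0 B * 1 \<le> max 0 B * (exp (R\<^sup>2 / 2) * exp (- (norm (slice_point 0 w))\<^sup>2 / 2))"
          by (rule mult_left_mono) simp
        then have "k (slice_point (s n) w) \<le> max 0 B * exp (R\<^sup>2 / 2) * exp (- (norm (slice_point 0 w))\<^sup>2 / 2)"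
          using B0[of "slice_point (s n) w"] by (simp add: mult.assoc)
        then show ?thesis
          by (simp add: gaussian_weight_def ennreal_leI flip: ennreal_mult')
      qed simp
    qed
    have "(\<integral>\<^sup>+w. ?c * gaussian_weight (slice_point 0 w) \<partial>slice_measure) =
        ?c * (gaussian_weight (0::real) * ennreal (sqrt (2 * pi)) ^ (dim hplane + dim (vertical_space V r)))"
      unfolding slice_measure_gaussian[symmetric] by (rule nn_integral_cmult) measurable
    also have "\<dots> < \<infinity>"
      by (simp add: gaussian_weight_def ennreal_power ennreal_mult_less_top)
    finally show "(\<integral>\<^sup>+w. ?c * gaussian_weight (slice_point 0 w) \<partial>slice_measure) < \<infinity>" .
    show "AE w in slice_measure. (\<lambda>n. ennreal (k (slice_point (s n) w))) \<longlonglongrightarrow> ennreal (k (slice_point a w))"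
    proof (rule AE_I2)
      fix w
      have "continuous_on UNIV (\<lambda>a. k (slice_point a w))"
        by (rule continuous_on_compose2[OF cont continuous_on_slice_point]) simp
      then have "(\<lambda>n. k (slice_point (s n) w)) \<longlonglongrightarrow> k (slice_point a w)"
        by (rule continuous_on_tendsto_compose[OF _ s]) auto
      then show "(\<lambda>n. ennreal (k (slice_point (s n) w))) \<longlonglongrightarrow> ennreal (k (slice_point a w))"
        by (rule tendsto_ennrealI)
    qed
  qed measurable
qed

text \<open>Translation by \<open>h\<close> raises the height by \<open>h \<bullet> dir\<close>, so
  both sides are densities of the same measure and agree almost everywhere; both are continuous in
  \<open>a\<close>, so they agree everywhere.\<close>

lemma slice_integral_translate_compact:
  assumes cont: "continuous_on UNIV k" and K: "compact K" "{x. k x \<noteq> 0} \<subseteq> K"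
    and \<rho>: "\<And>f. f \<in> borel_measurable borel \<Longrightarrow> (\<integral>\<^sup>+y. f (gmul h y) \<partial>lborel) = ennreal \<rho> * (\<integral>\<^sup>+y. f y \<partial>lborel)"
  shows "slice_integral (\<lambda>x. k (gmul h x)) a = ennreal \<rho> * slice_integral k (a + h \<bullet> dir)"
proof -
  let ?k = "\<lambda>x. k (gmul h x)" and ?b = "h \<bullet> dir"
  have [measurable]: "k \<in> borel_measurable borel"
    by (rule borel_measurable_continuous_onI[OF cont])
  have "density lborel (slice_integral ?k) = density lborel (\<lambda>a. ennreal \<rho> * slice_integral k (a + ?b))"
  proof (rule measure_eqI)
    fix A
    assume "A \<in> sets (density lborel (slice_integral ?k))"
    then have A[measurable]: "A \<in> sets borel"
      by simp
    let ?A = "{x. x - ?b \<in> A}"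
    have A'[measurable]: "?A \<in> sets borel"
      by measurable
    have "emeasure (density lborel (slice_integral ?k)) A = (\<integral>\<^sup>+x. ennreal (?k x) * indicator A (x \<bullet> dir) \<partial>lborel)"
      by (simp add: emeasure_density nn_integral_slice_integral)
    also have "\<dots> = (\<integral>\<^sup>+x. ennreal (k (gmul h x)) * indicator ?A (gmul h x \<bullet> dir) \<partial>lborel)"
      by (intro nn_integral_cong) (simp add: gmul_inner_dir indicator_def)
    also have "\<dots> = ennreal \<rho> * (\<integral>\<^sup>+x. ennreal (k x) * indicator ?A (x \<bullet> dir) \<partial>lborel)"
      by (rule \<rho>) measurable
    also have "(\<integral>\<^sup>+x. ennreal (k x) * indicator ?A (x \<bullet> dir) \<partial>lborel) = (\<integral>\<^sup>+a. slice_integral k a * indicator ?A a \<partial>lborel)"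
      by (rule nn_integral_slice_integral[symmetric]) measurable
    also have "\<dots> = (\<integral>\<^sup>+a. slice_integral k (a + ?b) * indicator A a \<partial>lborel)"
      by (subst nn_integral_real_affine[where c = 1 and t = ?b]) (auto simp: indicator_def add.commute intro!: nn_integral_cong)
    also have "ennreal \<rho> * \<dots> = (\<integral>\<^sup>+a. ennreal \<rho> * slice_integral k (a + ?b) * indicator A a \<partial>lborel)"
      by (simp add: nn_integral_cmult[symmetric] mult.assoc)
    also have "\<dots> = emeasure (density lborel (\<lambda>a. ennreal \<rho> * slice_integral k (a + ?b))) A"
      by (simp add: emeasure_density)
    finally show "emeasure (density lborel (slice_integral ?k)) A =
        emeasure (density lborel (\<lambda>a. ennreal \<rho> * slice_integral k (a + ?b))) A" .
  qed simp
  then have "AE a in lborel. slice_integral ?k a = ennreal \<rho> * slice_integral k (a + ?b)"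
    by (intro sigma_finite_measure.density_unique[OF sigma_finite_lborel]) auto
  then obtain s where s: "s \<longlonglongrightarrow> a" "\<And>n. slice_integral ?k (s n) = ennreal \<rho> * slice_integral k (s n + ?b)"
    using AE_lborel_approach by blast
  have "(\<lambda>n. slice_integral ?k (s n)) \<longlonglongrightarrow> slice_integral ?k a"
  proof (rule slice_integral_tendsto[OF _ compact_translate[OF K(1), of "- h"] _ s(1)])
    show "continuous_on UNIV ?k"
      by (rule continuous_on_compose2[OF cont continuous_gmul_left]) simp
    show "{x. ?k x \<noteq> 0} \<subseteq> gmul (- h) ` K"
    proof
      fix x
      assume "x \<in> {x. ?k x \<noteq> 0}"
      then have "gmul h x \<in> K"
        using K(2) by blast
      then show "x \<in> gmul (- h) ` K"
        by (rule image_eqI[rotated]) simp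
    qed
  qed
  moreover have "(\<lambda>n. ennreal \<rho> * slice_integral k (s n + ?b)) \<longlonglongrightarrow> ennreal \<rho> * slice_integral k (a + ?b)"
    by (intro ennreal_tendsto_cmult slice_integral_tendsto[OF cont K] tendsto_intros s) simp
  ultimately show ?thesis
    using LIMSEQ_unique s(2) by simp
qed

text \<open>The cut-off is composed with \<open>g\<close> as well, so that with a translation or the
  identity for \<open>g\<close> it moves along with \<open>k\<close>, as both sides of the
  translation formula require.\<close>

lemma slice_integral_increasing:
  assumes "continuous_on UNIV k" "\<And>x. 0 \<le> k x" "g \<in> borel_measurable borel"
  shows "(\<lambda>n. slice_integral (\<lambda>x. k (g x) * bump n (g x)) a) \<longlonglongrightarrow> slice_integral (\<lambda>x. k (g x)) a"
  unfolding slice_integral_def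
proof (rule nn_integral_LIMSEQ)
  note g = measurable_compose[OF slice_point_measurable' assms(3)]
  show "incseq (\<lambda>n w. ennreal (k (g (slice_point a w)) * bump n (g (slice_point a w))))"
    by (auto simp: incseq_def le_fun_def assms(2) intro!: ennreal_leI mult_left_mono bump_mono)
  show "(\<lambda>w. ennreal (k (g (slice_point a w)) * bump n (g (slice_point a w)))) \<in> borel_measurable slice_measure" for n
    by (intro measurable_compose[OF _ measurable_ennreal] borel_measurable_times measurable_compose[OF g]
      borel_measurable_continuous_onI[OF assms(1)] smooth_on_measurable[OF smooth_on_bump])
  show "(\<lambda>n. ennreal (k (g (slice_point a w)) * bump n (g (slice_point a w)))) \<longlonglongrightarrow> ennreal (k (g (slice_point a w)))" for w
    using tendsto_ennrealI[OF tendsto_mult_left[OF tendsto_bump, of "k (g (slice_point a w))" "g (slice_point a w)"]] by simp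
qed

lemma slice_integral_translate:
  assumes cont: "continuous_on UNIV k" and nonneg: "\<And>x. 0 \<le> k x"
    and \<rho>: "\<And>f. f \<in> borel_measurable borel \<Longrightarrow> (\<integral>\<^sup>+y. f (gmul h y) \<partial>lborel) = ennreal \<rho> * (\<integral>\<^sup>+y. f y \<partial>lborel)"
  shows "slice_integral (\<lambda>x. k (gmul h x)) a = ennreal \<rho> * slice_integral k (a + h \<bullet> dir)"
proof (rule LIMSEQ_unique[OF slice_integral_increasing[OF cont nonneg gmul_measurable]])
  have "slice_integral (\<lambda>x. k (gmul h x) * bump n (gmul h x)) a =
      ennreal \<rho> * slice_integral (\<lambda>x. k x * bump n x) (a + h \<bullet> dir)" for n
    using bump_support[of n]
    by (intro slice_integral_translate_compact[OF _ compact_cball[of 0 "real (Suc n)"] _ \<rho>, where k = "\<lambda>x. k x * bump n x"]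
      continuous_on_mult cont test_function_continuous[OF test_function_bump])
      (auto simp: nonneg bump_nonneg)
  moreover have "(\<lambda>n. ennreal \<rho> * slice_integral (\<lambda>x. k x * bump n x) (a + h \<bullet> dir))
      \<longlonglongrightarrow> ennreal \<rho> * slice_integral k (a + h \<bullet> dir)"
    using slice_integral_increasing[OF cont nonneg, of "\<lambda>x. x"] by (intro ennreal_tendsto_cmult) auto
  ultimately show "(\<lambda>n. slice_integral (\<lambda>x. k (gmul h x) * bump n (gmul h x)) a)
      \<longlonglongrightarrow> ennreal \<rho> * slice_integral k (a + h \<bullet> dir)"
    by simp
qed

section \<open>Slices of the heat kernel\<close>

definition heat_slice :: "real \<Rightarrow> real \<Rightarrow> ennreal" where
  "heat_slice t a = slice_integral (\<lambda>x. hk x 0 t) a"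

lemma heat_slice_measurable [measurable]: "0 < t \<Longrightarrow> heat_slice t \<in> borel_measurable borel"
  unfolding heat_slice_def[abs_def] by (intro slice_integral_measurable' borel_measurable_hk)

text \<open>The same factor \<open>\<rho>\<close> arises from the change of variables and from the
  relative invariance of the kernel; being positive and finite, it cancels.\<close>

lemma heat_slice_translate:
  assumes t: "0 < t"
  shows "slice_integral (\<lambda>x. hk x h t) 0 = heat_slice t (- (h \<bullet> dir))"
proof -
  obtain \<rho> where \<rho>: "0 < \<rho>" "\<And>x y. hk (gmul h x) (gmul h y) t = \<rho> * hk x y t"
    "\<And>f. f \<in> borel_measurable borel \<Longrightarrow> (\<integral>\<^sup>+y. f (gmul h y) \<partial>lborel) = ennreal \<rho> * (\<integral>\<^sup>+y. f y \<partial>lborel)"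
    using hk_relative_invariance[OF t, of h] by metis
  note [measurable] = borel_measurable_hk(2)[OF t]
  have "ennreal \<rho> * slice_integral (\<lambda>x. hk x h t) 0 = slice_integral (\<lambda>x. hk (gmul h x) h t) (- (h \<bullet> dir))"
    using slice_integral_translate[of "\<lambda>x. hk x h t" h \<rho> "- (h \<bullet> dir)"] hk_nonneg[OF t] \<rho>(3)
    by (simp add: continuous_on_hk[OF t continuous_on_id continuous_on_const])
  also have "\<dots> = slice_integral (\<lambda>x. \<rho> * hk x 0 t) (- (h \<bullet> dir))"
    using \<rho>(2)[of _ 0] by simp
  also have "\<dots> = ennreal \<rho> * heat_slice t (- (h \<bullet> dir))"
    using \<rho>(1) by (simp add: heat_slice_def slice_integral_def ennreal_mult' nn_integral_cmult)
  finally show ?thesis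
    using \<rho>(1) by (simp add: ennreal_mult_cancel_left)
qed

abbreviation gauss :: "real \<Rightarrow> real \<Rightarrow> real" where
  "gauss t \<equiv> normal_density 0 (sqrt (2 * t))"

lemma AE_heat_slice:
  assumes t: "0 < t"
  shows "AE a in lborel. heat_slice t a = ennreal (gauss t a)"
proof -
  note [measurable] = borel_measurable_hk[OF t] heat_slice_measurable[OF t]
  have "density lborel (heat_slice t) = law t"
  proof (rule measure_eqI)
    fix A
    assume "A \<in> sets (density lborel (heat_slice t))"
    then have A[measurable]: "A \<in> sets borel"
      by simp
    have "emeasure (density lborel (heat_slice t)) A = (\<integral>\<^sup>+x. ennreal (hk x 0 t) * indicator A (x \<bullet> dir) \<partial>lborel)"
      using nn_integral_slice_integral[of "\<lambda>x. hk x 0 t" A] by (simp add: emeasure_density heat_slice_def)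
    also have "\<dots> = (\<integral>\<^sup>+x. ennreal (hk 0 x t) * indicator ((\<lambda>x. x \<bullet> dir) -` A) x \<partial>lborel)"
      by (intro nn_integral_cong) (simp add: hk_sym[OF t, of 0] indicator_def)
    also have "\<dots> = emeasure (law t) A"
      using measurable_sets[of "\<lambda>x. x \<bullet> dir" borel borel A]
      by (simp add: law_def emeasure_distr emeasure_density)
    finally show "emeasure (density lborel (heat_slice t)) A = emeasure (law t) A" .
  qed (simp add: law_def)
  then show ?thesis
    unfolding law_eq[OF t]
    by (intro sigma_finite_measure.density_unique[OF sigma_finite_lborel]) auto
qed

lemma heat_slice_le:
  assumes t: "0 < t"
  shows "heat_slice t 0 \<le> ennreal (gauss t 0)"
proof -
  note [measurable] = borel_measurable_hk[OF t]
  \<comment> \<open>Heights tending to 0 at which the almost-everywhere identity holds; by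
    continuity of the kernel the integrands at these heights converge pointwise to the one at height
    0, as Fatou's lemma requires.\<close>
  obtain s where s: "s \<longlonglongrightarrow> 0" "\<And>n. heat_slice t (s n) = ennreal (gauss t (s n))"
    using AE_lborel_approach[OF AE_heat_slice[OF t]] by blast
  have "heat_slice t 0 = (\<integral>\<^sup>+w. liminf (\<lambda>n. ennreal (hk (slice_point (s n) w) 0 t)) \<partial>slice_measure)"
    unfolding heat_slice_def slice_integral_def
  proof (rule nn_integral_cong)
    fix w
    have "continuous_on UNIV (\<lambda>a. hk (slice_point a w) 0 t)"
      by (intro continuous_on_hk t continuous_on_slice_point continuous_on_const)
    then have "(\<lambda>n. hk (slice_point (s n) w) 0 t) \<longlonglongrightarrow> hk (slice_point 0 w) 0 t"
      by (rule continuous_on_tendsto_compose[OF _ s(1)]) auto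
    then show "ennreal (hk (slice_point 0 w) 0 t) = liminf (\<lambda>n. ennreal (hk (slice_point (s n) w) 0 t))"
      by (intro lim_imp_Liminf[symmetric] tendsto_ennrealI) simp
  qed
  also have "\<dots> \<le> liminf (\<lambda>n. \<integral>\<^sup>+w. ennreal (hk (slice_point (s n) w) 0 t) \<partial>slice_measure)"
    by (rule nn_integral_liminf) measurable
  also have "\<dots> = liminf (\<lambda>n. ennreal (gauss t (s n)))"
    by (simp add: s(2)[symmetric] heat_slice_def slice_integral_def)
  also have "\<dots> = ennreal (gauss t 0)"
  proof (intro lim_imp_Liminf tendsto_ennrealI)
    have "isCont (gauss t) 0"
      unfolding normal_density_def[abs_def] by (intro continuous_intros) (use t in auto)
    then show "(\<lambda>n. gauss t (s n)) \<longlonglongrightarrow> gauss t 0"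
      by (rule isCont_tendsto_compose[OF _ s(1)])
  qed simp
  finally show ?thesis .
qed

lemma heat_slice_ge:
  assumes t: "0 < t"
  shows "ennreal (gauss (t + t) 0) \<le> heat_slice (t + t) 0"
proof -
  note [measurable] = borel_measurable_hk[OF t] heat_slice_measurable[OF t]
  interpret L: pair_sigma_finite slice_measure "lborel :: 'a measure"
    by (intro pair_sigma_finite.intro HV.sigma_finite_measure_axioms sigma_finite_lborel)
  have meas: "(\<lambda>(w, g). ennreal (hk (slice_point 0 w) g t) * ennreal (hk g 0 t))
      \<in> borel_measurable (slice_measure \<Otimes>\<^sub>M lborel)"
  proof -
    have "(\<lambda>q. hk (fst q) (snd q) t) \<in> borel_measurable (borel :: ('a \<times> 'a) measure)"
      by (intro borel_measurable_continuous_onI continuous_intros t)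
    then have [measurable]: "(\<lambda>q. hk (fst q) (snd q) t) \<in> borel_measurable (borel \<Otimes>\<^sub>M borel)"
      by (simp add: borel_prod)
    have "(\<lambda>q. (slice_point 0 (fst q), snd q)) \<in> slice_measure \<Otimes>\<^sub>M lborel \<rightarrow>\<^sub>M borel \<Otimes>\<^sub>M borel"
      by measurable
    from measurable_compose[OF this \<open>(\<lambda>q. hk (fst q) (snd q) t) \<in> borel_measurable (borel \<Otimes>\<^sub>M borel)\<close>]
    have [measurable]: "(\<lambda>q. hk (slice_point 0 (fst q)) (snd q) t) \<in> borel_measurable (slice_measure \<Otimes>\<^sub>M lborel)"
      by simp
    show ?thesis
      unfolding case_prod_beta by measurable
  qed
  have "ennreal (gauss (t + t) 0) = (\<integral>\<^sup>+a. ennreal (gauss t (0 - a) * gauss t a) \<partial>lborel)"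
    using fun_cong[OF conv_normal_density_zero_mean[of "sqrt (2 * t)" "sqrt (2 * t)"], of 0] t by simp
  \<comment> \<open>One Gaussian factor of the convolution is replaced by the slice density, which
    it equals almost everywhere; reflection preserves null sets.\<close>
  also have "\<dots> = (\<integral>\<^sup>+a. ennreal (gauss t a) * heat_slice t (- a) \<partial>lborel)"
  proof (rule nn_integral_cong_AE)
    have "AE a in lborel. heat_slice t (0 + (- 1) * a) = ennreal (gauss t (0 + (- 1) * a))"
      by (rule AE_borel_affine[OF _ _ AE_heat_slice[OF t]]) auto
    then show "AE a in lborel. ennreal (gauss t (0 - a) * gauss t a) = ennreal (gauss t a) * heat_slice t (- a)"
      by eventually_elim (simp add: ennreal_mult' mult.commute)
  qed
  also have "\<dots> = (\<integral>\<^sup>+a. heat_slice t (- a) \<partial>law t)"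
    unfolding law_eq[OF t] by (simp add: nn_integral_density)
  also have "\<dots> = (\<integral>\<^sup>+g. ennreal (hk 0 g t) * heat_slice t (- (g \<bullet> dir)) \<partial>lborel)"
    unfolding law_def by (subst nn_integral_distr) (auto simp: nn_integral_density)
  \<comment> \<open>The slice density at height \<open>- (g \<bullet> dir)\<close> is the integral
    over the central slice of the kernel with pole \<open>g\<close>. The two kernels can now be
    composed at the intermediate point \<open>g\<close>.\<close>
  also have "\<dots> = (\<integral>\<^sup>+g. \<integral>\<^sup>+w. ennreal (hk (slice_point 0 w) g t) * ennreal (hk g 0 t) \<partial>slice_measure \<partial>lborel)"
    by (intro nn_integral_cong)
       (simp add: heat_slice_translate[OF t, symmetric] slice_integral_def hk_sym[OF t, of 0] nn_integral_cmult mult.commute)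
  also have "\<dots> = (\<integral>\<^sup>+w. \<integral>\<^sup>+g. ennreal (hk (slice_point 0 w) g t) * ennreal (hk g 0 t) \<partial>lborel \<partial>slice_measure)"
    by (rule L.Fubini'[OF meas])
  also have "\<dots> \<le> (\<integral>\<^sup>+w. ennreal (hk (slice_point 0 w) 0 (t + t)) \<partial>slice_measure)"
    by (intro nn_integral_mono hk_chapman_kolmogorov_le t)
  also have "\<dots> = heat_slice (t + t) 0"
    by (simp add: heat_slice_def slice_integral_def)
  finally show ?thesis .
qed

lemma heat_slice_0:
  assumes t: "0 < t"
  shows "heat_slice t 0 = ennreal (1 / sqrt (4 * pi * t))"
proof -
  \<comment> \<open>The lower bound concerns doubled times, so it is applied to
    \<open>t / 2\<close>.\<close>
  have "heat_slice t 0 = ennreal (gauss t 0)"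
    using heat_slice_le[OF t] heat_slice_ge[of "t / 2"] t by (intro antisym) auto
  then show ?thesis
    using t by (simp add: normal_density_def mult.commute mult.left_commute)
qed

lemma integral_slice:
  assumes t: "0 < t"
  shows "(LINT w|slice_measure. hk (from_coord e (fst w) (snd w)) 0 t) = 1 / sqrt (4 * pi * t)"
proof -
  note [measurable] = borel_measurable_hk[OF t]
  have "(LINT w|slice_measure. hk (slice_point 0 w) 0 t) = 1 / sqrt (4 * pi * t)"
  proof (rule integral_eq_nn_integral[THEN trans])
    show "enn2real (\<integral>\<^sup>+w. ennreal (hk (slice_point 0 w) 0 t) \<partial>slice_measure) = 1 / sqrt (4 * pi * t)"
      using heat_slice_0[OF t] t by (simp add: heat_slice_def slice_integral_def)
  qed (auto simp: hk_nonneg[OF t])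
  then show ?thesis
    by (simp add: slice_point_def)
qed

lemma integral_moment:
  assumes t: "0 < t" and p: "1 \<le> p"
  shows "(LINT g|lborel. hk g 0 t * \<bar>g \<bullet> dir\<bar> powr p) = t powr (p / 2) * (2 * Gamma p / Gamma (p / 2))"
proof -
  note [measurable] = borel_measurable_hk[OF t]
  have "(LINT g|lborel. hk g 0 t * \<bar>g \<bullet> dir\<bar> powr p) = (LINT g|lborel. hk 0 g t * \<bar>g \<bullet> dir\<bar> powr p)"
    by (simp add: hk_sym[OF t, of 0])
  also have "\<dots> = (LINT x|law t. \<bar>x\<bar> powr p)"
    unfolding law_def by (subst integral_distr) (auto simp: integral_density hk_nonneg[OF t])
  also have "\<dots> = t powr (p / 2) * (2 * Gamma p / Gamma (p / 2))"
    unfolding law_eq[OF t] by (rule normal_abs_moment[OF t p])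
  finally show ?thesis .
qed

end

theorem lemma4p3:
  fixes gmul :: "'a::euclidean_space \<Rightarrow> 'a \<Rightarrow> 'a"
    and V :: "nat \<Rightarrow> 'a set"
    and r :: nat
    and e :: "'m::finite \<Rightarrow> 'a"
    and P :: "real \<Rightarrow> ('a \<Rightarrow> real) \<Rightarrow> 'a \<Rightarrow> real"
    and hk :: "'a \<Rightarrow> 'a \<Rightarrow> real \<Rightarrow> real"
    and p t :: real
    and \<nu> :: "real ^ 'm"
  assumes "carnot_group gmul V r e"
    and "heat_semigroup gmul e P"
    and "heat_kernel P hk"
    and "1 \<le> p"
    and "norm \<nu> = 1"
    and "0 < t"
  shows "1 / t powr (p / 2) *
           (LINT g|lborel. hk g 0 t * \<bar>\<nu> \<bullet> horizontal_coord e g\<bar> powr p)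
         = 2 * Gamma p / Gamma (p / 2) \<and>
         sqrt (4 * pi * t) *
           (LINT w|(subspace_lborel {z. z \<bullet> \<nu> = 0} \<Otimes>\<^sub>M
                    subspace_lborel (vertical_space V r)).
              hk (from_coord e (fst w) (snd w)) 0 t)
         = 1"
proof -
  interpret carnot_heat_direction gmul V r e P hk \<nu>
    using assms
    by (simp add: carnot_heat_direction_def carnot_heat_direction_axioms_def carnot_heat_def carnot_heat_axioms_def)
  show ?thesis
    using assms(4,6) by (simp add: inner_dir integral_moment integral_slice)
qed

end
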